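(* Given an input graph $G=(V,E,\vec{W})$ with $n$ vertices and $m$ edges and privacy parameters $\varepsilon,\delta>0$, the Private Kruskal algorithm (defined in the context) runs in $O(m + n\log n)$ time, is $(\varepsilon,\delta)$-differentially private, and returns an approximately minimum spanning tree $\mathcal{M}(G)$ such that, if $T^*$ is a minimum spanning tree of $G$, $$\mathbb{E}\left[\sum_{e \in \mathcal{M}(G)} w_e\right] - \sum_{e\in T^*} w_e \in O\left(\frac{1}{\varepsilon}\cdot n^{3/2}\cdot \log n\cdot\sqrt{\log(1/\delta)}\right).$$
   Context: A graph $G = (V, E, \vec{W})$ has public vertex set $V=\{1,\dots,n\}$, public undirected edge set $E$ with $|E|=m$, and private weights $\vec{W}=(w_e)_{e\in E}\in\mathbb{R}^E$. Two graphs are neighboring if they have the same $V$ and $E$ and $\max_{e\in E}|w_e-w'_e|\le 1$. A randomized algorithm $\mathcal{M}$ outputting spanning trees is $(\varepsilon,\delta)$-differentially private if for all neighboring $G,G'$ and every set $Z$ of spanning trees, $\Pr[\mathcal{M}(G)\in Z]\le e^{\varepsilon}\Pr[\mathcal{M}(G')\in Z]+\delta$. The Private Kruskal algorithm on input $G$ and $(\varepsilon,\delta)$: set $\rho = \left(\sqrt{\varepsilon+\log(1/\delta)}-\sqrt{\log(1/\delta)}\right)^2$ and $\varepsilon' = \sqrt{2\rho/(n-1)}$; initialize $T\leftarrow\emptyset$, $F\leftarrow E$; for $i=1,\dots,n-1$: sample $e\in F$ with probability proportional to $e^{-\frac{\varepsilon'}{2}w_e}$, set $T\leftarrow T\cup\{e\}$,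 and set $F \leftarrow F\setminus\{e'\in F : \{e'\}\cup T \text{ contains a cycle}\}$; return $T$.
   Formalization: The error bound is proved for ε ≤ K·log(1/δ), with a constant depending only on the arbitrary K > 0; a constant uniform over all ε, δ > 0 is impossible (at δ = 1 the bound is 0 but the expected error can be positive). *)

theory Defs
  imports "HOL-Probability.Probability"
begin

section \<open>Weighted graphs and spanning trees\<close>

text \<open>An edge is the two-element set of its endpoints; only the values of \<open>weight\<close> on
  \<open>edges\<close> are meaningful.\<close>

record wgraph =
  nverts :: nat
  edges :: "nat set set"
  weight :: "nat set \<Rightarrow> real"

definition verts :: "wgraph \<Rightarrow> nat set" where
  "verts G = {1..nverts G}"

definition connects :: "nat set set \<Rightarrow> nat set \<Rightarrow> bool" where
  "connects A V \<longleftrightarrow> (\<forall>u\<in>V. \<forall>v\<in>V. (u, v) \<in> {(x, y). {x, y} \<in> A}\<^sup>*)"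

text \<open>Connectedness is part of being an input graph, since otherwise there is no spanning tree.\<close>

definition input_graph :: "wgraph \<Rightarrow> bool" where
  "input_graph G \<longleftrightarrow> nverts G \<ge> 1 \<and>
     edges G \<subseteq> {{u, v} | u v. u \<in> verts G \<and> v \<in> verts G \<and> u \<noteq> v} \<and>
     connects (edges G) (verts G)"

definition contains_cycle :: "nat set set \<Rightarrow> bool" where
  "contains_cycle A \<longleftrightarrow> (\<exists>vs. length vs \<ge> 3 \<and> distinct vs \<and>
     (\<forall>i < length vs. {vs ! i, vs ! (Suc i mod length vs)} \<in> A))"

definition spanning_trees :: "wgraph \<Rightarrow> nat set set set" where
  "spanning_trees G = {T. T \<subseteq> edges G \<and> connects T (verts G) \<and> \<not> contains_cycle T}"

definition total_weight :: "wgraph \<Rightarrow> nat set set \<Rightarrow> real" where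
  "total_weight G T = (\<Sum>e\<in>T. weight G e)"

definition is_mst :: "wgraph \<Rightarrow> nat set set \<Rightarrow> bool" where
  "is_mst G T \<longleftrightarrow> T \<in> spanning_trees G \<and>
     (\<forall>T' \<in> spanning_trees G. total_weight G T \<le> total_weight G T')"


section \<open>Differential privacy\<close>

definition neighboring :: "wgraph \<Rightarrow> wgraph \<Rightarrow> bool" where
  "neighboring G G' \<longleftrightarrow> nverts G = nverts G' \<and> edges G = edges G' \<and>
     (\<forall>e \<in> edges G. \<bar>weight G e - weight G' e\<bar> \<le> 1)"

definition differentially_private ::
    "real \<Rightarrow> real \<Rightarrow> (wgraph \<Rightarrow> nat set set pmf) \<Rightarrow> bool" where
  "differentially_private \<epsilon> \<delta> M \<longleftrightarrow>
     (\<forall>G G'. input_graph G \<longrightarrow> input_graph G' \<longrightarrow> neighboring G G' \<longrightarrow>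
       (\<forall>Z \<subseteq> spanning_trees G.
          measure_pmf.prob (M G) Z \<le> exp \<epsilon> * measure_pmf.prob (M G') Z + \<delta>))"


section \<open>Private Kruskal\<close>

text \<open>The distribution on a finite nonempty set \<open>F\<close> with probabilities proportional to \<open>g\<close>.\<close>

definition proportional_pmf :: "'a set \<Rightarrow> ('a \<Rightarrow> real) \<Rightarrow> 'a pmf" where
  "proportional_pmf F g = embed_pmf (\<lambda>x. if x \<in> F then g x / (\<Sum>y\<in>F. g y) else 0)"

lemma pmf_proportional_pmf:
  assumes "finite F" "F \<noteq> {}" "\<And>x. x \<in> F \<Longrightarrow> g x > 0"
  shows "pmf (proportional_pmf F g) x = (if x \<in> F then g x / (\<Sum>y\<in>F. g y) else 0)"
proof -
  have pos: "(\<Sum>y\<in>F. g y) > 0"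
    using assms by (intro sum_pos) auto
  let ?f = "\<lambda>x. if x \<in> F then g x / (\<Sum>y\<in>F. g y) else 0"
  have nonneg: "?f x \<ge> 0" for x
    using pos assms(3)[of x] by auto
  have "(\<integral>\<^sup>+x. ennreal (?f x) \<partial>count_space UNIV)
      = (\<integral>\<^sup>+x. ennreal (g x / (\<Sum>y\<in>F. g y)) \<partial>count_space F)"
    by (subst nn_integral_count_space_indicator)
       (auto intro!: nn_integral_cong simp: indicator_def)
  also have "\<dots> = (\<Sum>x\<in>F. ennreal (g x / (\<Sum>y\<in>F. g y)))"
    using assms(1) by (simp add: nn_integral_count_space_finite)
  also have "\<dots> = ennreal (\<Sum>x\<in>F. g x / (\<Sum>y\<in>F. g y))"
    using pos assms(3) by (intro sum_ennreal) (auto intro!: divide_nonneg_pos less_imp_le)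
  also have "\<dots> = 1"
    using pos by (simp flip: sum_divide_distrib)
  finally show ?thesis
    unfolding proportional_pmf_def by (intro pmf_embed_pmf nonneg)
qed

text \<open>With \<open>\<delta> > 1\<close> these are the values of HOL's total \<^const>\<open>sqrt\<close>, which is odd on negative
  arguments.\<close>

definition rho_param :: "real \<Rightarrow> real \<Rightarrow> real" where
  "rho_param \<epsilon> \<delta> = (sqrt (\<epsilon> + ln (1 / \<delta>)) - sqrt (ln (1 / \<delta>)))\<^sup>2"

definition eps_step :: "nat \<Rightarrow> real \<Rightarrow> real \<Rightarrow> real" where
  "eps_step n \<epsilon> \<delta> = sqrt (2 * rho_param \<epsilon> \<delta> / (real n - 1))"

text \<open>\<open>kruskal_loop w \<epsilon>' k T F\<close> performs \<open>k\<close> further iterations. Edges of the tree built so far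
  leave \<open>F\<close> explicitly: a chosen edge \<open>e\<close> and a second copy of it form a (degenerate) cycle, but
  as sets \<open>{e} \<union> T = T\<close>, so that the cycle test alone would not remove \<open>e\<close>.\<close>

fun kruskal_loop ::
    "(nat set \<Rightarrow> real) \<Rightarrow> real \<Rightarrow> nat \<Rightarrow> nat set set \<Rightarrow> nat set set \<Rightarrow> nat set set pmf" where
  "kruskal_loop w \<epsilon>' 0 T F = return_pmf T"
| "kruskal_loop w \<epsilon>' (Suc k) T F =
     bind_pmf (proportional_pmf F (\<lambda>e. exp (- (\<epsilon>' / 2) * w e)))
       (\<lambda>e. let T' = T \<union> {e} in
          kruskal_loop w \<epsilon>' k T' (F - T' - {e' \<in> F. contains_cycle ({e'} \<union> T')}))"

definition private_kruskal :: "real \<Rightarrow> real \<Rightarrow> wgraph \<Rightarrow> nat set set pmf" where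
  "private_kruskal \<epsilon> \<delta> G =
     kruskal_loop (weight G) (eps_step (nverts G) \<epsilon> \<delta>) (nverts G - 1) {} (edges G)"


section \<open>Cost model: a randomized unit-cost real RAM\<close>

text \<open>Programs work on finitely many named unbounded arrays of naturals and of reals (a scalar is
  a cell of an array). Naturals admit only addition and truncated subtraction, and there is no way
  from reals to naturals except comparisons, so unit cost is the usual convention. As a program is
  fixed, its expressions have bounded size and evaluating one is charged a single unit.\<close>

datatype nexp =
    NLit nat
  | NGet nat nexp
  | NAdd nexp nexp
  | NSub nexp nexp

datatype rexp =
    RNat nexp
  | RGet nat nexp
  | RAdd rexp rexp
  | RSub rexp rexp
  | RMul rexp rexp
  | RDiv rexp rexp
  | RExp rexp
  | RLn rexp
  | RSqrt rexp

datatype bexp =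
    NLess nexp nexp
  | RLess rexp rexp
  | BNot bexp
  | BAnd bexp bexp

datatype com =
    Skip
  | NSet nat nexp nexp
  | RSet nat nexp rexp
  | Sample nat nexp
  | Seq com com
  | If bexp com com
  | While bexp com

text \<open>\<open>nmem s a i\<close> is cell \<open>i\<close> of array \<open>a\<close>; \<open>drawn\<close> is the number of random reals consumed.\<close>

record ram_state =
  nmem :: "nat \<Rightarrow> nat \<Rightarrow> nat"
  rmem :: "nat \<Rightarrow> nat \<Rightarrow> real"
  drawn :: nat

fun nval :: "nexp \<Rightarrow> ram_state \<Rightarrow> nat" where
  "nval (NLit k) s = k"
| "nval (NGet a i) s = nmem s a (nval i s)"
| "nval (NAdd x y) s = nval x s + nval y s"
| "nval (NSub x y) s = nval x s - nval y s"

fun rval :: "rexp \<Rightarrow> ram_state \<Rightarrow> real" where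
  "rval (RNat x) s = real (nval x s)"
| "rval (RGet a i) s = rmem s a (nval i s)"
| "rval (RAdd x y) s = rval x s + rval y s"
| "rval (RSub x y) s = rval x s - rval y s"
| "rval (RMul x y) s = rval x s * rval y s"
| "rval (RDiv x y) s = rval x s / rval y s"
| "rval (RExp x) s = exp (rval x s)"
| "rval (RLn x) s = ln (rval x s)"
| "rval (RSqrt x) s = sqrt (rval x s)"

fun bval :: "bexp \<Rightarrow> ram_state \<Rightarrow> bool" where
  "bval (NLess x y) s \<longleftrightarrow> nval x s < nval y s"
| "bval (RLess x y) s \<longleftrightarrow> rval x s < rval y s"
| "bval (BNot b) s \<longleftrightarrow> \<not> bval b s"
| "bval (BAnd b c) s \<longleftrightarrow> bval b s \<and> bval c s"

definition nwrite :: "nat \<Rightarrow> nat \<Rightarrow> nat \<Rightarrow> ram_state \<Rightarrow> ram_state" where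
  "nwrite a i x s = s\<lparr>nmem := (nmem s)(a := (nmem s a)(i := x))\<rparr>"

definition rwrite :: "nat \<Rightarrow> nat \<Rightarrow> real \<Rightarrow> ram_state \<Rightarrow> ram_state" where
  "rwrite a i x s = s\<lparr>rmem := (rmem s)(a := (rmem s a)(i := x))\<rparr>"

text \<open>\<open>runs \<omega> c s t s'\<close>: on the random tape \<open>\<omega>\<close>, program \<open>c\<close> started in \<open>s\<close> halts in \<open>s'\<close> after
  \<open>t\<close> steps.\<close>

inductive runs :: "(nat \<Rightarrow> real) \<Rightarrow> com \<Rightarrow> ram_state \<Rightarrow> nat \<Rightarrow> ram_state \<Rightarrow> bool"
  for \<omega> :: "nat \<Rightarrow> real" where
  Skip: "runs \<omega> Skip s 1 s"
| NSet: "runs \<omega> (NSet a i x) s 1 (nwrite a (nval i s) (nval x s) s)"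
| RSet: "runs \<omega> (RSet a i x) s 1 (rwrite a (nval i s) (rval x s) s)"
| Sample: "runs \<omega> (Sample a i) s 1
     ((rwrite a (nval i s) (\<omega> (drawn s)) s)\<lparr>drawn := Suc (drawn s)\<rparr>)"
| Seq: "runs \<omega> c s t s' \<Longrightarrow> runs \<omega> c' s' t' s'' \<Longrightarrow> runs \<omega> (Seq c c') s (t + t') s''"
| IfTrue: "bval b s \<Longrightarrow> runs \<omega> c s t s' \<Longrightarrow> runs \<omega> (If b c c') s (Suc t) s'"
| IfFalse: "\<not> bval b s \<Longrightarrow> runs \<omega> c' s t s' \<Longrightarrow> runs \<omega> (If b c c') s (Suc t) s'"
| WhileFalse: "\<not> bval b s \<Longrightarrow> runs \<omega> (While b c) s 1 s"
| WhileTrue: "bval b s \<Longrightarrow> runs \<omega> c s t s' \<Longrightarrow> runs \<omega> (While b c) s' t' s'' \<Longrightarrow>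
     runs \<omega> (While b c) s (Suc (t + t')) s''"

text \<open>A random tape consists of independent reals uniform on the open unit interval.\<close>

definition tape_measure :: "(nat \<Rightarrow> real) measure" where
  "tape_measure = PiM UNIV (\<lambda>_. uniform_measure lborel {0<..<1})"

definition valid_tape :: "(nat \<Rightarrow> real) \<Rightarrow> bool" where
  "valid_tape \<omega> \<longleftrightarrow> (\<forall>i. 0 < \<omega> i \<and> \<omega> i < 1)"

text \<open>A graph is given to a program as a list of its edges in any order and orientation.\<close>

definition edge_listing :: "wgraph \<Rightarrow> (nat \<times> nat) list \<Rightarrow> bool" where
  "edge_listing G es \<longleftrightarrow>
     distinct (map (\<lambda>(u, v). {u, v}) es) \<and> set (map (\<lambda>(u, v). {u, v}) es) = edges G"

text \<open>Natural arrays: 0 holds \<open>n\<close> and \<open>m\<close>, 1 and 2 the two endpoints of each edge. Real arrays: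
  0 holds \<open>\<epsilon>\<close> and \<open>\<delta>\<close>, 1 the edge weights. All other cells are 0.\<close>

definition input_state :: "real \<Rightarrow> real \<Rightarrow> wgraph \<Rightarrow> (nat \<times> nat) list \<Rightarrow> ram_state" where
  "input_state \<epsilon> \<delta> G es = \<lparr>
     nmem = (\<lambda>a i.
       if a = 0 \<and> i = 0 then nverts G
       else if a = 0 \<and> i = 1 then length es
       else if a = 1 \<and> i < length es then fst (es ! i)
       else if a = 2 \<and> i < length es then snd (es ! i)
       else 0),
     rmem = (\<lambda>a i.
       if a = 0 \<and> i = 0 then \<epsilon>
       else if a = 0 \<and> i = 1 then \<delta>
       else if a = 1 \<and> i < length es then weight G {fst (es ! i), snd (es ! i)}
       else 0),
     drawn = 0\<rparr>"

text \<open>The output is read off as \<open>n - 1\<close> edges whose endpoints are in the natural arrays 3 and 4.\<close>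

definition output_edges :: "wgraph \<Rightarrow> ram_state \<Rightarrow> nat set set" where
  "output_edges G s = {{nmem s 3 j, nmem s 4 j} | j. j < nverts G - 1}"

text \<open>On every edge listing of \<open>G\<close>, program \<open>P\<close> halts within \<open>t\<close> steps for every random tape, and
  its output has distribution \<open>D\<close>. The values of \<open>out\<close> off the valid tapes, a null set, are
  irrelevant.\<close>

definition samples_within ::
    "com \<Rightarrow> real \<Rightarrow> real \<Rightarrow> wgraph \<Rightarrow> nat set set pmf \<Rightarrow> real \<Rightarrow> bool" where
  "samples_within P \<epsilon> \<delta> G D t \<longleftrightarrow>
     (\<forall>es. edge_listing G es \<longrightarrow>
       (\<exists>out \<in> tape_measure \<rightarrow>\<^sub>M count_space UNIV.
          (\<forall>\<omega>. valid_tape \<omega> \<longrightarrow>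
             (\<exists>k s. runs \<omega> P (input_state \<epsilon> \<delta> G es) k s \<and> real k \<le> t \<and>
                    output_edges G s = out \<omega>)) \<and>
          distr tape_measure (count_space UNIV) out = measure_pmf D))"

end

theory Submission
  imports Defs
begin

text \<open>Privacy: the output probabilities on two neighbouring graphs satisfy \<open>P Z \<le> D ^ k * Q Z powr ((\<alpha> - 1) / \<alpha>)\<close>
  for \<open>k\<close> selections. By Hoelder's inequality this form is stable under adaptive composition, and one selection
  obeys it because its privacy loss lies in an interval of length \<open>\<epsilon>'\<close>, to which Hoeffding's lemma
  applies. Optimising \<open>\<alpha>\<close> gives \<open>(\<epsilon>, \<delta>)\<close>.

  Utility: a minimum spanning tree is exchanged edge by edge for the chosen edges. Each exchange costs at most the
  expected excess of a Gibbs sample over the minimum, which the entropy bounds by \<open>2 / \<epsilon>' * ln m\<close>.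

  Running time: give every edge an independent exponential clock of rate \<open>exp (- \<epsilon>' / 2 * w e)\<close>. The first
  clock to ring among the admissible edges is distributed as in the exponential mechanism, and by memorylessness
  this remains so after each selection; hence the output has the law of the minimum spanning tree
  with respect to the ringing times. That tree is computed by Prim's algorithm. A hollow heap has constant
  amortised insertion and decrease-key and logarithmic extraction, which yields \<open>O(m + n log n)\<close> on every tape.\<close>

section \<open>Forests and spanning trees\<close>

text \<open>Executed naively, the loop renormalises over a changing set in every round. Drawing all
  randomness in advance removes the rounds: what remains to compute is a tree that depends on one
  linear order of the edges only. That tree is characterised in \<open>msf\<close> without reference
  to an algorithm. The greedy run, whose law is known, and Prim's run, whose cost is known, are each
  compared with it and never with each other. As the time bound has to hold on every tape,
  expected-time methods are excluded and equal clocks cannot be discarded as a null set. Hollow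
  heaps fit because a decrease makes a new node instead of cutting an old one out of its tree, so
  there are no parent pointers and no cascading cuts. Each new node is a newly scanned edge, hence
  at most m nodes ever arise. In the privacy part the event \<open>Z\<close> stays fixed, so that
  two real numbers per loop state are compared and no likelihood ratio on trees is formed.\<close>

definition reach :: "nat set set \<Rightarrow> (nat \<times> nat) set" where
  "reach A = {(x, y). {x, y} \<in> A}\<^sup>*"

lemma reach_refl [simp]: "(x, x) \<in> reach A"
  by (simp add: reach_def)

lemma reach_trans: "(x, y) \<in> reach A \<Longrightarrow> (y, z) \<in> reach A \<Longrightarrow> (x, z) \<in> reach A"
  unfolding reach_def by (rule rtrancl_trans)

lemma reach_sym: "(x, y) \<in> reach A \<Longrightarrow> (y, x) \<in> reach A"
proof -
  have "sym {(x, y). {x, y} \<in> A}"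
    by (auto simp: sym_def insert_commute)
  then show "(x, y) \<in> reach A \<Longrightarrow> (y, x) \<in> reach A"
    unfolding reach_def by (metis sym_rtrancl symD)
qed

lemma reach_mono: "A \<subseteq> B \<Longrightarrow> reach A \<subseteq> reach B"
  unfolding reach_def by (rule rtrancl_mono) auto

lemma reach_edge: "{x, y} \<in> A \<Longrightarrow> (x, y) \<in> reach A"
  unfolding reach_def by auto

lemma reach_induct [consumes 1, case_names refl step]:
  assumes "(x, y) \<in> reach A" "P x"
    "\<And>y z. (x, y) \<in> reach A \<Longrightarrow> {y, z} \<in> A \<Longrightarrow> P y \<Longrightarrow> P z"
  shows "P y"
  using assms(1) unfolding reach_def
  by (induction rule: rtrancl_induct) (use assms in \<open>auto simp: reach_def\<close>)

lemma reach_empty: "(x, y) \<in> reach {} \<Longrightarrow> x = y"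
  by (auto simp: reach_def)

lemma reach_insert:
  "(x, y) \<in> reach (insert {u, v} A) \<longleftrightarrow> (x, y) \<in> reach A \<or>
     (x, u) \<in> reach A \<and> (v, y) \<in> reach A \<or> (x, v) \<in> reach A \<and> (u, y) \<in> reach A"
  (is "?l \<longleftrightarrow> ?r x y")
proof
  assume ?l
  then show "?r x y"
  proof (induction rule: reach_induct)
    case refl
    then show ?case by simp
  next
    case (step y z)
    then consider "{y, z} \<in> A" | "y = u" "z = v" | "y = v" "z = u"
      by (auto simp: doubleton_eq_iff)
    then show ?case
    proof cases
      case 1
      then have "(y, z) \<in> reach A"
        by (rule reach_edge)
      then show ?thesis
        using step.IH by (meson reach_trans)
    qed (use step.IH in \<open>auto intro: reach_sym\<close>)
  qed
next
  have m: "(a, b) \<in> reach A \<Longrightarrow> (a, b) \<in> reach (insert {u, v} A)" for a b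
    using reach_mono[of A "insert {u, v} A"] by auto
  have e: "(u, v) \<in> reach (insert {u, v} A)" "(v, u) \<in> reach (insert {u, v} A)"
    by (auto intro: reach_edge simp: insert_commute)
  show "?r x y \<Longrightarrow> ?l"
    by (meson m e reach_trans)
qed

lemma reach_minimal:
  assumes "(x, y) \<in> reach A" "\<And>u v. {u, v} \<in> A \<Longrightarrow> (u, v) \<in> reach B"
  shows "(x, y) \<in> reach B"
  using assms(1)
  by (induction rule: reach_induct) (use assms(2) reach_trans in \<open>auto\<close>)

lemma reach_distinct_path:
  assumes "(x, y) \<in> reach A"
  shows "\<exists>vs. vs \<noteq> [] \<and> distinct vs \<and> hd vs = x \<and> last vs = y \<and>
    (\<forall>i. Suc i < length vs \<longrightarrow> {vs ! i, vs ! Suc i} \<in> A)"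
  using assms
proof (induction rule: reach_induct)
  case refl
  show ?case
    by (rule exI[of _ "[x]"]) auto
next
  case (step y z)
  from step.IH obtain vs where vs: "vs \<noteq> []" "distinct vs" "hd vs = x" "last vs = y"
    and vs': "\<forall>i. Suc i < length vs \<longrightarrow> {vs ! i, vs ! Suc i} \<in> A"
    by (elim exE conjE)
  note vs = vs vs'[rule_format]
  show ?case
  proof (cases "z \<in> set vs")
    case True
    then obtain i where i: "i < length vs" "vs ! i = z"
      by (auto simp: in_set_conv_nth)
    \<comment> \<open>A walk that returns to a vertex is cut back to its earlier visit, which keeps
      the list distinct.\<close>
    show ?thesis
    proof (intro exI[of _ "take (Suc i) vs"] conjI)
      show "last (take (Suc i) vs) = z"
        using i by (simp add: take_Suc_conv_app_nth)
      show "hd (take (Suc i) vs) = x"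
        using vs(1,3) by (cases vs) auto
      show "\<forall>j. Suc j < length (take (Suc i) vs) \<longrightarrow> {take (Suc i) vs ! j, take (Suc i) vs ! Suc j} \<in> A"
        using vs(5) by simp
    qed (use vs(1,2) in simp_all)
  next
    case False
    have "{(vs @ [z]) ! i, (vs @ [z]) ! Suc i} \<in> A" if "Suc i < length (vs @ [z])" for i
    proof (cases "Suc i < length vs")
      case True
      then show ?thesis using vs(5) by (auto simp: nth_append)
    next
      case False
      then have "i = length vs - 1" using that by auto
      then show ?thesis
        using that vs(1,4) step(2) False by (auto simp: nth_append last_conv_nth)
    qed
    then show ?thesis
      by (intro exI[of _ "vs @ [z]"]) (use vs False in auto)
  qed
qed

lemma reach_path:
  assumes "\<And>i. Suc i < length vs \<Longrightarrow> {vs ! i, vs ! Suc i} \<in> A" "j < length vs"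
  shows "(vs ! 0, vs ! j) \<in> reach A"
  using assms(2)
proof (induction j)
  case (Suc j)
  then show ?case
    using assms(1)[of j] reach_edge reach_trans by (metis Suc_lessD)
qed simp

text \<open>Every edge is a bridge. This form of acyclicity can be handled by reachability alone,
  without vertex lists. Loops are exempt, in accordance with the minimal length 3 in
  \<open>contains_cycle\<close>.\<close>

definition forest :: "nat set set \<Rightarrow> bool" where
  "forest A \<longleftrightarrow> (\<forall>u v. {u, v} \<in> A \<longrightarrow> u \<noteq> v \<longrightarrow> (u, v) \<notin> reach (A - {{u, v}}))"

text \<open>The closing edge of a cycle is bypassed by the remaining ones. Conversely, a simple path
  around an edge closes up to a cycle: one vertex is impossible as the ends differ, and two would
  use the removed edge.\<close>

lemma forest_iff_acyclic: "forest A \<longleftrightarrow> \<not> contains_cycle A"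
proof (intro iffI notI)
  assume f: "forest A" and "contains_cycle A"
  then obtain vs where vs: "length vs \<ge> 3" "distinct vs"
    and vs': "\<forall>i < length vs. {vs ! i, vs ! (Suc i mod length vs)} \<in> A"
    unfolding contains_cycle_def by (elim exE conjE)
  note vs = vs vs'[rule_format]
  define l where "l = length vs - 1"
  have l: "Suc l = length vs" "l \<ge> 2" using vs(1) by (auto simp: l_def)
  have e: "{vs ! 0, vs ! l} \<in> A"
    using vs(3)[of l] l by (auto simp: insert_commute)
  have ne: "vs ! 0 \<noteq> vs ! l"
    using nth_eq_iff_index_eq[OF vs(2), of 0 l] l by linarith
  have "{vs ! i, vs ! Suc i} \<in> A - {{vs ! 0, vs ! l}}" if "Suc i < length vs" for i
  proof -
    have "{vs ! i, vs ! Suc i} \<in> A"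
      using vs(3)[of i] that by auto
    moreover have "{vs ! i, vs ! Suc i} \<noteq> {vs ! 0, vs ! l}"
      using that l nth_eq_iff_index_eq[OF vs(2), of i 0] nth_eq_iff_index_eq[OF vs(2), of i l]
        nth_eq_iff_index_eq[OF vs(2), of "Suc i" 0] nth_eq_iff_index_eq[OF vs(2), of "Suc i" l]
      unfolding doubleton_eq_iff by linarith
    ultimately show ?thesis by auto
  qed
  then have "(vs ! 0, vs ! l) \<in> reach (A - {{vs ! 0, vs ! l}})"
    using l by (intro reach_path) auto
  then show False
    using f e ne unfolding forest_def by blast
next
  assume nc: "\<not> contains_cycle A"
  show "forest A"
    unfolding forest_def
  proof (intro allI impI notI)
    fix u v
    assume e: "{u, v} \<in> A" "u \<noteq> v" "(u, v) \<in> reach (A - {{u, v}})"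
    from reach_distinct_path[OF e(3)] obtain vs where vs: "vs \<noteq> []" "distinct vs" "hd vs = u" "last vs = v"
      "\<And>i. Suc i < length vs \<Longrightarrow> {vs ! i, vs ! Suc i} \<in> A - {{u, v}}"
      by blast
    have "length vs \<noteq> 1"
      using vs(3,4) e(2) by (cases vs) auto
    moreover have "length vs \<noteq> 2"
    proof
      assume "length vs = 2"
      then show False
        using vs(5)[of 0] hd_conv_nth[OF vs(1)] last_conv_nth[OF vs(1)] vs(3,4) by simp
    qed
    ultimately have l: "length vs \<ge> 3"
      using vs(1) by (cases "length vs"; cases "length vs - 1"; cases "length vs - 2") auto
    have "{vs ! i, vs ! (Suc i mod length vs)} \<in> A" if "i < length vs" for i
    proof (cases "Suc i < length vs")
      case True
      then show ?thesis using vs(5) by auto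
    next
      case False
      then have "i = length vs - 1" "Suc i = length vs" using that by auto
      then show ?thesis
        using vs e(1) by (auto simp: last_conv_nth hd_conv_nth insert_commute)
    qed
    then show False
      using nc l vs(2) unfolding contains_cycle_def by blast
  qed
qed

lemma forest_subset: "forest A \<Longrightarrow> B \<subseteq> A \<Longrightarrow> forest B"
  unfolding forest_iff_acyclic contains_cycle_def by blast

lemma forest_insert:
  assumes "u \<noteq> v" "{u, v} \<notin> A"
  shows "forest (insert {u, v} A) \<longleftrightarrow> forest A \<and> (u, v) \<notin> reach A"
proof
  assume f: "forest (insert {u, v} A)"
  then show "forest A \<and> (u, v) \<notin> reach A"
    using assms forest_subset[OF f] unfolding forest_def
    by (metis Diff_insert_absorb insertI1 subset_insertI)
next
  assume f: "forest A \<and> (u, v) \<notin> reach A"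
  show "forest (insert {u, v} A)"
    unfolding forest_def
  proof (intro allI impI notI)
    fix x y
    assume xy: "{x, y} \<in> insert {u, v} A" "x \<noteq> y" "(x, y) \<in> reach (insert {u, v} A - {{x, y}})"
    show False
    proof (cases "{x, y} = {u, v}")
      case True
      then have "(x, y) \<in> reach A"
        using xy(3) assms(2) by simp
      then show False
        using True f reach_sym by (auto simp: doubleton_eq_iff)
    next
      case False
      then have in_A: "{x, y} \<in> A" using xy(1) by auto
      \<comment> \<open>\<open>{x, y}\<close> is a bridge of \<open>A\<close>, so a detour around it
        must pass through \<open>{u, v}\<close>. The rest of the detour together with
        \<open>{x, y}\<close> then joins \<open>u\<close> and \<open>v\<close> inside
        \<open>A\<close>.\<close>
      let ?A = "A - {{x, y}}"
      have "insert {u, v} A - {{x, y}} = insert {u, v} ?A"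
        using False by auto
      then have "(x, y) \<in> reach (insert {u, v} ?A)"
        using xy(3) by simp
      moreover have "(x, y) \<notin> reach ?A"
        using f in_A xy(2) unfolding forest_def by blast
      moreover have "reach ?A \<subseteq> reach A"
        by (rule reach_mono) auto
      moreover have "(x, y) \<in> reach A"
        using in_A by (rule reach_edge)
      ultimately have "(u, v) \<in> reach A"
        unfolding reach_insert by (meson reach_sym reach_trans subsetD)
      then show False using f by simp
    qed
  qed
qed

section \<open>Components and edge counts of forests\<close>

definition components :: "nat set set \<Rightarrow> nat set \<Rightarrow> nat set set" where
  "components A V = (\<lambda>v. reach A `` {v}) ` V"

definition simple_edges :: "nat set \<Rightarrow> nat set set" where
  "simple_edges V = {{u, v} | u v. u \<in> V \<and> v \<in> V \<and> u \<noteq> v}"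

lemma component_eq_iff: "reach A `` {u} = reach A `` {v} \<longleftrightarrow> (u, v) \<in> reach A"
proof
  assume "(u, v) \<in> reach A"
  then show "reach A `` {u} = reach A `` {v}"
    by (auto intro: reach_trans reach_sym)
next
  assume "reach A `` {u} = reach A `` {v}"
  moreover have "v \<in> reach A `` {v}" by simp
  ultimately show "(u, v) \<in> reach A" by blast
qed

lemma finite_simple_edges: "finite V \<Longrightarrow> finite (simple_edges V)"
  by (rule finite_subset[of _ "Pow V"]) (auto simp: simple_edges_def)

text \<open>Each edge added to a forest merges exactly two classes. The identity turns connectedness
  of a forest into a statement about its number of edges.\<close>

lemma card_components_forest:
  assumes "finite V" "forest A" "A \<subseteq> simple_edges V"
  shows "card (components A V) + card A = card V"
proof -
  have "finite A"
    using assms(1,3) finite_simple_edges finite_subset by blast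
  then show ?thesis
    using assms(2,3)
  proof (induction A)
    case empty
    have "components {} V = (\<lambda>v. {v}) ` V"
      unfolding components_def by (auto dest: reach_empty intro!: image_cong)
    then show ?case
      by (simp add: card_image)
  next
    case (insert e A)
    then obtain u v where uv: "e = {u, v}" "u \<in> V" "v \<in> V" "u \<noteq> v"
      by (auto simp: simple_edges_def)
    then have f: "forest A" "(u, v) \<notin> reach A"
      using insert.prems insert.hyps forest_insert by auto
    have IH: "card (components A V) + card A = card V"
      using insert f by auto
    let ?C = "\<lambda>x. reach A `` {x}" and ?C' = "\<lambda>x. reach (insert e A) `` {x}"
    have C': "?C' x = (if x \<in> ?C u \<union> ?C v then ?C u \<union> ?C v else ?C x)" for x
    proof (intro set_eqI)
      fix y
      have "(u, x) \<in> reach A \<longleftrightarrow> (x, u) \<in> reach A" "(v, x) \<in> reach A \<longleftrightarrow> (x, v) \<in> reach A"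
        by (auto intro: reach_sym)
      moreover have "(x, w) \<in> reach A \<Longrightarrow> (x, y) \<in> reach A \<longleftrightarrow> (w, y) \<in> reach A" for w
        by (meson reach_sym reach_trans)
      ultimately show "y \<in> ?C' x \<longleftrightarrow> y \<in> (if x \<in> ?C u \<union> ?C v then ?C u \<union> ?C v else ?C x)"
        by (auto simp: uv(1) reach_insert)
    qed
    have C1: "?C' x = ?C u \<union> ?C v" if "x \<in> ?C u \<union> ?C v" for x
      using C'[of x] unfolding if_P[OF that] .
    have C2: "?C' x = ?C x" if "x \<notin> ?C u \<union> ?C v" for x
      using C'[of x] unfolding if_not_P[OF that] .
    have "components (insert e A) V = insert (?C u \<union> ?C v) (components A V - {?C u, ?C v})"
      (is "?L = ?R")
    proof
      show "?L \<subseteq> ?R"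
      proof
        fix X assume "X \<in> ?L"
        then obtain x where x: "x \<in> V" "X = ?C' x" by (auto simp: components_def)
        show "X \<in> ?R"
        proof (cases "x \<in> ?C u \<union> ?C v")
          case True
          then show ?thesis unfolding x(2) C1[OF True] by blast
        next
          case False
          then have "?C x \<noteq> ?C u" "?C x \<noteq> ?C v"
            unfolding component_eq_iff using reach_sym by blast+
          then show ?thesis unfolding x(2) C2[OF False] components_def using x(1) by blast
        qed
      qed
      have "?C u \<union> ?C v \<in> ?L"
        unfolding components_def using C1[of u] uv(2) by (metis UnI1 Image_singleton_iff image_eqI reach_refl)
      moreover have "?C x \<in> ?L" if "x \<in> V" "?C x \<noteq> ?C u" "?C x \<noteq> ?C v" for x
      proof -
        have "x \<notin> ?C u \<union> ?C v"
          using that component_eq_iff[of A u x] component_eq_iff[of A v x] by blast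
        then have "?C' x = ?C x" by (rule C2)
        then show ?thesis using that(1) unfolding components_def by (metis imageI)
      qed
      ultimately show "?R \<subseteq> ?L"
        unfolding components_def[of A] by auto
    qed
    moreover have "?C u \<union> ?C v \<notin> components A V"
    proof
      assume "?C u \<union> ?C v \<in> components A V"
      then obtain x where "?C x = ?C u \<union> ?C v" by (auto simp: components_def)
      then have "(x, u) \<in> reach A" "(x, v) \<in> reach A"
        by (metis Image_singleton_iff UnI1 UnI2 reach_refl)+
      then have "(u, v) \<in> reach A" by (meson reach_sym reach_trans)
      then show False using f(2) by simp
    qed
    moreover have "?C u \<in> components A V" "?C v \<in> components A V" "?C u \<noteq> ?C v"
      using uv f(2) by (auto simp: components_def component_eq_iff)
    moreover have "finite (components A V)"
      using assms(1) by (simp add: components_def)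
    \<comment> \<open>Two classes are replaced by one; as at least two exist, the subtraction of
      naturals below is exact.\<close>
    moreover have "card {?C u, ?C v} \<le> card (components A V)"
      by (rule card_mono) (use calculation in auto)
    ultimately have "card (components (insert e A) V) = card (components A V) - 1"
      "card (components A V) \<ge> 2"
      by (auto simp: card_Diff_subset)
    then show ?case
      using IH insert.hyps by simp
  qed
qed

lemma connects_iff_components:
  assumes "V \<noteq> {}"
  shows "connects A V \<longleftrightarrow> card (components A V) = 1"
proof -
  have "connects A V \<longleftrightarrow> (\<forall>u\<in>V. \<forall>v\<in>V. (u, v) \<in> reach A)"
    by (simp add: connects_def reach_def)
  also have "\<dots> \<longleftrightarrow> is_singleton (components A V)"
  proof
    assume c: "\<forall>u\<in>V. \<forall>v\<in>V. (u, v) \<in> reach A"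
    obtain v where v: "v \<in> V" using assms by auto
    have "components A V = {reach A `` {v}}"
    proof -
      have "reach A `` {u} = reach A `` {v}" if "u \<in> V" for u
        unfolding component_eq_iff using c v that by blast
      then show ?thesis unfolding components_def using v by blast
    qed
    then show "is_singleton (components A V)" by (simp add: is_singleton_def)
  next
    assume "is_singleton (components A V)"
    then obtain X where "components A V = {X}" by (auto simp: is_singleton_def)
    then have "\<And>u. u \<in> V \<Longrightarrow> reach A `` {u} = X" by (auto simp: components_def)
    then show "\<forall>u\<in>V. \<forall>v\<in>V. (u, v) \<in> reach A" using component_eq_iff by metis
  qed
  finally show ?thesis by (simp add: is_singleton_altdef)
qed


section \<open>Spanning trees of an input graph and the states of Kruskal's loop\<close>

lemma input_graph_facts:
  assumes "input_graph G"
  shows "finite (verts G)" "verts G \<noteq> {}" "card (verts G) = nverts G" "nverts G \<ge> 1"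
    "edges G \<subseteq> simple_edges (verts G)" "finite (edges G)"
proof -
  show "finite (verts G)" "verts G \<noteq> {}" "card (verts G) = nverts G" "nverts G \<ge> 1"
    using assms by (auto simp: input_graph_def verts_def)
  show s: "edges G \<subseteq> simple_edges (verts G)"
    using assms by (simp add: input_graph_def simple_edges_def)
  show "finite (edges G)"
    by (rule finite_subset[OF s finite_simple_edges]) (simp add: verts_def)
qed

lemma input_graph_reach:
  assumes "input_graph G" "u \<in> verts G" "v \<in> verts G"
  shows "(u, v) \<in> reach (edges G)"
  using assms by (simp add: input_graph_def connects_def reach_def)

lemma edgeE:
  assumes "input_graph G" "e \<in> edges G"
  obtains u v where "e = {u, v}" "u \<in> verts G" "v \<in> verts G" "u \<noteq> v"
  using input_graph_facts(5)[OF assms(1)] assms(2) by (auto simp: simple_edges_def)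

text \<open>Trades connectedness for a cardinality, which the loop counter controls
  directly.\<close>

lemma spanning_trees_iff:
  assumes "input_graph G"
  shows "T \<in> spanning_trees G \<longleftrightarrow> T \<subseteq> edges G \<and> forest T \<and> card T = nverts G - 1"
proof -
  note f = input_graph_facts[OF assms]
  have "connects T (verts G) \<longleftrightarrow> card T = nverts G - 1" if "T \<subseteq> edges G" "forest T"
  proof -
    have "card (components T (verts G)) + card T = nverts G"
      using card_components_forest[OF f(1) that(2) subset_trans[OF that(1) f(5)]] f(3) by simp
    then show ?thesis
      using f(4) unfolding connects_iff_components[OF f(2)] by linarith
  qed
  then show ?thesis
    unfolding spanning_trees_def forest_iff_acyclic[symmetric] by blast
qed

text \<open>The loop invariant with \<open>k\<close> rounds to go. It determines \<open>F\<close>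
  from \<open>T\<close> alone, so the history of deletions can be forgotten.\<close>

definition kruskal_state :: "wgraph \<Rightarrow> nat \<Rightarrow> nat set set \<Rightarrow> nat set set \<Rightarrow> bool" where
  "kruskal_state G k T F \<longleftrightarrow> T \<subseteq> edges G \<and> forest T \<and> card T + k = nverts G - 1 \<and>
     F = {e \<in> edges G - T. forest (insert e T)}"

lemma forest_empty: "forest {}"
  by (simp add: forest_def)

lemma kruskal_state_init:
  assumes "input_graph G"
  shows "kruskal_state G (nverts G - 1) {} (edges G)"
proof -
  have "forest {e}" if e: "e \<in> edges G" for e
  proof -
    obtain u v where "e = {u, v}" "u \<noteq> v" using edgeE[OF assms e] by metis
    then show ?thesis
      using forest_insert[of u v "{}"] forest_empty reach_empty by auto
  qed
  then show ?thesis
    by (auto simp: kruskal_state_def forest_empty)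
qed

lemma kruskal_state_step:
  assumes "input_graph G" "kruskal_state G (Suc k) T F" "e \<in> F"
  shows "kruskal_state G k (T \<union> {e}) (F - (T \<union> {e}) - {e' \<in> F. contains_cycle ({e'} \<union> (T \<union> {e}))})"
proof -
  have st: "T \<subseteq> edges G" "card T + Suc k = nverts G - 1" and F: "F = {e \<in> edges G - T. forest (insert e T)}"
    using assms(2) unfolding kruskal_state_def by simp_all
  have "finite T"
    using st(1) input_graph_facts(6)[OF assms(1)] by (rule finite_subset)
  \<comment> \<open>Rejected edges stay rejected, since subsets of forests are forests; hence
    filtering the old \<open>F\<close> is as good as filtering all edges.\<close>
  moreover have "forest (insert e' T)" if "forest (insert e' (insert e T))" for e'
    by (rule forest_subset[OF that]) auto
  moreover have e: "e \<in> edges G" "e \<notin> T" "forest (insert e T)"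
    using assms(3) F by simp_all
  moreover have c: "contains_cycle A \<longleftrightarrow> \<not> forest A" for A
    by (simp add: forest_iff_acyclic)
  moreover have i: "{e'} \<union> (T \<union> {e}) = insert e' (insert e T)" "T \<union> {e} = insert e T" for e'
    by auto
  ultimately show ?thesis
    using st unfolding kruskal_state_def F c i by (intro conjI set_eqI) auto
qed

lemma kruskal_state_final:
  assumes "input_graph G" "kruskal_state G 0 T F"
  shows "T \<in> spanning_trees G"
  using assms by (simp add: spanning_trees_iff kruskal_state_def)

text \<open>If no edge were admissible, \<open>T\<close> would join the ends of every edge and thus
  span the graph with too few edges. Nonemptiness is what makes the sampling distribution well
  defined.\<close>

lemma kruskal_state_nonempty:
  assumes G: "input_graph G" and st: "kruskal_state G (Suc k) T F"
  shows "F \<noteq> {}"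
proof
  assume "F = {}"
  have "(u, v) \<in> reach T" if e: "{u, v} \<in> edges G" for u v
  proof (cases "{u, v} \<in> T")
    case True
    then show ?thesis by (rule reach_edge)
  next
    case False
    then have "\<not> forest (insert {u, v} T)"
      using st \<open>F = {}\<close> e by (auto simp: kruskal_state_def)
    moreover have "u \<noteq> v"
      using edgeE[OF G e] by (auto simp: doubleton_eq_iff)
    ultimately show ?thesis
      using forest_insert[OF _ False] st by (auto simp: kruskal_state_def)
  qed
  then have "(x, y) \<in> reach T" if "x \<in> verts G" "y \<in> verts G" for x y
    using reach_minimal[OF input_graph_reach[OF G that]] by blast
  then have "connects T (verts G)"
    by (simp add: connects_def reach_def)
  then have "T \<in> spanning_trees G"
    using st by (simp add: spanning_trees_def kruskal_state_def forest_iff_acyclic)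
  then show False
    using st by (simp add: spanning_trees_iff[OF G] kruskal_state_def)
qed

lemma kruskal_state_finite:
  "input_graph G \<Longrightarrow> kruskal_state G k T F \<Longrightarrow> finite F \<and> finite T"
  using input_graph_facts(6) finite_subset by (fastforce simp: kruskal_state_def)

text \<open>The edge to give up is found without following paths: take a maximal part of
  \<open>B\<close> that together with \<open>T\<close> still separates \<open>u\<close> from
  \<open>v\<close>. Any further edge \<open>b\<close> of \<open>B\<close> completes a connection,
  and as \<open>b\<close> is a bridge of the forest, there is no connection avoiding it.\<close>

lemma tree_exchange:
  assumes "forest (T \<union> B)" "finite B" "u \<noteq> v" "(u, v) \<notin> reach T" "(u, v) \<in> reach (T \<union> B)"
    and simple: "\<And>e. e \<in> B \<Longrightarrow> \<exists>x y. e = {x, y} \<and> x \<noteq> y"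
  shows "\<exists>b\<in>B. b \<notin> T \<and> (u, v) \<notin> reach (T \<union> B - {b})"
proof -
  let ?P = "\<lambda>B0. B0 \<subseteq> B \<and> (u, v) \<notin> reach (T \<union> B0)"
  have fin: "finite {B0. ?P B0}"
    using assms(2) by simp
  have "{B0. ?P B0} \<noteq> {}"
    using assms(4) by (metis (mono_tags, lifting) Un_empty_right empty_iff empty_subsetI mem_Collect_eq)
  from finite_has_maximal[OF fin this] obtain B0
    where B0': "B0 \<in> {B0. ?P B0}" and max': "\<forall>B1\<in>{B0. ?P B0}. B0 \<subseteq> B1 \<longrightarrow> B0 = B1"
    by (elim bexE)
  have B0: "?P B0"
    using B0' by (rule CollectD)
  have max: "B0 = B1" if "?P B1" "B0 \<subseteq> B1" for B1
    using max' that(2) CollectI[of ?P, OF that(1)] by blast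
  have "B0 \<noteq> B" using B0 assms(5) by blast
  then obtain b where b: "b \<in> B" "b \<notin> B0" using B0 by blast
  have u: "(u, v) \<in> reach (insert b (T \<union> B0))"
    using max[of "insert b B0"] B0 b by (metis Un_insert_right insertI1 insert_subset subset_insertI)
  have "b \<notin> T"
    using u B0 by (metis insert_absorb UnI1)
  obtain x y where xy: "b = {x, y}" "x \<noteq> y" using simple b(1) by blast
  have sub: "reach (T \<union> B0) \<subseteq> reach (T \<union> B - {b})"
    by (rule reach_mono) (use B0 b \<open>b \<notin> T\<close> in auto)
  have "(x, y) \<notin> reach (T \<union> B - {b})"
    using assms(1) b(1) xy unfolding forest_def by blast
  moreover have "(x, y) \<in> reach (T \<union> B - {b})" if "(u, v) \<in> reach (T \<union> B - {b})"
    using u B0 sub that unfolding xy(1) reach_insert by (meson reach_sym reach_trans subsetD)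
  ultimately show ?thesis
    using b(1) \<open>b \<notin> T\<close> by blast
qed

text \<open>\<open>T\<close> holds the edges already chosen, so the edge given up must come from the
  completion \<open>B\<close>. If \<open>e\<close> is itself in \<open>B\<close>, it is exchanged
  for itself.\<close>

lemma spanning_tree_exchange:
  assumes G: "input_graph G" and TB: "T \<union> B \<in> spanning_trees G" "T \<inter> B = {}"
    and e: "e \<in> edges G" "e \<notin> T" "forest (insert e T)"
  shows "\<exists>b\<in>B. (T \<union> {e}) \<union> (B - {b}) \<in> spanning_trees G \<and> (T \<union> {e}) \<inter> (B - {b}) = {}"
proof (cases "e \<in> B")
  case True
  then have "(T \<union> {e}) \<union> (B - {e}) = T \<union> B" by auto
  then show ?thesis
    using True TB by (intro bexI[of _ e]) auto
next
  case False
  have st: "T \<union> B \<subseteq> edges G" "forest (T \<union> B)" "card (T \<union> B) = nverts G - 1"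
    using TB(1) by (simp_all add: spanning_trees_iff[OF G])
  have fin: "finite T" "finite B"
    using st(1) input_graph_facts(6)[OF G] by (auto intro: finite_subset)
  obtain u v where uv: "e = {u, v}" "u \<in> verts G" "v \<in> verts G" "u \<noteq> v"
    using edgeE[OF G e(1)] .
  have "\<exists>b\<in>B. b \<notin> T \<and> (u, v) \<notin> reach (T \<union> B - {b})"
  proof (rule tree_exchange[OF st(2) fin(2) uv(4)])
    show "(u, v) \<notin> reach T"
      using e(2,3) uv forest_insert by blast
    show "(u, v) \<in> reach (T \<union> B)"
      using TB(1) uv by (simp add: spanning_trees_def connects_def reach_def)
    show "\<exists>x y. e = {x, y} \<and> x \<noteq> y" if "e \<in> B" for e
      using edgeE[OF G] that st(1) by (metis UnI2 subsetD)
  qed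
  then obtain b where b: "b \<in> B" "b \<notin> T" "(u, v) \<notin> reach (T \<union> B - {b})" by blast
  have eq: "(T \<union> {e}) \<union> (B - {b}) = insert e (T \<union> B - {b})"
    using b by auto
  have notin: "e \<notin> T \<union> B - {b}"
    using e(2) False by auto
  have "forest (T \<union> B - {b})"
    by (rule forest_subset[OF st(2)]) auto
  then have "forest (insert e (T \<union> B - {b}))"
    using notin b(3) unfolding uv(1) by (subst forest_insert[OF uv(4)]) simp_all
  moreover have "card (insert e (T \<union> B - {b})) = nverts G - 1"
  proof -
    have "card (T \<union> B) > 0" "finite (T \<union> B)"
      using fin b(1) by (auto simp: card_gt_0_iff)
    then show ?thesis
      using notin st(3) b(1) by (simp add: card_Diff_singleton)
  qed
  ultimately have "(T \<union> {e}) \<union> (B - {b}) \<in> spanning_trees G"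
    unfolding eq spanning_trees_iff[OF G] using st(1) e(1) by blast
  then show ?thesis
    using b(1) False TB(2) by blast
qed

section \<open>Privacy and utility\<close>

lemma set_proportional_pmf:
  assumes "finite F" "F \<noteq> {}" "\<And>x. x \<in> F \<Longrightarrow> g x > (0::real)"
  shows "set_pmf (proportional_pmf F g) = F"
proof -
  have "sum g F > 0" using assms by (intro sum_pos) auto
  then have "g x / sum g F \<noteq> 0" if "x \<in> F" for x
    using assms(3)[OF that] by simp
  moreover have "pmf (proportional_pmf F g) x = (if x \<in> F then g x / sum g F else 0)" for x
    by (rule pmf_proportional_pmf[OF assms])
  ultimately have "pmf (proportional_pmf F g) x \<noteq> 0 \<longleftrightarrow> x \<in> F" for x
    by simp
  then show ?thesis
    unfolding set_pmf_eq by blast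
qed

abbreviation gibbs :: "'a set \<Rightarrow> ('a \<Rightarrow> real) \<Rightarrow> real \<Rightarrow> 'a pmf" where
  "gibbs F w c \<equiv> proportional_pmf F (\<lambda>e. exp (- (c / 2) * w e))"

lemma sum_pmf_gibbs:
  assumes "finite F" "F \<noteq> {}"
  shows "(\<Sum>x\<in>F. pmf (gibbs F w c) x) = 1" "\<And>x. x \<in> F \<Longrightarrow> pmf (gibbs F w c) x > 0"
proof -
  have s: "set_pmf (gibbs F w c) = F" using assms by (intro set_proportional_pmf) auto
  show "(\<Sum>x\<in>F. pmf (gibbs F w c) x) = 1"
    using sum_pmf_eq_1[OF assms(1), of "gibbs F w c"] s by simp
  show "\<And>x. x \<in> F \<Longrightarrow> pmf (gibbs F w c) x > 0"
    using s by (simp add: pmf_positive)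
qed

lemma finite_set_kruskal_loop:
  assumes "input_graph G"
  shows "kruskal_state G k T F \<Longrightarrow> finite (set_pmf (kruskal_loop w c k T F))"
proof (induction k arbitrary: T F)
  case (Suc k)
  have F: "finite F" "F \<noteq> {}"
    using kruskal_state_finite[OF assms Suc.prems] kruskal_state_nonempty[OF assms Suc.prems] by auto
  have s: "set_pmf (gibbs F w c) = F" using F by (intro set_proportional_pmf) auto
  have "finite (set_pmf (kruskal_loop w c k (T \<union> {e}) (F - (T \<union> {e}) - {e' \<in> F. contains_cycle ({e'} \<union> (T \<union> {e}))})))"
    if "e \<in> F" for e
    by (rule Suc.IH[OF kruskal_state_step[OF assms Suc.prems that]])
  then show ?case
    unfolding kruskal_loop.simps Let_def set_bind_pmf s by (intro finite_UN_I F(1))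
qed simp

lemma expectation_kruskal_loop_Suc:
  assumes "input_graph G" "kruskal_state G (Suc k) T F"
  shows "measure_pmf.expectation (kruskal_loop w c (Suc k) T F) (h :: _ \<Rightarrow> real) =
    (\<Sum>e\<in>F. pmf (gibbs F w c) e * measure_pmf.expectation (kruskal_loop w c k (T \<union> {e})
        (F - (T \<union> {e}) - {e' \<in> F. contains_cycle ({e'} \<union> (T \<union> {e}))})) h)"
proof -
  have F: "finite F" "F \<noteq> {}"
    using kruskal_state_finite[OF assms] kruskal_state_nonempty[OF assms] by auto
  have s: "set_pmf (gibbs F w c) = F" using F by (intro set_proportional_pmf) auto
  show ?thesis
    unfolding kruskal_loop.simps Let_def
    by (subst pmf_expectation_bind[OF F(1)])
      (use s finite_set_kruskal_loop[OF assms(1) kruskal_state_step[OF assms]] in auto)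
qed

lemma set_kruskal_loop:
  assumes "input_graph G"
  shows "kruskal_state G k T F \<Longrightarrow> set_pmf (kruskal_loop w c k T F) \<subseteq> spanning_trees G"
proof (induction k arbitrary: T F)
  case 0
  then show ?case
    using kruskal_state_final[OF assms] by simp
next
  case (Suc k)
  have F: "finite F" "F \<noteq> {}"
    using kruskal_state_finite[OF assms Suc.prems] kruskal_state_nonempty[OF assms Suc.prems] by auto
  have s: "set_pmf (gibbs F w c) = F" using F by (intro set_proportional_pmf) auto
  show ?case
    using Suc.IH[OF kruskal_state_step[OF assms Suc.prems]]
    unfolding kruskal_loop.simps Let_def set_bind_pmf s by blast
qed

section \<open>The inequalities of Hoeffding and Hoelder for finite sums\<close>

lemma Hoeffding_mgf_pmf:
  fixes X :: "'a \<Rightarrow> real"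
  assumes "finite F" "set_pmf p \<subseteq> F" "\<And>x. x \<in> F \<Longrightarrow> X x \<in> {a..b}" "l \<ge> 0"
  shows "(\<Sum>x\<in>F. pmf p x * exp (l * (X x - (\<Sum>x\<in>F. pmf p x * X x)))) \<le> exp (l\<^sup>2 * (b - a)\<^sup>2 / 8)"
proof (cases "l = 0")
  case True
  then show ?thesis using assms sum_pmf_eq_1[of F p] by simp
next
  case False
  interpret interval_bounded_random_variable "measure_pmf p" X a b
    by unfold_locales (use assms in \<open>auto simp: AE_measure_pmf_iff\<close>)
  have E: "measure_pmf.expectation p f = (\<Sum>x\<in>F. pmf p x * f x)" for f :: "'a \<Rightarrow> real"
    using integral_measure_pmf[OF assms(1), of p f] assms(2) by auto
  define \<mu> where "\<mu> = measure_pmf.expectation p X"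
  have int: "integrable (measure_pmf p) (\<lambda>x. exp (l * (X x - \<mu>)))"
    by (rule integrable_measure_pmf_finite) (use assms finite_subset in auto)
  have "ennreal (measure_pmf.expectation p (\<lambda>x. exp (l * (X x - \<mu>)))) =
      (\<integral>\<^sup>+x. ennreal (exp (l * (X x - \<mu>))) \<partial>measure_pmf p)"
    by (subst nn_integral_eq_integral[OF int]) simp_all
  also have "\<dots> \<le> ennreal (exp (l\<^sup>2 * (b - a)\<^sup>2 / 8))"
    unfolding \<mu>_def by (rule Hoeffdings_lemma_nn_integral) (use False assms(4) in simp)
  finally have "measure_pmf.expectation p (\<lambda>x. exp (l * (X x - \<mu>))) \<le> exp (l\<^sup>2 * (b - a)\<^sup>2 / 8)"
    by (subst (asm) ennreal_le_iff) simp_all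
  then show ?thesis
    unfolding E \<mu>_def .
qed

text \<open>Hoelder's inequality with exponents \<alpha> and \<alpha> / (\<alpha> - 1), after
  \<open>p\<close> has been split into its ratio to a power of \<open>q\<close> and that power. It
  compares the mean of a concave power of \<open>g\<close> under \<open>p\<close> with the mean of
  \<open>g\<close> under \<open>q\<close>.\<close>

lemma holder_sum:
  fixes p q g :: "'a \<Rightarrow> real"
  assumes "finite F" "\<And>x. x \<in> F \<Longrightarrow> p x > 0" "\<And>x. x \<in> F \<Longrightarrow> q x > 0" "\<And>x. x \<in> F \<Longrightarrow> g x \<ge> 0"
    and "F \<noteq> {}" "\<alpha> > 1"
  shows "(\<Sum>x\<in>F. p x * g x powr ((\<alpha> - 1) / \<alpha>)) \<le>
    (\<Sum>x\<in>F. p x powr \<alpha> * q x powr (1 - \<alpha>)) powr (1 / \<alpha>) * (\<Sum>x\<in>F. q x * g x) powr ((\<alpha> - 1) / \<alpha>)"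
proof -
  define A B \<beta> where "A = (\<Sum>x\<in>F. p x powr \<alpha> * q x powr (1 - \<alpha>))" and "B = (\<Sum>x\<in>F. q x * g x)"
    and "\<beta> = (\<alpha> - 1) / \<alpha>"
  have \<beta>: "0 < \<beta>" "1 / \<alpha> + \<beta> = 1" using assms(6) by (auto simp: \<beta>_def field_simps)
  have A: "A > 0" unfolding A_def
    using assms by (intro sum_pos mult_pos_pos) (auto simp: less_imp_neq[symmetric])
  have B: "B \<ge> 0" unfolding B_def
    using assms by (intro sum_nonneg mult_nonneg_nonneg) (auto simp: less_imp_le)
  show ?thesis
  proof (cases "B = 0")
    case True
    have "q x * g x = 0" if "x \<in> F" for x
      using True sum_nonneg_eq_0_iff[OF assms(1), of "\<lambda>x. q x * g x"] that assms(3,4)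
      unfolding B_def by (metis less_imp_le mult_nonneg_nonneg)
    then have "g x = 0" if "x \<in> F" for x
      using assms(3)[OF that] that by fastforce
    then show ?thesis by (auto intro!: sum_nonpos mult_nonneg_nonneg)
  next
    case False
    then have B: "B > 0" using B by simp
    \<comment> \<open>Young's inequality for the terms normalised by \<open>A\<close> and
      \<open>B\<close>: summed over \<open>F\<close>, its two parts contribute 1 / \<alpha> and
      \<open>\<beta>\<close>, which add up to 1.\<close>
    have "p x * g x powr \<beta> \<le> A powr (1 / \<alpha>) * B powr \<beta> *
        ((1 / \<alpha>) * (p x powr \<alpha> * q x powr (1 - \<alpha>) / A) + \<beta> * (q x * g x / B))" if x: "x \<in> F" for x
    proof (cases "g x = 0")
      case True
      then show ?thesis using A B \<beta> assms(6) by simp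
    next
      case False
      then have pos: "p x > 0" "q x > 0" "g x > 0"
        using assms(2,3,4)[OF x] by auto
      have "(p x powr \<alpha> * q x powr (1 - \<alpha>) / A) powr (1 / \<alpha>) * (q x * g x / B) powr \<beta> \<le>
          (1 / \<alpha>) * (p x powr \<alpha> * q x powr (1 - \<alpha>) / A) + \<beta> * (q x * g x / B)"
        using pos A B \<beta> assms(6) by (intro Youngs_inequality_0) auto
      also have "(p x powr \<alpha> * q x powr (1 - \<alpha>) / A) powr (1 / \<alpha>) * (q x * g x / B) powr \<beta> =
          (p x powr \<alpha>) powr (1 / \<alpha>) * ((q x powr (1 - \<alpha>)) powr (1 / \<alpha>) * q x powr \<beta>) * g x powr \<beta> / (A powr (1 / \<alpha>) * B powr \<beta>)"
        using pos A B by (simp add: powr_mult powr_divide)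
      also have "(q x powr (1 - \<alpha>)) powr (1 / \<alpha>) * q x powr \<beta> = 1"
      proof -
        have "(1 - \<alpha>) * (1 / \<alpha>) + \<beta> = 0" using assms(6) by (simp add: \<beta>_def field_simps)
        then show ?thesis using pos(2) by (simp add: powr_powr flip: powr_add)
      qed
      also have "(p x powr \<alpha>) powr (1 / \<alpha>) = p x"
        using pos(1) assms(6) by (simp add: powr_powr)
      finally show ?thesis
        using A B by (simp add: field_simps)
    qed
    then have "(\<Sum>x\<in>F. p x * g x powr \<beta>) \<le> (\<Sum>x\<in>F. A powr (1 / \<alpha>) * B powr \<beta> *
        ((1 / \<alpha>) * (p x powr \<alpha> * q x powr (1 - \<alpha>) / A) + \<beta> * (q x * g x / B)))"
      by (rule sum_mono)
    also have "\<dots> = A powr (1 / \<alpha>) * B powr \<beta> * ((1 / \<alpha>) * (A / A) + \<beta> * (B / B))"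
      unfolding sum_distrib_left[symmetric] sum.distrib
      by (simp only: A_def B_def sum_divide_distrib sum_distrib_left)
    also have "\<dots> = A powr (1 / \<alpha>) * B powr \<beta>"
      using A B \<beta>(2) by simp
    finally show ?thesis
      unfolding A_def B_def \<beta>_def .
  qed
qed

text \<open>The privacy loss of one selection ranges over an interval of length \<open>c\<close>, so Hoeffding's lemma
  bounds its relative entropy (exponent \<open>-1\<close>) and its Renyi divergence (exponent \<open>\<alpha> - 1\<close>).\<close>

lemma gibbs_renyi:
  assumes F: "finite F" "F \<noteq> {}" and w: "\<And>e. e \<in> F \<Longrightarrow> \<bar>w e - w' e\<bar> \<le> 1" and "c \<ge> 0" "\<alpha> > 1"
  shows "(\<Sum>x\<in>F. pmf (gibbs F w c) x powr \<alpha> * pmf (gibbs F w' c) x powr (1 - \<alpha>)) \<le>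
    exp (\<alpha> * (\<alpha> - 1) * c\<^sup>2 / 8)"
proof -
  define p q where "p = pmf (gibbs F w c)" and "q = pmf (gibbs F w' c)"
  define Z Z' where "Z = (\<Sum>e\<in>F. exp (- (c / 2) * w e))" and "Z' = (\<Sum>e\<in>F. exp (- (c / 2) * w' e))"
  have Z: "Z > 0" "Z' > 0" unfolding Z_def Z'_def using F by (auto intro!: sum_pos)
  have p: "p x > 0" "q x > 0" if "x \<in> F" for x
    unfolding p_def q_def using sum_pmf_gibbs(2)[OF F that] by auto
  have ps: "(\<Sum>x\<in>F. p x) = 1" "(\<Sum>x\<in>F. q x) = 1"
    unfolding p_def q_def using sum_pmf_gibbs(1)[OF F] by auto
  define X where "X x = ln (p x / q x)" for x
  define K where "K = ln (Z' / Z)"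
  \<comment> \<open>The normalising constants enter the privacy loss only through the common offset
    \<open>K\<close>, so that its spread is governed by the weights.\<close>
  have X: "X x = K - (c / 2) * (w x - w' x)" if "x \<in> F" for x
  proof -
    have "p x = exp (- (c / 2) * w x) / Z" "q x = exp (- (c / 2) * w' x) / Z'"
      unfolding p_def q_def Z_def Z'_def using F that by (subst pmf_proportional_pmf; simp)+
    then have "X x = ln ((exp (- (c / 2) * w x) / exp (- (c / 2) * w' x)) * (Z' / Z))"
      by (simp add: X_def ac_simps)
    also have "\<dots> = ln (exp (- (c / 2) * w x) / exp (- (c / 2) * w' x)) + K"
      unfolding K_def using Z by (intro ln_mult_pos) auto
    finally show ?thesis
      by (simp add: exp_diff[symmetric] field_simps)
  qed
  have X_int: "X x \<in> {K - c / 2..K + c / 2}" if "x \<in> F" for x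
  proof -
    have "\<bar>(c / 2) * (w x - w' x)\<bar> \<le> (c / 2) * 1"
      unfolding abs_mult using w[OF that] \<open>c \<ge> 0\<close> by (intro mult_mono) auto
    then show ?thesis using X[OF that] by auto
  qed
  have s: "set_pmf (gibbs F w c) = F" using F by (intro set_proportional_pmf) auto
  define \<mu> where "\<mu> = (\<Sum>x\<in>F. p x * X x)"
  have H1: "(\<Sum>x\<in>F. p x * exp ((\<alpha> - 1) * (X x - \<mu>))) \<le> exp ((\<alpha> - 1)\<^sup>2 * c\<^sup>2 / 8)"
    using Hoeffding_mgf_pmf[OF F(1), of "gibbs F w c" X "K - c / 2" "K + c / 2" "\<alpha> - 1"] s X_int assms(5)
    by (simp add: p_def \<mu>_def)
  \<comment> \<open>Hoeffding's lemma for the negated loss with parameter 1. The mean of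
    \<open>exp (- X)\<close> under \<open>p\<close> is the total mass of \<open>q\<close>, namely 1,
    so the inequality bounds the relative entropy \<open>\<mu>\<close>.\<close>
  have "(\<Sum>x\<in>F. p x * exp (1 * (- X x - (\<Sum>x\<in>F. p x * (- X x))))) \<le>
      exp (1\<^sup>2 * (- (K - c / 2) - (- (K + c / 2)))\<^sup>2 / 8)"
    unfolding p_def
  proof (rule Hoeffding_mgf_pmf[OF F(1)])
    show "- X x \<in> {- (K + c / 2)..- (K - c / 2)}" if "x \<in> F" for x
      unfolding atLeastAtMost_iff neg_le_iff_le using X_int[OF that] by auto
  qed (use s in auto)
  also have "(\<Sum>x\<in>F. p x * (- X x)) = - \<mu>"
    by (simp add: \<mu>_def sum_negf)
  also have "(\<Sum>x\<in>F. p x * exp (1 * (- X x - (- \<mu>)))) = (\<Sum>x\<in>F. q x * exp \<mu>)"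
  proof (rule sum.cong[OF refl])
    fix x assume x: "x \<in> F"
    have "exp (1 * (- X x - (- \<mu>))) = exp \<mu> / exp (X x)"
      by (simp add: exp_diff)
    also have "exp (X x) = p x / q x"
      unfolding X_def using p[OF x] by simp
    finally show "p x * exp (1 * (- X x - (- \<mu>))) = q x * exp \<mu>"
      using p[OF x] by simp
  qed
  also have "\<dots> = exp \<mu>"
    using ps by (simp flip: sum_distrib_right)
  finally have \<mu>: "\<mu> \<le> c\<^sup>2 / 8" by simp
  \<comment> \<open>Each term equals \<open>p x * exp ((\<alpha> - 1) * X x)\<close>; centring
    \<open>X\<close> at \<open>\<mu>\<close> leaves one factor for each of the two bounds
    above.\<close>
  have "(\<Sum>x\<in>F. p x powr \<alpha> * q x powr (1 - \<alpha>)) =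
      exp ((\<alpha> - 1) * \<mu>) * (\<Sum>x\<in>F. p x * exp ((\<alpha> - 1) * (X x - \<mu>)))"
    unfolding sum_distrib_left
  proof (rule sum.cong[OF refl])
    fix x assume x: "x \<in> F"
    have "p x powr \<alpha> * q x powr (1 - \<alpha>) = exp (\<alpha> * ln (p x) + (1 - \<alpha>) * ln (q x))"
      using p[OF x] by (simp add: powr_def exp_add)
    also have "\<alpha> * ln (p x) + (1 - \<alpha>) * ln (q x) = (\<alpha> - 1) * \<mu> + (ln (p x) + (\<alpha> - 1) * (X x - \<mu>))"
      using p[OF x] by (simp add: X_def ln_div algebra_simps)
    also have "exp \<dots> = exp ((\<alpha> - 1) * \<mu>) * (p x * exp ((\<alpha> - 1) * (X x - \<mu>)))"
      using p[OF x] by (simp add: exp_add)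
    finally show "p x powr \<alpha> * q x powr (1 - \<alpha>) = exp ((\<alpha> - 1) * \<mu>) * (p x * exp ((\<alpha> - 1) * (X x - \<mu>)))" .
  qed
  also have "\<dots> \<le> exp ((\<alpha> - 1) * (c\<^sup>2 / 8)) * exp ((\<alpha> - 1)\<^sup>2 * c\<^sup>2 / 8)"
  proof (rule mult_mono)
    show "exp ((\<alpha> - 1) * \<mu>) \<le> exp ((\<alpha> - 1) * (c\<^sup>2 / 8))"
      using \<mu> assms(5) by simp
    show "0 \<le> (\<Sum>x\<in>F. p x * exp ((\<alpha> - 1) * (X x - \<mu>)))"
      using p by (intro sum_nonneg mult_nonneg_nonneg) (auto intro: less_imp_le)
  qed (use H1 in auto)
  also have "\<dots> = exp (\<alpha> * (\<alpha> - 1) * c\<^sup>2 / 8)"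
  proof -
    have "(\<alpha> - 1) * (c\<^sup>2 / 8) + (\<alpha> - 1)\<^sup>2 * c\<^sup>2 / 8 = \<alpha> * (\<alpha> - 1) * c\<^sup>2 / 8"
      by (simp add: power2_eq_square field_simps)
    then show ?thesis by (simp flip: exp_add)
  qed
  finally show ?thesis
    unfolding p_def q_def .
qed

lemma prob_as_expectation: "measure_pmf.prob M Z = measure_pmf.expectation M (indicat_real Z)"
  by simp

text \<open>The exponent (\<alpha> - 1) / \<alpha> is the same in hypothesis and conclusion of a
  round, so it does not deteriorate and the factors simply multiply. The factor of one round is the
  bound of \<open>gibbs_renyi\<close> raised to the power 1 / \<alpha>.\<close>

lemma kruskal_loop_renyi:
  assumes G: "input_graph G" and w: "\<And>e. e \<in> edges G \<Longrightarrow> \<bar>w e - w' e\<bar> \<le> 1" and "c \<ge> 0" "\<alpha> > 1"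
  shows "kruskal_state G k T F \<Longrightarrow>
    measure_pmf.prob (kruskal_loop w c k T F) Z \<le>
      exp ((\<alpha> - 1) * c\<^sup>2 / 8) ^ k * measure_pmf.prob (kruskal_loop w' c k T F) Z powr ((\<alpha> - 1) / \<alpha>)"
proof (induction k arbitrary: T F)
  case 0
  then show ?case by (simp add: indicator_def)
next
  case (Suc k)
  define D where "D = exp ((\<alpha> - 1) * c\<^sup>2 / 8)"
  define \<beta> where "\<beta> = (\<alpha> - 1) / \<alpha>"
  define F' where "F' e = F - (T \<union> {e}) - {e' \<in> F. contains_cycle ({e'} \<union> (T \<union> {e}))}" for e
  define P where "P e = measure_pmf.prob (kruskal_loop w c k (T \<union> {e}) (F' e)) Z" for e
  define Q where "Q e = measure_pmf.prob (kruskal_loop w' c k (T \<union> {e}) (F' e)) Z" for e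
  have F: "finite F" "F \<noteq> {}"
    using kruskal_state_finite[OF G Suc.prems] kruskal_state_nonempty[OF G Suc.prems] by auto
  have wF: "\<bar>w e - w' e\<bar> \<le> 1" if "e \<in> F" for e
    using that w Suc.prems by (auto simp: kruskal_state_def)
  let ?p = "pmf (gibbs F w c)" and ?q = "pmf (gibbs F w' c)"
  have "measure_pmf.prob (kruskal_loop w c (Suc k) T F) Z = (\<Sum>e\<in>F. ?p e * P e)"
    unfolding prob_as_expectation expectation_kruskal_loop_Suc[OF G Suc.prems] P_def F'_def ..
  also have "\<dots> \<le> (\<Sum>e\<in>F. ?p e * (D ^ k * Q e powr \<beta>))"
    using Suc.IH[OF kruskal_state_step[OF G Suc.prems]]
    by (intro sum_mono mult_left_mono) (auto simp: P_def Q_def D_def \<beta>_def F'_def)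
  also have "\<dots> = D ^ k * (\<Sum>e\<in>F. ?p e * Q e powr \<beta>)"
    by (simp add: sum_distrib_left ac_simps)
  also have "\<dots> \<le> D ^ k * (D * (\<Sum>e\<in>F. ?q e * Q e) powr \<beta>)"
  proof (rule mult_left_mono)
    have "(\<Sum>e\<in>F. ?p e * Q e powr \<beta>) \<le>
        (\<Sum>x\<in>F. ?p x powr \<alpha> * ?q x powr (1 - \<alpha>)) powr (1 / \<alpha>) * (\<Sum>x\<in>F. ?q x * Q x) powr \<beta>"
      unfolding \<beta>_def
      by (rule holder_sum) (use F sum_pmf_gibbs(2)[OF F] assms(4) in \<open>auto simp: Q_def\<close>)
    also have "(\<Sum>x\<in>F. ?p x powr \<alpha> * ?q x powr (1 - \<alpha>)) powr (1 / \<alpha>) \<le> exp (\<alpha> * (\<alpha> - 1) * c\<^sup>2 / 8) powr (1 / \<alpha>)"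
      using gibbs_renyi[OF F wF assms(3,4)] assms(4) by (intro powr_mono2) (auto intro!: sum_nonneg)
    also have "exp (\<alpha> * (\<alpha> - 1) * c\<^sup>2 / 8) powr (1 / \<alpha>) = D"
      using assms(4) by (simp add: D_def powr_def)
    finally show "(\<Sum>e\<in>F. ?p e * Q e powr \<beta>) \<le> D * (\<Sum>x\<in>F. ?q x * Q x) powr \<beta>"
      by (simp add: mult_right_mono)
  qed (simp add: D_def)
  also have "(\<Sum>e\<in>F. ?q e * Q e) = measure_pmf.prob (kruskal_loop w' c (Suc k) T F) Z"
    unfolding prob_as_expectation expectation_kruskal_loop_Suc[OF G Suc.prems] Q_def F'_def ..
  finally show ?case
    unfolding D_def \<beta>_def power_Suc by (simp only: ac_simps)
qed


section \<open>From moment bounds to approximate privacy\<close>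

lemma rho_param_pos: "0 < \<epsilon> \<Longrightarrow> rho_param \<epsilon> \<delta> > 0"
proof -
  assume "0 < \<epsilon>"
  then have "sqrt (ln (1 / \<delta>)) < sqrt (\<epsilon> + ln (1 / \<delta>))"
    by (intro real_sqrt_less_mono) simp
  then show ?thesis by (simp add: rho_param_def)
qed

lemma eps_step_squared:
  assumes "0 < \<epsilon>" "n \<ge> 2"
  shows "(eps_step n \<epsilon> \<delta>)\<^sup>2 = 2 * rho_param \<epsilon> \<delta> / (real n - 1)" "eps_step n \<epsilon> \<delta> > 0"
  using rho_param_pos[OF assms(1), of \<delta>] assms(2) by (auto simp: eps_step_def)

text \<open>With \<open>y = exp (\<alpha> * \<rho>) * Q\<close>, either the power of
  \<open>y\<close> is at most \<delta> and the additive term suffices, or \<open>y\<close> is so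
  large that the missing factor \<open>y powr - (1 / \<alpha>)\<close> is at most
  \<open>\<delta> powr (- 1 / (\<alpha> - 1))\<close>, which is absorbed multiplicatively.\<close>

lemma renyi_to_approximate:
  fixes P Q :: real
  assumes "P \<le> (exp (\<alpha> * \<rho>) * Q) powr ((\<alpha> - 1) / \<alpha>)" "Q \<ge> 0" "\<alpha> > 1" "\<delta> > 0"
  shows "P \<le> exp (\<alpha> * \<rho> + ln (1 / \<delta>) / (\<alpha> - 1)) * Q + \<delta>"
proof -
  define y \<beta> where "y = exp (\<alpha> * \<rho>) * Q" and "\<beta> = (\<alpha> - 1) / \<alpha>"
  have y: "y \<ge> 0" using assms(2) by (simp add: y_def)
  have \<beta>: "\<beta> > 0" using assms(3) by (simp add: \<beta>_def)
  have R: "exp (\<alpha> * \<rho> + ln (1 / \<delta>) / (\<alpha> - 1)) * Q = y * \<delta> powr (- 1 / (\<alpha> - 1))"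
    using assms(4) by (simp add: y_def powr_def ln_div exp_diff exp_minus field_simps)
  show ?thesis
  proof (cases "y \<le> \<delta> powr (1 / \<beta>)")
    case True
    then have "y powr \<beta> \<le> (\<delta> powr (1 / \<beta>)) powr \<beta>"
      using y \<beta> by (intro powr_mono2) auto
    also have "\<dots> = \<delta>" using \<beta> assms(4) by (simp add: powr_powr)
    finally have "P \<le> \<delta>" using assms(1) by (simp add: y_def \<beta>_def)
    then show ?thesis using assms(2) by (simp add: add_increasing)
  next
    case False
    then have y: "y > 0" "\<delta> powr (1 / \<beta>) < y" using le_less_trans[OF powr_ge_zero[of \<delta> "1 / \<beta>"], of y] by simp_all
    have "P \<le> y powr \<beta>" using assms(1) by (simp add: y_def \<beta>_def)
    also have "\<beta> = 1 + - (1 / \<alpha>)" using assms(3) by (simp add: \<beta>_def field_simps)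
    also have "y powr \<dots> = y * y powr - (1 / \<alpha>)"
      using y(1) by (subst powr_add) simp
    also have "\<dots> \<le> y * (\<delta> powr (1 / \<beta>)) powr - (1 / \<alpha>)"
      using y assms(3,4) by (intro mult_left_mono powr_mono2') auto
    also have "(\<delta> powr (1 / \<beta>)) powr - (1 / \<alpha>) = \<delta> powr (- 1 / (\<alpha> - 1))"
      using assms(3) by (simp add: powr_powr \<beta>_def)
    finally show ?thesis
      using R assms(4) by simp
  qed
qed

lemma private_kruskal_private:
  assumes "\<epsilon> > 0" "\<delta> > 0"
  shows "differentially_private \<epsilon> \<delta> (private_kruskal \<epsilon> \<delta>)"
  unfolding differentially_private_def
proof (intro allI impI)
  fix G G' Z
  assume G: "input_graph G" "input_graph G'" "neighboring G G'"
  let ?P = "measure_pmf.prob (private_kruskal \<epsilon> \<delta> G) Z" and ?Q = "measure_pmf.prob (private_kruskal \<epsilon> \<delta> G') Z"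
  have nb: "nverts G' = nverts G" "edges G' = edges G" "\<And>e. e \<in> edges G \<Longrightarrow> \<bar>weight G e - weight G' e\<bar> \<le> 1"
    using G(3) by (auto simp: neighboring_def)
  show "?P \<le> exp \<epsilon> * ?Q + \<delta>"
  proof (cases "\<delta> \<ge> 1")
    \<comment> \<open>A probability never exceeds 1. From here on \<delta> < 1, so the logarithm of
      1 / \<delta> is positive and the square roots have their usual meaning.\<close>
    case True
    have "?P \<le> 1 + 0" "0 \<le> exp \<epsilon> * ?Q" by simp_all
    then show ?thesis using True by linarith
  next
    case \<delta>: False
    show ?thesis
    proof (cases "nverts G \<ge> 2")
      case False
      then have "nverts G - 1 = 0" by simp
      then have "?P = ?Q" by (simp add: private_kruskal_def nb)
      moreover have "1 * ?Q \<le> exp \<epsilon> * ?Q"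
        using assms(1) by (intro mult_right_mono) auto
      ultimately show ?thesis using assms(2) by linarith
    next
      case True
      define \<rho> where "\<rho> = rho_param \<epsilon> \<delta>"
      define L where "L = ln (1 / \<delta>)"
      define c where "c = eps_step (nverts G) \<epsilon> \<delta>"
      \<comment> \<open>The minimiser of \<open>\<alpha> * \<rho> + L / (\<alpha> - 1)\<close>. The
        minimum is \<open>(sqrt \<rho> + sqrt L)\<^sup>2 - L\<close>, and equating it with
        \<epsilon> gives the formula of \<open>rho_param\<close>.\<close>
      define \<alpha> where "\<alpha> = 1 + sqrt (L / \<rho>)"
      have L: "L > 0" using \<delta> assms(2) by (simp add: L_def)
      have \<rho>: "\<rho> > 0" using rho_param_pos[OF assms(1)] by (simp add: \<rho>_def)
      have \<alpha>: "\<alpha> > 1" using L \<rho> by (simp add: \<alpha>_def)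
      have c: "c\<^sup>2 = 2 * \<rho> / (real (nverts G) - 1)" "c > 0"
        using eps_step_squared[OF assms(1) True] by (auto simp: c_def \<rho>_def)
      have sq: "sqrt \<rho> = sqrt (\<epsilon> + L) - sqrt L"
        using assms(1) L by (simp add: \<rho>_def rho_param_def L_def)
      have \<epsilon>: "\<alpha> * \<rho> + L / (\<alpha> - 1) = \<epsilon>"
      proof -
        have "\<alpha> * \<rho> + L / (\<alpha> - 1) = \<rho> + sqrt L * (\<rho> / sqrt \<rho>) + sqrt \<rho> * (L / sqrt L)"
          using L \<rho> by (simp add: \<alpha>_def real_sqrt_divide field_simps)
        also have "\<dots> = (sqrt \<rho> + sqrt L)\<^sup>2 - L"
          using L \<rho> by (simp add: real_div_sqrt power2_eq_square algebra_simps)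
        also have "\<dots> = \<epsilon>"
          using assms(1) L by (simp add: sq)
        finally show ?thesis .
      qed
      have "?P \<le> exp ((\<alpha> - 1) * c\<^sup>2 / 8) ^ (nverts G - 1) * ?Q powr ((\<alpha> - 1) / \<alpha>)"
        using kruskal_loop_renyi[where c = "eps_step (nverts G) \<epsilon> \<delta>" and Z = Z
            and w = "weight G" and w' = "weight G'", OF G(1) nb(3) _ \<alpha> kruskal_state_init[OF G(1)]] c(2)
        by (simp add: private_kruskal_def nb c_def)
      also have "exp ((\<alpha> - 1) * c\<^sup>2 / 8) ^ (nverts G - 1) = exp ((\<alpha> - 1) * \<rho> / 4)"
      proof -
        have "real (nverts G - 1) * ((\<alpha> - 1) * c\<^sup>2 / 8) = (\<alpha> - 1) * \<rho> / 4"
          using True by (simp add: c(1) of_nat_diff field_simps)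
        then show ?thesis by (simp flip: exp_of_nat_mult)
      qed
      \<comment> \<open>Over n - 1 rounds Hoeffding's constant 1 / 8 yields a quarter of the
        exponent that the calibration allows; the difference is given away.\<close>
      also have "exp ((\<alpha> - 1) * \<rho> / 4) * ?Q powr ((\<alpha> - 1) / \<alpha>) \<le> exp ((\<alpha> - 1) * \<rho>) * ?Q powr ((\<alpha> - 1) / \<alpha>)"
        using \<alpha> \<rho> by (intro mult_right_mono) auto
      \<comment> \<open>(\<alpha> - 1) * \<rho> is the (\<alpha> - 1) / \<alpha> fraction of
        \<alpha> * \<rho>, so the factor moves inside the power.\<close>
      also have "\<dots> = (exp (\<alpha> * \<rho>) * ?Q) powr ((\<alpha> - 1) / \<alpha>)"
      proof -
        have "(exp (\<alpha> * \<rho>)) powr ((\<alpha> - 1) / \<alpha>) = exp ((\<alpha> - 1) * \<rho>)"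
          using \<alpha> by (simp add: powr_def)
        then show ?thesis by (simp add: powr_mult)
      qed
      finally have "?P \<le> exp (\<alpha> * \<rho> + L / (\<alpha> - 1)) * ?Q + \<delta>"
        unfolding L_def by (rule renyi_to_approximate) (use \<alpha> assms(2) in auto)
      then show ?thesis unfolding \<epsilon> .
    qed
  qed
qed

text \<open>The Gibbs variational identity: \<open>c / 2\<close> times the mean weight, minus the
  entropy, equals \<open>- ln Z\<close>. The entropy is at most \<open>ln (card F)\<close>, here by
  \<open>ln x <= x - 1\<close>, and \<open>Z\<close> is at least the single term of
  \<open>b\<close>. Bounding the mean directly avoids tail estimates.\<close>

lemma gibbs_expected_weight:
  assumes F: "finite F" "F \<noteq> {}" and c: "c > 0" and b: "b \<in> F"
  shows "(\<Sum>e\<in>F. pmf (gibbs F w c) e * w e) \<le> w b + 2 / c * ln (card F)"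
proof -
  define p where "p = pmf (gibbs F w c)"
  define Z where "Z = (\<Sum>e\<in>F. exp (- (c / 2) * w e))"
  have p: "p x > 0" if "x \<in> F" for x
    unfolding p_def using sum_pmf_gibbs(2)[OF F that] .
  have ps: "(\<Sum>x\<in>F. p x) = 1"
    unfolding p_def using sum_pmf_gibbs(1)[OF F] .
  have N: "real (card F) > 0" using F by (simp add: card_gt_0_iff)
  have Zb: "Z \<ge> exp (- (c / 2) * w b)"
    unfolding Z_def by (rule member_le_sum[OF b]) (use F in auto)
  then have Z: "Z > 0" by (rule less_le_trans[OF exp_gt_zero])
  have lnp: "ln (p x) = - (c / 2) * w x - ln Z" if "x \<in> F" for x
  proof -
    have "p x = exp (- (c / 2) * w x) / Z"
      unfolding p_def Z_def using F that by (subst pmf_proportional_pmf) simp_all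
    then show ?thesis using Z by (simp add: ln_div)
  qed
  have "(\<Sum>x\<in>F. p x * (ln (1 / card F) - ln (p x))) \<le> (\<Sum>x\<in>F. 1 / card F - p x)"
  proof (rule sum_mono)
    fix x assume x: "x \<in> F"
    have "ln (1 / card F) - ln (p x) = ln ((1 / card F) / p x)"
      using N p[OF x] by (simp add: ln_div ln_mult)
    also have "\<dots> \<le> (1 / card F) / p x - 1"
      using N p[OF x] by (intro ln_le_minus_one) simp
    finally have "p x * (ln (1 / card F) - ln (p x)) \<le> p x * ((1 / card F) / p x - 1)"
      using p[OF x] by (intro mult_left_mono) auto
    also have "\<dots> = 1 / card F - p x" using p[OF x] by (simp add: right_diff_distrib)
    finally show "p x * (ln (1 / card F) - ln (p x)) \<le> 1 / card F - p x" .
  qed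
  also have "\<dots> = 0" using N by (simp add: sum_subtractf ps)
  also have "(\<Sum>x\<in>F. p x * (ln (1 / card F) - ln (p x))) =
      (\<Sum>x\<in>F. (ln Z - ln (card F)) * p x + (c / 2) * (p x * w x))"
    using N by (intro sum.cong refl) (simp add: lnp ln_div algebra_simps)
  also have "\<dots> = (ln Z - ln (card F)) + (c / 2) * (\<Sum>x\<in>F. p x * w x)"
    by (simp only: sum.distrib sum_distrib_left[symmetric] ps mult_1_right)
  finally have "(c / 2) * (\<Sum>x\<in>F. p x * w x) \<le> ln (card F) - ln Z" by simp
  moreover have "- ln Z \<le> (c / 2) * w b"
    using ln_mono[OF Zb] Z by simp
  ultimately have "(c / 2) * (\<Sum>x\<in>F. p x * w x) \<le> ln (card F) + (c / 2) * w b" by linarith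
  then show ?thesis
    using c by (simp add: p_def field_simps)
qed

text \<open>\<open>B\<close> is any completion of \<open>T\<close> to a spanning tree, since the
  exchanges soon leave the minimum spanning tree with which the loop starts. A round trades
  \<open>e\<close> for an edge of \<open>B\<close>, which weighs at least the minimum over
  \<open>F\<close>, while the mean weight of \<open>e\<close> exceeds that minimum by at most one
  error term.\<close>

lemma kruskal_loop_utility:
  assumes G: "input_graph G" and c: "c > 0"
  shows "kruskal_state G k T F \<Longrightarrow> T \<union> B \<in> spanning_trees G \<Longrightarrow> T \<inter> B = {} \<Longrightarrow>
    measure_pmf.expectation (kruskal_loop w c k T F) (\<lambda>T. \<Sum>e\<in>T. w e) \<le>
      (\<Sum>e\<in>T. w e) + (\<Sum>e\<in>B. w e) + real k * (2 / c * ln (card (edges G)))"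
proof (induction k arbitrary: T F B)
  case 0
  have fin: "finite T" "finite B"
    using 0 input_graph_facts(6)[OF G] finite_subset[of _ "edges G"] by (auto simp: spanning_trees_iff[OF G])
  have "card (T \<union> B) = card T"
    using 0 by (auto simp: spanning_trees_iff[OF G] kruskal_state_def)
  then have "B = {}"
    using fin 0(3) by (simp add: card_Un_disjoint)
  then show ?case by simp
next
  case (Suc k)
  let ?D = "2 / c * ln (card (edges G))"
  let ?W = "\<lambda>A. \<Sum>e\<in>A. w e"
  let ?p = "pmf (gibbs F w c)"
  have F: "finite F" "F \<noteq> {}"
    using kruskal_state_finite[OF G Suc.prems(1)] kruskal_state_nonempty[OF G Suc.prems(1)] by auto
  have st: "T \<subseteq> edges G" "F = {e \<in> edges G - T. forest (insert e T)}" "F \<subseteq> edges G"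
    using Suc.prems(1) by (auto simp: kruskal_state_def)
  have fT: "finite T" using st(1) input_graph_facts(6)[OF G] by (rule finite_subset)
  have fB: "finite B"
    using Suc.prems(2) input_graph_facts(6)[OF G] finite_subset[of _ "edges G"]
    by (auto simp: spanning_trees_iff[OF G])
  \<comment> \<open>Edges of a completion are admissible, hence none of them is lighter than the
    minimum over \<open>F\<close>.\<close>
  have BF: "B \<subseteq> F"
  proof
    fix b assume b: "b \<in> B"
    have "forest (insert b T)"
      by (rule forest_subset[of "T \<union> B"]) (use Suc.prems(2) b in \<open>auto simp: spanning_trees_iff[OF G]\<close>)
    then show "b \<in> F"
      using Suc.prems(2,3) b st(2) by (auto simp: spanning_trees_iff[OF G])
  qed
  define wm where "wm = Min (w ` F)"
  have wm: "wm \<le> w e" if "e \<in> F" for e using F that by (simp add: wm_def)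
  have "wm \<in> w ` F" using F by (simp add: wm_def)
  then obtain b0 where b0: "b0 \<in> F" "wm = w b0" by auto
  have E: "(\<Sum>e\<in>F. ?p e * w e) \<le> wm + ?D"
  proof -
    have "ln (card F) \<le> ln (card (edges G))"
    proof -
      have "0 < card F" using F by (simp add: card_gt_0_iff)
      then show ?thesis
        using card_mono[OF input_graph_facts(6)[OF G] st(3)] by (subst ln_le_cancel_iff) auto
    qed
    then have "2 / c * ln (card F) \<le> ?D"
      using c by (intro mult_left_mono) auto
    then show ?thesis
      using gibbs_expected_weight[OF F c b0(1), of w] b0(2) by simp
  qed
  have step: "measure_pmf.expectation (kruskal_loop w c k (T \<union> {e})
        (F - (T \<union> {e}) - {e' \<in> F. contains_cycle ({e'} \<union> (T \<union> {e}))})) ?W \<le>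
      w e + (?W T + ?W B - wm + real k * ?D)" if e: "e \<in> F" for e
  proof -
    have e': "e \<in> edges G" "e \<notin> T" "forest (insert e T)" using e st(2) by auto
    from spanning_tree_exchange[OF G Suc.prems(2,3) e'] obtain b
      where b: "b \<in> B" "(T \<union> {e}) \<union> (B - {b}) \<in> spanning_trees G" "(T \<union> {e}) \<inter> (B - {b}) = {}"
      by blast
    have "?W (T \<union> {e}) = ?W T + w e" using fT e'(2) by simp
    moreover have "?W (B - {b}) = ?W B - w b" using fB b(1) by (simp add: sum_diff1)
    moreover have "wm \<le> w b" using b(1) BF wm by auto
    ultimately show ?thesis
      using Suc.IH[OF kruskal_state_step[OF G Suc.prems(1) e] b(2,3)] by simp
  qed
  have "measure_pmf.expectation (kruskal_loop w c (Suc k) T F) ?W \<le>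
      (\<Sum>e\<in>F. ?p e * (w e + (?W T + ?W B - wm + real k * ?D)))"
    unfolding expectation_kruskal_loop_Suc[OF G Suc.prems(1)]
    by (intro sum_mono mult_left_mono step) simp_all
  also have "\<dots> = (\<Sum>e\<in>F. ?p e * w e) + (?W T + ?W B - wm + real k * ?D)"
    by (simp only: distrib_left sum.distrib sum_distrib_right[symmetric] sum_pmf_gibbs(1)[OF F] mult_1)
  also have "\<dots> \<le> (wm + ?D) + (?W T + ?W B - wm + real k * ?D)"
    using E by simp
  also have "\<dots> = ?W T + ?W B + real (Suc k) * ?D"
    unfolding of_nat_Suc distrib_right by simp
  finally show ?case .
qed

lemma card_edges_le: "input_graph G \<Longrightarrow> card (edges G) \<le> nverts G * nverts G"
proof -
  assume G: "input_graph G"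
  have "edges G \<subseteq> (\<lambda>(u, v). {u, v}) ` (verts G \<times> verts G)"
    using input_graph_facts(5)[OF G] by (auto simp: simple_edges_def)
  then have "card (edges G) \<le> card (verts G \<times> verts G)"
    using input_graph_facts(1)[OF G] by (intro surj_card_le) auto
  then show ?thesis
    using input_graph_facts(3)[OF G] by (simp add: card_cartesian_product)
qed

text \<open>The algorithm itself provides a spanning tree: its support is nonempty and consists of
  such trees. The parameters 1 and 1 are arbitrary.\<close>

lemma card_edges_ge: "input_graph G \<Longrightarrow> card (edges G) \<ge> nverts G - 1"
proof -
  assume G: "input_graph G"
  have "set_pmf (private_kruskal 1 1 G) \<subseteq> spanning_trees G"
    unfolding private_kruskal_def by (rule set_kruskal_loop[OF G kruskal_state_init[OF G]])
  moreover have "set_pmf (private_kruskal 1 1 G) \<noteq> {}" by (rule set_pmf_not_empty)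
  ultimately obtain T where "T \<in> spanning_trees G" by auto
  then show ?thesis
    using card_mono[OF input_graph_facts(6)[OF G], of T] by (simp add: spanning_trees_iff[OF G])
qed

lemma private_kruskal_utility:
  assumes "\<epsilon> > 0" "\<delta> > 0" "K > 0" "\<epsilon> \<le> K * ln (1 / \<delta>)" and G: "input_graph G" and T: "is_mst G Tstar"
  shows "measure_pmf.expectation (private_kruskal \<epsilon> \<delta> G) (\<lambda>T. \<Sum>e\<in>T. weight G e) - (\<Sum>e\<in>Tstar. weight G e)
    \<le> (4 * (sqrt (K + 1) + 1)) * (1 / \<epsilon> * real (nverts G) powr (3 / 2) * ln (real (nverts G)) * sqrt (ln (1 / \<delta>)))"
proof -
  define n where "n = nverts G"
  define L where "L = ln (1 / \<delta>)"
  \<comment> \<open>The assumption relating \<epsilon> to \<open>K\<close> forces \<delta> <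
    1.\<close>
  have "0 < K * L" using assms(1,4) by (simp add: L_def)
  then have L: "L > 0" using assms(3) by (simp add: zero_less_mult_iff)
  have Ts: "Tstar \<in> spanning_trees G" using T by (simp add: is_mst_def)
  show ?thesis
  proof (cases "n \<ge> 2")
    \<comment> \<open>For one vertex the bound is 0 because \<open>ln 1 = 0\<close>, and both trees
      are empty.\<close>
    case False
    then have n: "nverts G = 1" using input_graph_facts(4)[OF G] by (simp add: n_def)
    then have "card Tstar = 0" "finite Tstar"
      using Ts input_graph_facts(6)[OF G] finite_subset by (auto simp: spanning_trees_iff[OF G])
    then show ?thesis
      using n by (simp add: private_kruskal_def)
  next
    case True
    define c where "c = eps_step n \<epsilon> \<delta>"
    define N where "N = real n - 1"
    have N: "N > 0" "N \<le> real n" using True by (auto simp: N_def)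
    have c: "c > 0" "c\<^sup>2 = 2 * rho_param \<epsilon> \<delta> / N"
      using eps_step_squared[OF assms(1) True, of \<delta>] by (auto simp: c_def N_def)
    \<comment> \<open>The conjugate of \<open>sqrt (\<epsilon> + L) - sqrt L\<close>, by which the
      root of \<open>rho_param\<close> becomes \<open>\<epsilon> / S\<close> and the cancellation in
      the difference disappears.\<close>
    define S where "S = sqrt (\<epsilon> + L) + sqrt L"
    have S: "S > 0" using L assms(1) by (simp add: S_def add_pos_pos)
    have "S * (sqrt (\<epsilon> + L) - sqrt L) = \<epsilon>"
      using L assms(1) by (simp add: S_def algebra_simps)
    then have "sqrt (\<epsilon> + L) - sqrt L = \<epsilon> / S" using S by (simp add: field_simps)
    then have r: "rho_param \<epsilon> \<delta> = (\<epsilon> / S)\<^sup>2" by (simp add: rho_param_def L_def)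
    have "c = sqrt (2 * (\<epsilon> / S)\<^sup>2 / N)"
      using c r by (metis less_imp_le real_sqrt_unique)
    also have "\<dots> \<ge> sqrt ((\<epsilon> / S)\<^sup>2 / N)"
      using N by (intro real_sqrt_le_mono divide_right_mono) auto
    also have "sqrt ((\<epsilon> / S)\<^sup>2 / N) = \<epsilon> / S / sqrt N"
      using S assms(1) by (simp add: real_sqrt_divide)
    finally have "c \<ge> \<epsilon> / S / sqrt N" .
    then have "1 / c \<le> 1 / (\<epsilon> / S / sqrt N)"
      using S assms(1) N c(1) by (intro divide_left_mono mult_pos_pos) auto
    also have "\<dots> = S * sqrt N / \<epsilon>" by simp
    also have "\<dots> \<le> ((sqrt (K + 1) + 1) * sqrt L) * sqrt (real n) / \<epsilon>"
    proof (intro divide_right_mono mult_mono)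
      \<comment> \<open>\<open>L\<close> absorbs \<epsilon> at the expense of a constant depending
        on \<open>K\<close>, so that \<open>S\<close> is of the order of
        \<open>sqrt L\<close>.\<close>
      have "\<epsilon> + L \<le> (K + 1) * L" using assms(4) by (simp add: L_def algebra_simps)
      then have "sqrt (\<epsilon> + L) \<le> sqrt (K + 1) * sqrt L"
        by (metis real_sqrt_le_mono real_sqrt_mult)
      then show "S \<le> (sqrt (K + 1) + 1) * sqrt L" by (simp add: S_def algebra_simps)
    qed (use N L assms in auto)
    finally have c_inv: "1 / c \<le> ((sqrt (K + 1) + 1) * sqrt L) * sqrt (real n) / \<epsilon>" .
    have "measure_pmf.expectation (private_kruskal \<epsilon> \<delta> G) (\<lambda>T. \<Sum>e\<in>T. weight G e) - (\<Sum>e\<in>Tstar. weight G e)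
        \<le> real (n - 1) * (2 / c * ln (card (edges G)))"
      using kruskal_loop_utility[OF G c(1) kruskal_state_init[OF G], of Tstar "weight G"] Ts
      by (simp add: private_kruskal_def c_def n_def)
    \<comment> \<open>The constant 4 is the 2 of the Gibbs bound times the 2 from
      \<open>ln m <= 2 * ln n\<close>, as there are at most n squared edges.\<close>
    also have "\<dots> \<le> real n * ((2 * (((sqrt (K + 1) + 1) * sqrt L) * sqrt (real n) / \<epsilon>)) * (2 * ln (real n)))"
    proof (intro mult_mono)
      have "card (edges G) > 0" using card_edges_ge[OF G] True by (simp add: n_def)
      moreover have "real (card (edges G)) \<le> real n * real n"
        using card_edges_le[OF G] by (simp add: n_def flip: of_nat_mult)
      ultimately have "ln (card (edges G)) \<le> ln (real n * real n)"
        by (subst ln_le_cancel_iff) (use True in auto)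
      then show "ln (card (edges G)) \<le> 2 * ln (real n)"
        using True by (simp add: ln_mult)
      show "0 \<le> ln (card (edges G))" using \<open>card (edges G) > 0\<close> by simp
      show "2 / c \<le> 2 * (((sqrt (K + 1) + 1) * sqrt L) * sqrt (real n) / \<epsilon>)"
        using c_inv by simp
      show "0 \<le> 2 / c * ln (card (edges G))"
        using c(1) \<open>card (edges G) > 0\<close> by (intro mult_nonneg_nonneg) simp_all
    qed (use assms L c True in auto)
    also have "\<dots> = (4 * (sqrt (K + 1) + 1)) * (1 / \<epsilon> * (real n * sqrt (real n)) * ln (real n) * sqrt L)"
      by simp
    also have "real n * sqrt (real n) = real n powr (3 / 2)"
    proof -
      have "real n powr (1 + 1 / 2) = real n * sqrt (real n)"
        using True by (subst powr_add) (simp add: powr_half_sqrt)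
      then show ?thesis by simp
    qed
    finally show ?thesis unfolding n_def L_def .
  qed
qed

section \<open>Hollow heaps\<close>

fun chain :: "(nat \<Rightarrow> nat) \<Rightarrow> nat \<Rightarrow> nat list \<Rightarrow> bool" where
  "chain nx p [] \<longleftrightarrow> p = 0"
| "chain nx p (x # xs) \<longleftrightarrow> p = x \<and> x \<noteq> 0 \<and> chain nx (nx x) xs"

lemma chain_cong: "(\<And>x. x \<in> set xs \<Longrightarrow> nx x = nx' x) \<Longrightarrow> chain nx p xs \<longleftrightarrow> chain nx' p xs"
  by (induction xs arbitrary: p) auto

lemma chain_upd: "y \<notin> set xs \<Longrightarrow> chain (nx(y := z)) p xs \<longleftrightarrow> chain nx p xs"
  by (rule chain_cong) auto

lemma chain_0: "chain nx 0 xs \<longleftrightarrow> xs = []"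
  by (cases xs) auto

lemma chain_pos: "chain nx p xs \<Longrightarrow> p \<noteq> 0 \<Longrightarrow> \<exists>ys. xs = p # ys \<and> chain nx (nx p) ys"
  by (cases xs) auto

text \<open>\<open>m\<close> bounds the nodes ever created and \<open>M\<close> the ranks. The
  exponent \<open>r div 2\<close> reflects that after a decrease a node of rank r may be left with
  its children of ranks r - 1 and r - 2 only; powers of two with halved exponents survive this
  loss.\<close>

locale hollow_heap =
  fixes lt :: "nat \<Rightarrow> nat \<Rightarrow> bool" and M m :: nat
  assumes lt_irrefl: "\<not> lt a a"
    and lt_trans: "lt a b \<Longrightarrow> lt b c \<Longrightarrow> lt a c"
    and lt_total: "a \<noteq> b \<Longrightarrow> lt a b \<or> lt b a"
    and rank_bound: "2 ^ (r div 2) \<le> m \<Longrightarrow> r < M"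
begin

definition table_nodes :: "(nat \<Rightarrow> nat) \<Rightarrow> nat multiset" where
  "table_nodes tab = (\<Sum>r<M. if tab r = 0 then {#} else {#tab r#})"

text \<open>Stated additively, so that no truncated multiset difference arises whichever of the old
  and new entries is null.\<close>

lemma table_nodes_upd:
  assumes "r < M"
  shows "table_nodes (tab(r := a)) + (if tab r = 0 then {#} else {#tab r#}) =
    table_nodes tab + (if a = 0 then {#} else {#a#})"
proof -
  have "table_nodes t = (if t r = 0 then {#} else {#t r#}) +
      (\<Sum>i\<in>{..<M} - {r}. if t i = 0 then {#} else {#t i#})" for t
    unfolding table_nodes_def using assms by (subst sum.remove[of _ r]) auto
  note e = this
  have "(\<Sum>i\<in>{..<M} - {r}. if (tab(r := a)) i = 0 then {#} else {#(tab(r := a)) i#}) =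
      (\<Sum>i\<in>{..<M} - {r}. if tab i = 0 then {#} else {#tab i#})"
    by (rule sum.cong) auto
  then show ?thesis
    using e[of tab] e[of "tab(r := a)"] by simp
qed

lemma in_table_nodes: "x \<in># table_nodes tab \<longleftrightarrow> (\<exists>r<M. tab r = x \<and> x \<noteq> 0)"
  unfolding table_nodes_def by (auto simp: set_mset_sum split: if_splits)

text \<open>\<open>N\<close> are the nodes in the heap and \<open>U\<close> those ever created. Node \<open>a\<close> is full if
  \<open>cur (item a) = a\<close>, otherwise it is hollow: its item has a newer node or has been extracted.
  The multiset equation says that each node occurs exactly once as a root or as a child; acyclicity
  is left to the heap order. For a hollow node, which may have lost children, only the inequality that keeps
  ranks logarithmic is retained.\<close>

definition heap_inv where
  "heap_inv N U ch stk mx cur item rnk chd nx tab \<longleftrightarrow>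
     N \<subseteq> U \<and> finite U \<and> 0 \<notin> U \<and> card U \<le> m \<and>
     mset stk + table_nodes tab + (\<Sum>a\<in>N. mset (ch a)) = mset_set N \<and>
     (\<forall>a\<in>N. chain nx (chd a) (ch a)) \<and>
     (\<forall>a\<in>N. \<forall>c\<in>set (ch a). lt a c) \<and>
     (\<forall>a\<in>N. cur (item a) = a \<longrightarrow> map rnk (ch a) = rev [0..<rnk a]) \<and>
     (\<forall>a\<in>N. cur (item a) \<noteq> a \<longrightarrow> 2 ^ (rnk a div 2) \<le> Suc (\<Sum>c\<leftarrow>ch a. 2 ^ (rnk c div 2))) \<and>
     (\<forall>a. a \<notin> U \<longrightarrow> rnk a = 0 \<and> chd a = 0) \<and>
     (\<forall>r. tab r \<noteq> 0 \<longrightarrow> r < mx \<and> rnk (tab r) = r \<and> cur (item (tab r)) = tab r) \<and>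
     mx \<le> M \<and>
     (\<forall>v. cur v \<noteq> (0::nat) \<longrightarrow> cur v \<in> N \<and> item (cur v) = v)"

definition hollow_children ::
    "nat set \<Rightarrow> (nat \<Rightarrow> nat list) \<Rightarrow> (nat \<Rightarrow> nat) \<Rightarrow> (nat \<Rightarrow> nat) \<Rightarrow> nat" where
  "hollow_children N ch cur item = (\<Sum>a\<in>N. if cur (item a) = a then 0 else length (ch a))"

text \<open>The weights are chosen such that every pass of the consolidation loop releases a unit: it drops a
  hollow root (2 units), replaces a child of a hollow node by a root (3 for 2), moves a root into the
  rank table (2 for 1) or links it with the root found there.\<close>

definition potential where
  "potential N ch stk cur item tab =
     2 * length stk + size (table_nodes tab) + 3 * hollow_children N ch cur item"

context
  fixes N U :: "nat set" and ch :: "nat \<Rightarrow> nat list" and stk mx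
    and cur item rnk chd nx tab :: "nat \<Rightarrow> nat"
  assumes inv: "heap_inv N U ch stk mx cur item rnk chd nx tab"
begin

section \<open>Consequences of the heap invariant\<close>

lemma inv_simps:
  shows "N \<subseteq> U" "finite U" "0 \<notin> U" "card U \<le> m" "finite N" "0 \<notin> N"
    "mset stk + table_nodes tab + (\<Sum>a\<in>N. mset (ch a)) = mset_set N"
    "\<And>a. a \<in> N \<Longrightarrow> chain nx (chd a) (ch a)"
    "\<And>a c. a \<in> N \<Longrightarrow> c \<in> set (ch a) \<Longrightarrow> lt a c"
    "\<And>a. a \<in> N \<Longrightarrow> cur (item a) = a \<Longrightarrow> map rnk (ch a) = rev [0..<rnk a]"
    "\<And>a. a \<in> N \<Longrightarrow> cur (item a) \<noteq> a \<Longrightarrow> 2 ^ (rnk a div 2) \<le> Suc (\<Sum>c\<leftarrow>ch a. 2 ^ (rnk c div 2))"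
    "\<And>a. a \<notin> U \<Longrightarrow> rnk a = 0" "\<And>a. a \<notin> U \<Longrightarrow> chd a = 0"
    "\<And>r. tab r \<noteq> 0 \<Longrightarrow> r < mx" "\<And>r. tab r \<noteq> 0 \<Longrightarrow> rnk (tab r) = r"
    "\<And>r. tab r \<noteq> 0 \<Longrightarrow> cur (item (tab r)) = tab r"
    "mx \<le> M" "\<And>v. cur v \<noteq> 0 \<Longrightarrow> cur v \<in> N" "\<And>v. cur v \<noteq> 0 \<Longrightarrow> item (cur v) = v"
proof -
  show "finite N" "0 \<notin> N"
    using inv unfolding heap_inv_def by (auto intro: finite_subset)
qed (use inv in \<open>(simp add: heap_inv_def)+\<close>)

lemma sum_children_split:
  "p \<in> N \<Longrightarrow> (\<Sum>a\<in>N. mset (ch a)) = mset (ch p) + (\<Sum>a\<in>N - {p}. mset (ch a))"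
  using inv_simps(5) by (rule sum.remove)

text \<open>Multiplicity at most one in the node equation is the source of all structural facts
  below: roots are nobody's children, sibling lists are distinct, and parents are unique.\<close>

lemma count_nodes: "count (mset stk + table_nodes tab + (\<Sum>a\<in>N. mset (ch a))) x \<le> 1"
  using inv_simps(5) by (simp add: inv_simps(7) count_mset_set')

lemma count_le_children: "p \<in> N \<Longrightarrow> count (mset (ch p)) x \<le> count (\<Sum>a\<in>N. mset (ch a)) x"
  by (simp add: sum_children_split)

lemma root_node: "x \<in># mset stk + table_nodes tab \<Longrightarrow> x \<in> N"
  using inv_simps(5) inv_simps(7) by (metis finite_set_mset_mset_set union_iff)

lemma child_node: "p \<in> N \<Longrightarrow> x \<in> set (ch p) \<Longrightarrow> x \<in> N"
  using inv_simps(5) inv_simps(7) sum_children_split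
  by (metis finite_set_mset_mset_set set_mset_mset union_iff)

lemma root_not_child: "x \<in># mset stk + table_nodes tab \<Longrightarrow> p \<in> N \<Longrightarrow> x \<notin> set (ch p)"
proof
  assume "x \<in># mset stk + table_nodes tab" "p \<in> N" "x \<in> set (ch p)"
  then have "x \<in># (\<Sum>a\<in>N. mset (ch a))"
    by (simp add: sum_children_split)
  then have "count (mset stk + table_nodes tab) x \<ge> 1" "count (\<Sum>a\<in>N. mset (ch a)) x \<ge> 1"
    using \<open>x \<in># mset stk + table_nodes tab\<close> by (simp_all only: Suc_le_eq One_nat_def count_greater_zero_iff)
  then show False
    using count_nodes[of x] unfolding count_union by linarith
qed

lemma distinct_children: "p \<in> N \<Longrightarrow> distinct (ch p)"
  unfolding distinct_count_atmost_1
proof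
  fix x assume p: "p \<in> N"
  have "count (mset (ch p)) x \<le> 1"
    using count_le_children[OF p, of x] count_nodes[of x] by simp
  then show "count (mset (ch p)) x = (if x \<in> set (ch p) then 1 else 0)"
    by (metis One_nat_def count_eq_zero_iff le_Suc_eq le_zero_eq set_mset_mset)
qed

lemma children_disjoint:
  assumes "p \<in> N" "q \<in> N" "p \<noteq> q" "x \<in> set (ch p)"
  shows "x \<notin> set (ch q)"
proof
  assume "x \<in> set (ch q)"
  then have "count (mset (ch q)) x \<ge> 1" "count (mset (ch p)) x \<ge> 1"
    using assms(4) by (metis One_nat_def Suc_leI count_greater_zero_iff set_mset_mset)+
  moreover have "(\<Sum>a\<in>N. mset (ch a)) = mset (ch p) + (mset (ch q) + (\<Sum>a\<in>N - {p} - {q}. mset (ch a)))"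
    using assms inv_simps(5) by (subst sum_children_split[OF assms(1)], subst sum.remove[of _ q]) auto
  then have "count (\<Sum>a\<in>N. mset (ch a)) x =
      count (mset (ch p)) x + (count (mset (ch q)) x + count (\<Sum>a\<in>N - {p} - {q}. mset (ch a)) x)"
    by (simp only: count_union)
  ultimately have "count (\<Sum>a\<in>N. mset (ch a)) x \<ge> 2"
    by linarith
  then show False
    using count_nodes[of x] unfolding count_union by linarith
qed

lemma root_or_child: "x \<in> N \<Longrightarrow> x \<in># mset stk + table_nodes tab \<or> (\<exists>p\<in>N. x \<in> set (ch p))"
proof -
  assume "x \<in> N"
  then have "x \<in># mset stk + table_nodes tab + (\<Sum>a\<in>N. mset (ch a))"
    using inv_simps(5,7) by simp
  then show ?thesis
    using inv_simps(5) by (auto simp: set_mset_sum)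
qed

text \<open>A child lies above its parent in the order, so the least node has none. Only roots need
  to be inspected for the minimum.\<close>

lemma least_node_is_root:
  assumes "x \<in> N" "\<And>y. y \<in> N \<Longrightarrow> y \<noteq> x \<Longrightarrow> lt x y"
  shows "x \<in># mset stk + table_nodes tab"
  using root_or_child[OF assms(1)] assms inv_simps(9) lt_irrefl lt_trans by metis

text \<open>Induction in steps of two: doubling \<open>2 ^ (k div 2)\<close> is paid for by the two
  topmost children, of ranks k + 1 and k.\<close>

lemma sum_pow2_half: "2 ^ (r div 2) \<le> Suc (\<Sum>j\<leftarrow>rev [0..<r]. 2 ^ (j div 2))"
proof (induction r rule: less_induct)
  case (less r)
  show ?case
  proof (cases "r < 2")
    case True
    then show ?thesis by (cases r) auto
  next
    case False
    then obtain k where r: "r = Suc (Suc k)"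
      by (metis One_nat_def Suc_1 add_2_eq_Suc le_add_diff_inverse not_less)
    have "(2::nat) ^ (k div 2) \<le> 2 ^ (Suc k div 2)"
      by (rule power_increasing) auto
    then show ?thesis
      by (simp add: r le_SucI trans_le_add1)
  qed
qed

lemma node_rank_le: "a \<in> N \<Longrightarrow> 2 ^ (rnk a div 2) \<le> Suc (\<Sum>c\<leftarrow>ch a. 2 ^ (rnk c div 2))"
proof (cases "cur (item a) = a")
  assume "a \<in> N" and f: "cur (item a) = a"
  then have "(\<Sum>c\<leftarrow>ch a. 2 ^ (rnk c div 2)) = (\<Sum>j\<leftarrow>rev [0..<rnk a]. (2::nat) ^ (j div 2))"
    using inv_simps(10)[of a] by (metis (no_types, lifting) list.map_comp o_def map_eq_conv)
  then show ?thesis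
    using sum_pow2_half by simp
qed (rule inv_simps)

text \<open>Summing the local rank inequality over all nodes, every non-root occurs once as a child and
  cancels, so no reasoning about subtree sizes is needed.\<close>

lemma root_rank_le: 
  assumes "a \<in># mset stk + table_nodes tab"
  shows "rnk a < M"
proof -
  let ?g = "\<lambda>a. (2::nat) ^ (rnk a div 2)"
  have "(\<Sum>a\<in>N. ?g a) \<le> (\<Sum>a\<in>N. Suc (\<Sum>c\<leftarrow>ch a. ?g c))"
    by (rule sum_mono) (rule node_rank_le)
  also have "\<dots> = card N + (\<Sum>a\<in>N. \<Sum>c\<in>#mset (ch a). ?g c)"
    by (simp add: sum.distrib sum_Suc flip: sum_mset_sum_list mset_map)
  also have "(\<Sum>a\<in>N. \<Sum>c\<in>#mset (ch a). ?g c) = (\<Sum>c\<in>#(\<Sum>a\<in>N. mset (ch a)). ?g c)"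
    using inv_simps(5) by (induction N rule: finite_induct) auto
  finally have 1: "(\<Sum>a\<in>N. ?g a) \<le> card N + (\<Sum>c\<in>#(\<Sum>a\<in>N. mset (ch a)). ?g c)" .
  have "(\<Sum>a\<in>N. ?g a) = (\<Sum>c\<in>#mset_set N. ?g c)"
    by (simp add: sum_unfold_sum_mset)
  also have "\<dots> = (\<Sum>c\<in>#mset stk + table_nodes tab. ?g c) + (\<Sum>c\<in>#(\<Sum>a\<in>N. mset (ch a)). ?g c)"
    by (simp flip: inv_simps(7))
  finally have 2: "(\<Sum>c\<in>#mset stk + table_nodes tab. ?g c) \<le> card N"
    using 1 by simp
  obtain B where "mset stk + table_nodes tab = add_mset a B"
    using assms by (metis mset_add)
  then have "?g a \<le> card N"
    using 2 by simp
  also have "\<dots> \<le> m"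
    using card_mono[OF inv_simps(2,1)] inv_simps(4) by simp
  finally show ?thesis
    by (rule rank_bound)
qed

end

section \<open>Effect of the operations on invariant and potential\<close>

lemma sum_children_upd:
  assumes "finite N" "p \<in> N"
  shows "(\<Sum>a\<in>N. mset ((ch(p := cs)) a)) + mset (ch p) = (\<Sum>a\<in>N. mset (ch a)) + mset cs"
proof -
  have e: "(\<Sum>a\<in>N. mset (f a)) = mset (f p) + (\<Sum>a\<in>N - {p}. mset (f a))" for f
    using assms by (rule sum.remove)
  have "(\<Sum>a\<in>N - {p}. mset ((ch(p := cs)) a)) = (\<Sum>a\<in>N - {p}. mset (ch a))"
    by (rule sum.cong) auto
  then show ?thesis
    using e[of ch] e[of "ch(p := cs)"] by simp
qed

lemma hollow_children_upd:
  assumes "finite N" "p \<in> N" "cur (item p) \<noteq> p"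
  shows "hollow_children N (ch(p := cs)) cur item + length (ch p) = hollow_children N ch cur item + length cs"
proof -
  have e: "hollow_children N f cur item = length (f p) + (\<Sum>a\<in>N - {p}. if cur (item a) = a then 0 else length (f a))" for f
    unfolding hollow_children_def using assms by (subst sum.remove[of _ p]) auto
  have "(\<Sum>a\<in>N - {p}. if cur (item a) = a then 0 else length ((ch(p := cs)) a)) =
      (\<Sum>a\<in>N - {p}. if cur (item a) = a then 0 else length (ch a))"
    by (rule sum.cong) auto
  then show ?thesis
    using e[of ch] e[of "ch(p := cs)"] by simp
qed

text \<open>Cells of indices outside \<open>U\<close> still hold 0, so a fresh node is a childless
  root of rank 0 without further initialisation. It pays the 2 units of a stack entry.\<close>

lemma inv_insert:
  assumes inv: "heap_inv N U ch stk mx cur item rnk chd nx tab"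
    and e: "cur v = 0" "e \<notin> U" "e \<noteq> 0" "card (insert e U) \<le> m"
  shows "heap_inv (insert e N) (insert e U) (ch(e := [])) (stk @ [e]) mx (cur(v := e)) (item(e := v)) rnk chd nx tab"
    "potential (insert e N) (ch(e := [])) (stk @ [e]) (cur(v := e)) (item(e := v)) tab = potential N ch stk cur item tab + 2"
proof -
  note i = inv_simps[OF inv]
  have eN: "e \<notin> N" using i(1) e(2) by auto
  have full: "(cur(v := e)) ((item(e := v)) a) = a \<longleftrightarrow> cur (item a) = a" if "a \<in> N" for a
  proof -
    have "a \<noteq> e" "a \<noteq> 0" using that eN i(6) by metis+
    then show ?thesis using e(1) by auto
  qed
  have ch: "(\<Sum>a\<in>N. mset ((ch(e := [])) a)) = (\<Sum>a\<in>N. mset (ch a))"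
    by (rule sum.cong) (use eN in auto)
  have tabN: "tab r \<noteq> 0 \<Longrightarrow> tab r \<in> N" for r
    using i(16,18) by metis
  have m: "mset (stk @ [e]) + table_nodes tab + (\<Sum>a\<in>insert e N. mset ((ch(e := [])) a)) = mset_set (insert e N)"
    using i(5,7) eN by (simp add: ch fun_upd_same del: fun_upd_apply)
  show "heap_inv (insert e N) (insert e U) (ch(e := [])) (stk @ [e]) mx (cur(v := e)) (item(e := v)) rnk chd nx tab"
    unfolding heap_inv_def
  proof (intro conjI m)
    show "\<forall>a\<in>insert e N. chain nx (chd a) ((ch(e := [])) a)"
      using i(8,13) e(2) by auto
    show "\<forall>a\<in>insert e N. \<forall>c\<in>set ((ch(e := [])) a). lt a c"
      using i(9) by auto
    show "\<forall>a\<in>insert e N. (cur(v := e)) ((item(e := v)) a) = a \<longrightarrow> map rnk ((ch(e := [])) a) = rev [0..<rnk a]"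
      using i(10,12) e(2) full eN by auto
    show "\<forall>a\<in>insert e N. (cur(v := e)) ((item(e := v)) a) \<noteq> a \<longrightarrow>
        2 ^ (rnk a div 2) \<le> Suc (\<Sum>c\<leftarrow>(ch(e := [])) a. 2 ^ (rnk c div 2))"
      using i(11) full eN by auto
    show "\<forall>r. tab r \<noteq> 0 \<longrightarrow> r < mx \<and> rnk (tab r) = r \<and> (cur(v := e)) ((item(e := v)) (tab r)) = tab r"
      using i(14,15,16) full tabN by blast
    show "\<forall>w. (cur(v := e)) w \<noteq> 0 \<longrightarrow> (cur(v := e)) w \<in> insert e N \<and> (item(e := v)) ((cur(v := e)) w) = w"
      using i(18,19) eN by auto
  qed (use i e in auto)
  have "hollow_children (insert e N) (ch(e := [])) (cur(v := e)) (item(e := v)) = hollow_children N ch cur item"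
    unfolding hollow_children_def using i(5) eN
    by (subst sum.insert) (auto intro!: sum.cong simp: full simp del: fun_upd_apply, auto)
  then show "potential (insert e N) (ch(e := [])) (stk @ [e]) (cur(v := e)) (item(e := v)) tab = potential N ch stk cur item tab + 2"
    by (simp add: potential_def)
qed

text \<open>A hollow root is dismantled child by child: it goes back on the stack below its first
  child. Resetting its rank to 0 makes the inequality required of hollow nodes trivial. One hollow
  child (3 units) becomes one stack entry (2 units).\<close>

lemma inv_consume:
  assumes inv: "heap_inv N U ch (stk @ [a]) mx cur item rnk chd nx tab"
    and a: "cur (item a) \<noteq> a" "chd a \<noteq> 0"
  shows "heap_inv N U (ch(a := tl (ch a))) (stk @ [a, chd a]) mx cur item (rnk(a := 0)) (chd(a := nx (chd a))) nx tab"
    "Suc (potential N (ch(a := tl (ch a))) (stk @ [a, chd a]) cur item tab) = potential N ch (stk @ [a]) cur item tab"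
proof -
  note i = inv_simps[OF inv]
  have aN: "a \<in> N" by (rule root_node[OF inv]) auto
  obtain cs where cs: "ch a = chd a # cs" "chain nx (nx (chd a)) cs"
    using chain_pos[OF i(8)[OF aN] a(2)] by auto
  define c where "c = chd a"
  have cN: "c \<in> N" using child_node[OF inv aN, of c] cs by (simp add: c_def)
  have rc: "a \<notin> set (ch p)" if "p \<in> N" for p
    by (rule root_not_child[OF inv _ that]) auto
  have map_eq: "map (rnk(a := 0)) (ch p) = map rnk (ch p)" if "p \<in> N" for p
    using rc[OF that] by auto
  have g_eq: "(\<Sum>c\<leftarrow>ch p. 2 ^ ((rnk(a := 0)) c div 2)) = (\<Sum>c\<leftarrow>ch p. (2::nat) ^ (rnk c div 2))" if "p \<in> N" for p
    by (intro arg_cong[where f = sum_list] map_cong refl) (use rc[OF that] in auto)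
  have m: "mset (stk @ [a, c]) + table_nodes tab + (\<Sum>p\<in>N. mset ((ch(a := tl (ch a))) p)) = mset_set N"
  proof -
    have "(\<Sum>p\<in>N. mset (ch p)) = add_mset c (\<Sum>p\<in>N. mset ((ch(a := tl (ch a))) p))"
      using sum_children_upd[OF i(5) aN, of ch "tl (ch a)"] cs(1) by (simp add: c_def del: fun_upd_apply)
    then show ?thesis
      using i(7) by (simp add: add_mset_commute del: fun_upd_apply)
  qed
  have tabN: "tab r \<noteq> a" if "tab r \<noteq> 0" for r
    using i(16)[OF that] a(1) by metis
  show "heap_inv N U (ch(a := tl (ch a))) (stk @ [a, chd a]) mx cur item (rnk(a := 0)) (chd(a := nx (chd a))) nx tab"
    unfolding heap_inv_def c_def[symmetric]
  proof (intro conjI m)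
    show "\<forall>p\<in>N. chain nx ((chd(a := nx c)) p) ((ch(a := tl (ch a))) p)"
      using i(8) cs by (auto simp: c_def)
    show "\<forall>p\<in>N. \<forall>c\<in>set ((ch(a := tl (ch a))) p). lt p c"
      using i(9) cs by auto
    show "\<forall>p\<in>N. cur (item p) = p \<longrightarrow> map (rnk(a := 0)) ((ch(a := tl (ch a))) p) = rev [0..<(rnk(a := 0)) p]"
    proof (intro ballI impI)
      fix p assume p: "p \<in> N" "cur (item p) = p"
      then have "p \<noteq> a" using a(1) by auto
      then show "map (rnk(a := 0)) ((ch(a := tl (ch a))) p) = rev [0..<(rnk(a := 0)) p]"
        using map_eq[OF p(1)] i(10)[OF p] by (simp del: fun_upd_apply map_eq_conv add: fun_upd_other)
    qed
    show "\<forall>p\<in>N. cur (item p) \<noteq> p \<longrightarrow> 2 ^ ((rnk(a := 0)) p div 2) \<le>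
        Suc (\<Sum>c\<leftarrow>(ch(a := tl (ch a))) p. 2 ^ ((rnk(a := 0)) c div 2))"
    proof (intro ballI impI)
      fix p assume p: "p \<in> N" "cur (item p) \<noteq> p"
      show "2 ^ ((rnk(a := 0)) p div 2) \<le> Suc (\<Sum>c\<leftarrow>(ch(a := tl (ch a))) p. 2 ^ ((rnk(a := 0)) c div 2))"
      proof (cases "p = a")
        case False
        then show ?thesis
          using g_eq[OF p(1)] i(11)[OF p] by (simp del: fun_upd_apply add: fun_upd_other)
      qed simp
    qed
    show "\<forall>r. tab r \<noteq> 0 \<longrightarrow> r < mx \<and> (rnk(a := 0)) (tab r) = r \<and> cur (item (tab r)) = tab r"
      using i(14,15,16) tabN by auto
  qed (use i aN in auto)
  show "Suc (potential N (ch(a := tl (ch a))) (stk @ [a, chd a]) cur item tab) = potential N ch (stk @ [a]) cur item tab"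
    using hollow_children_upd[where cur = cur and item = item, OF i(5) aN a(1), of ch "tl (ch a)"] cs(1) by (simp add: potential_def)
qed

text \<open>The node leaves \<open>N\<close> but stays in \<open>U\<close>, so its index is never
  taken for a fresh one.\<close>

lemma inv_discard:
  assumes inv: "heap_inv N U ch (stk @ [a]) mx cur item rnk chd nx tab"
    and a: "cur (item a) \<noteq> a" "chd a = 0"
  shows "heap_inv (N - {a}) U ch stk mx cur item (rnk(a := 0)) chd nx tab"
    "potential (N - {a}) ch stk cur item tab < potential N ch (stk @ [a]) cur item tab"
proof -
  note i = inv_simps[OF inv]
  have aN: "a \<in> N" by (rule root_node[OF inv]) auto
  have cs: "ch a = []"
    using i(8)[OF aN] a(2) by (simp add: chain_0)
  have rc: "a \<notin> set (ch p)" if "p \<in> N" for p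
    by (rule root_not_child[OF inv _ that]) auto
  have map_eq: "map (rnk(a := 0)) (ch p) = map rnk (ch p)" if "p \<in> N" for p
    using rc[OF that] by auto
  have g_eq: "(\<Sum>c\<leftarrow>ch p. 2 ^ ((rnk(a := 0)) c div 2)) = (\<Sum>c\<leftarrow>ch p. (2::nat) ^ (rnk c div 2))" if "p \<in> N" for p
    by (intro arg_cong[where f = sum_list] map_cong refl) (use rc[OF that] in auto)
  have "mset stk + table_nodes tab + (\<Sum>p\<in>N - {a}. mset (ch p)) + {#a#} = mset_set (N - {a}) + {#a#}"
    using i(7) sum_children_split[OF inv aN] cs mset_set.remove[OF i(5) aN] by simp
  then have m: "mset stk + table_nodes tab + (\<Sum>p\<in>N - {a}. mset (ch p)) = mset_set (N - {a})"
    by simp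
  have tabN: "tab r \<noteq> a" if "tab r \<noteq> 0" for r
    using i(16)[OF that] a(1) by metis
  show "heap_inv (N - {a}) U ch stk mx cur item (rnk(a := 0)) chd nx tab"
    unfolding heap_inv_def
  proof (intro conjI m)
    show "\<forall>p\<in>N - {a}. cur (item p) \<noteq> p \<longrightarrow> 2 ^ ((rnk(a := 0)) p div 2) \<le>
        Suc (\<Sum>c\<leftarrow>ch p. 2 ^ ((rnk(a := 0)) c div 2))"
      using i(11) g_eq by (auto simp del: fun_upd_apply simp: fun_upd_other)
    show "\<forall>p\<in>N - {a}. cur (item p) = p \<longrightarrow> map (rnk(a := 0)) (ch p) = rev [0..<(rnk(a := 0)) p]"
    proof (intro ballI impI)
      fix p assume "p \<in> N - {a}" "cur (item p) = p"
      then show "map (rnk(a := 0)) (ch p) = rev [0..<(rnk(a := 0)) p]"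
        using map_eq[of p] i(10)[of p] by (simp del: fun_upd_apply map_eq_conv add: fun_upd_other)
    qed
    show "\<forall>r. tab r \<noteq> 0 \<longrightarrow> r < mx \<and> (rnk(a := 0)) (tab r) = r \<and> cur (item (tab r)) = tab r"
      using i(14,15,16) tabN by auto
    show "\<forall>v. cur v \<noteq> 0 \<longrightarrow> cur v \<in> N - {a} \<and> item (cur v) = v"
    proof (intro allI impI)
      fix v assume "cur v \<noteq> 0"
      then have "cur v \<in> N" "item (cur v) = v" by (rule i(18), rule i(19))
      then show "cur v \<in> N - {a} \<and> item (cur v) = v" using a(1) by auto
    qed
  qed (use i in auto)
  have "hollow_children N ch cur item = hollow_children (N - {a}) ch cur item"
    unfolding hollow_children_def using i(5) aN cs by (subst sum.remove[of _ a]) auto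
  then show "potential (N - {a}) ch stk cur item tab < potential N ch (stk @ [a]) cur item tab"
    by (simp add: potential_def)
qed

lemma inv_to_table:
  assumes inv: "heap_inv N U ch (stk @ [a]) mx cur item rnk chd nx tab"
    and a: "cur (item a) = a" "tab (rnk a) = 0"
  shows "heap_inv N U ch stk (max mx (Suc (rnk a))) cur item rnk chd nx (tab(rnk a := a))"
    "Suc (potential N ch stk cur item (tab(rnk a := a))) = potential N ch (stk @ [a]) cur item tab"
proof -
  note i = inv_simps[OF inv]
  have aN: "a \<in> N" by (rule root_node[OF inv]) auto
  have a0: "a \<noteq> 0" using aN i(6) by metis
  have r: "rnk a < M" by (rule root_rank_le[OF inv]) auto
  have t: "table_nodes (tab(rnk a := a)) = add_mset a (table_nodes tab)"
    using table_nodes_upd[OF r, of tab a] a(2) a0 by simp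
  show "heap_inv N U ch stk (max mx (Suc (rnk a))) cur item rnk chd nx (tab(rnk a := a))"
    unfolding heap_inv_def t using i a r by (auto simp: less_max_iff_disj)
  show "Suc (potential N ch stk cur item (tab(rnk a := a))) = potential N ch (stk @ [a]) cur item tab"
    by (simp add: potential_def t)
qed

text \<open>The loser has the rank of the winner and becomes its first child, so the children of the
  winner keep the ranks r, ..., 0 in descending order. Stack entry and table entry (2 + 1 units)
  become one stack entry.\<close>

lemma inv_link:
  assumes inv: "heap_inv N U ch (stk @ [a]) mx cur item rnk chd nx tab"
    and a: "cur (item a) = a" "tab (rnk a) \<noteq> 0"
    and wl: "w = a \<and> l = tab (rnk a) \<or> w = tab (rnk a) \<and> l = a" "lt w l"
  shows "heap_inv N U (ch(w := l # ch w)) (stk @ [w]) mx cur item (rnk(w := Suc (rnk w)))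
           (chd(w := l)) (nx(l := chd w)) (tab(rnk a := 0))"
    "Suc (potential N (ch(w := l # ch w)) (stk @ [w]) cur item (tab(rnk a := 0))) = potential N ch (stk @ [a]) cur item tab"
proof -
  note i = inv_simps[OF inv]
  define r b where "r = rnk a" and "b = tab r"
  have rM: "r < M" unfolding r_def by (rule root_rank_le[OF inv]) auto
  have b: "b \<noteq> 0" "rnk b = r" "cur (item b) = b" "b \<in># table_nodes tab"
    using a(2) i(15,16) rM by (auto simp: b_def r_def in_table_nodes)
  have roots: "w \<in># mset (stk @ [a]) + table_nodes tab" "l \<in># mset (stk @ [a]) + table_nodes tab"
    using wl b(4) by (auto simp: b_def r_def)
  have wlN: "w \<in> N" "l \<in> N" using roots by (auto intro: root_node[OF inv])
  have wl': "rnk w = r" "rnk l = r" "cur (item w) = w" "cur (item l) = l" "l \<noteq> 0" "w \<noteq> l"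
  proof -
    have "a \<in> N" by (rule root_node[OF inv]) auto
    then have "a \<noteq> 0" using i(6) by metis
    then show "rnk w = r" "rnk l = r" "cur (item w) = w" "cur (item l) = l" "l \<noteq> 0" "w \<noteq> l"
      using wl a(1) b lt_irrefl by (auto simp: r_def b_def)
  qed
  have rc: "w \<notin> set (ch p)" "l \<notin> set (ch p)" if "p \<in> N" for p
    using root_not_child[OF inv _ that] roots by blast+
  let ?rnk = "rnk(w := Suc (rnk w))"
  have map_eq: "map ?rnk (ch p) = map rnk (ch p)" if "p \<in> N" for p
    using rc[OF that] by auto
  have g_eq: "(\<Sum>c\<leftarrow>ch p. 2 ^ (?rnk c div 2)) = (\<Sum>c\<leftarrow>ch p. (2::nat) ^ (rnk c div 2))" if "p \<in> N" for p
    by (intro arg_cong[where f = sum_list] map_cong refl) (use rc[OF that] in auto)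
  have t: "table_nodes tab = add_mset b (table_nodes (tab(r := 0)))"
    using table_nodes_upd[OF rM, of tab 0] b(1) by (simp add: b_def)
  have S: "(\<Sum>p\<in>N. mset ((ch(w := l # ch w)) p)) = add_mset l (\<Sum>p\<in>N. mset (ch p))"
    using sum_children_upd[OF i(5) wlN(1), of ch "l # ch w"] by (simp del: fun_upd_apply)
  have "{#w#} + {#l#} = {#a#} + {#b#}"
    using wl by (auto simp: b_def r_def)
  then have "mset (stk @ [w]) + table_nodes (tab(r := 0)) + (\<Sum>p\<in>N. mset ((ch(w := l # ch w)) p)) =
    mset (stk @ [a]) + table_nodes tab + (\<Sum>p\<in>N. mset (ch p))"
    unfolding S t by (simp add: add_mset_commute)
  then have m: "mset (stk @ [w]) + table_nodes (tab(r := 0)) + (\<Sum>p\<in>N. mset ((ch(w := l # ch w)) p)) = mset_set N"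
    using i(7) by (rule trans)
  \<comment> \<open>Table entries sit at the index of their own rank, so \<open>w\<close> could only
    be in slot \<open>r\<close>, which is cleared; its change of rank therefore disturbs no
    entry.\<close>
  have tabw: "tab q \<noteq> w" if "tab q \<noteq> 0" "q \<noteq> r" for q
    using i(15)[OF that(1)] that(2) wl'(1) by metis
  show "heap_inv N U (ch(w := l # ch w)) (stk @ [w]) mx cur item ?rnk
           (chd(w := l)) (nx(l := chd w)) (tab(rnk a := 0))"
    unfolding heap_inv_def r_def[symmetric]
  proof (intro conjI m)
    show "\<forall>p\<in>N. chain (nx(l := chd w)) ((chd(w := l)) p) ((ch(w := l # ch w)) p)"
      using i(8) rc wl'(5,6) by (auto simp: chain_upd)
    show "\<forall>p\<in>N. \<forall>c\<in>set ((ch(w := l # ch w)) p). lt p c"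
      using i(9) wl(2) by auto
    show "\<forall>p\<in>N. cur (item p) = p \<longrightarrow> map ?rnk ((ch(w := l # ch w)) p) = rev [0..<?rnk p]"
    proof (intro ballI impI)
      fix p assume p: "p \<in> N" "cur (item p) = p"
      show "map ?rnk ((ch(w := l # ch w)) p) = rev [0..<?rnk p]"
        using map_eq[OF p(1)] i(10)[OF p] wl' by (cases "p = w") (simp_all del: map_eq_conv)
    qed
    show "\<forall>p\<in>N. cur (item p) \<noteq> p \<longrightarrow> 2 ^ (?rnk p div 2) \<le>
        Suc (\<Sum>c\<leftarrow>(ch(w := l # ch w)) p. 2 ^ (?rnk c div 2))"
    proof (intro ballI impI)
      fix p assume p: "p \<in> N" "cur (item p) \<noteq> p"
      then have "p \<noteq> w" using wl'(3) by auto
      then show "2 ^ (?rnk p div 2) \<le> Suc (\<Sum>c\<leftarrow>(ch(w := l # ch w)) p. 2 ^ (?rnk c div 2))"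
        using i(11)[OF p] g_eq[OF p(1)] by (simp del: fun_upd_apply add: fun_upd_other)
    qed
    show "\<forall>q. (tab(r := 0)) q \<noteq> 0 \<longrightarrow> q < mx \<and> ?rnk ((tab(r := 0)) q) = q \<and>
        cur (item ((tab(r := 0)) q)) = (tab(r := 0)) q"
      using i(14,15,16) tabw by auto
    show "\<forall>p. p \<notin> U \<longrightarrow> ?rnk p = 0 \<and> (chd(w := l)) p = 0"
      using i(1,12,13) wlN(1) by auto
  qed (use i in auto)
  have "hollow_children N (ch(w := l # ch w)) cur item = hollow_children N ch cur item"
    unfolding hollow_children_def using wl'(3) by (intro sum.cong) auto
  then show "Suc (potential N (ch(w := l # ch w)) (stk @ [w]) cur item (tab(rnk a := 0))) = potential N ch (stk @ [a]) cur item tab"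
    unfolding potential_def t r_def[symmetric] by simp
qed

text \<open>The new node inherits the children of ranks below ru - 2 and so has rank ru - 2. The two
  children left behind justify the rank of the superseded node. Price: 2 units for the stack entry
  and 3 for each of the two hollow children. An empty rank table ensures that no entry turns
  hollow.\<close>

lemma inv_decrease:
  assumes inv: "heap_inv N U ch stk mx cur item rnk chd nx tab"
    and tab: "\<And>r. tab r = 0"
    and e: "cur v \<noteq> 0" "lt e (cur v)" "e \<notin> U" "e \<noteq> 0" "card (insert e U) \<le> m"
    and new: "ru = rnk (cur v)" "c2 = nx (chd (cur v))"
      "if ru < 2 then rnk' = rnk \<and> chd' = chd \<and> nx' = nx
       else rnk' = rnk(e := ru - 2) \<and> chd' = chd(e := nx c2) \<and> nx' = nx(c2 := 0)"
  shows "\<exists>ch'. heap_inv (insert e N) (insert e U) ch' (stk @ [e]) mx (cur(v := e)) (item(e := v)) rnk' chd' nx' tab \<and>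
    potential (insert e N) ch' (stk @ [e]) (cur(v := e)) (item(e := v)) tab \<le> potential N ch stk cur item tab + 8"
proof -
  note i = inv_simps[OF inv]
  define u where "u = cur v"
  have u: "u \<in> N" "item u = v" "cur (item u) = u" "u \<noteq> 0"
    using i(18)[OF e(1)] i(19)[OF e(1)] e(1) by (simp_all add: u_def)
  have eN: "e \<notin> N" using i(1) e(3) by auto
  have full: "(cur(v := e)) ((item(e := v)) a) = a \<longleftrightarrow> cur (item a) = a \<and> a \<noteq> u" if "a \<in> N" for a
    using that eN u(2) by (auto simp: u_def)
  have ranks: "map rnk (ch u) = rev [0..<ru]"
    using i(10)[OF u(1,3)] by (simp add: new(1) u_def)
  define cs0 where "cs0 = (if ru < 2 then [] else drop 2 (ch u))"
  define cs1 where "cs1 = (if ru < 2 then ch u else take 2 (ch u))"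
  define ch' where "ch' = ch(u := cs1, e := cs0)"
  have len: "length (ch u) = ru" using ranks by (metis length_map length_rev length_upt minus_nat.diff_0)
  have split: "ch u = cs1 @ cs0" "length cs1 \<le> 2" "length cs0 = ru - 2"
    using len by (auto simp: cs0_def cs1_def)
  have ch'_simps: "ch' e = cs0" "ch' u = cs1" "\<And>a. a \<noteq> e \<Longrightarrow> a \<noteq> u \<Longrightarrow> ch' a = ch a"
    using u(1) eN by (auto simp: ch'_def)
  have eU: "rnk e = 0" "chd e = 0" using i(12,13) e(3) by auto
  \<comment> \<open>For \<open>ru < 2\<close> the untouched cell of the fresh node holds 0, which is
    the truncated value of \<open>ru - 2\<close>.\<close>
  have rnk': "rnk' e = ru - 2" "\<And>a. a \<noteq> e \<Longrightarrow> rnk' a = rnk a"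
    using new(3) eU by (auto split: if_splits)
  have rnk'_ch: "map rnk' (ch a) = map rnk (ch a)" if "a \<in> N" for a
    using child_node[OF inv that] eN rnk'(2) by (intro map_cong refl) metis
  have big: "\<exists>c1 k. ch u = c1 # c2 # cs0 \<and> cs1 = [c1, c2] \<and> ru = Suc (Suc k) \<and> rnk c1 = Suc k \<and> rnk c2 = k \<and>
      c1 = chd u \<and> chain nx (nx c2) cs0 \<and> c1 \<noteq> 0 \<and> c2 \<noteq> 0" if ru: "\<not> ru < 2"
  proof -
    obtain k where k: "ru = Suc (Suc k)" using ru by (metis One_nat_def Suc_1 add_2_eq_Suc le_add_diff_inverse not_less)
    then obtain c1 d cs where c: "ch u = c1 # d # cs" using len by (metis length_Suc_conv)
    have "chain nx (chd u) (ch u)" using i(8)[OF u(1)] .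
    then have "c1 = chd u" "d = c2" "chain nx (nx c2) cs" "c1 \<noteq> 0" "d \<noteq> 0"
      unfolding c by (auto simp: new(2) u_def)
    moreover have "rnk c1 = Suc k" "rnk d = k" using ranks unfolding c k by auto
    moreover have "cs0 = cs" "cs1 = [c1, d]" using ru c by (auto simp: cs0_def cs1_def)
    ultimately show ?thesis using c k by auto
  qed
  have dist: "distinct (ch u)" by (rule distinct_children[OF inv u(1)])
  have c2_other: "c2 \<notin> set (ch a)" if "\<not> ru < 2" "a \<in> N" "a \<noteq> u" for a
    using children_disjoint[OF inv u(1) that(2)] that(3) big[OF that(1)] by auto
  \<comment> \<open>The only successor pointer that changes is that of \<open>c2\<close>, which
    belongs to the sibling list of \<open>u\<close> and to no other.\<close>
  have "chain nx' (chd' a) (ch a)" if "a \<in> N" "a \<noteq> u" for a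
  proof -
    have "a \<noteq> e" using that eN by auto
    then show ?thesis
      using i(8)[OF that(1)] c2_other[OF _ that] new(3) by (cases "ru < 2") (auto simp: chain_upd)
  qed
  moreover have "chain nx' (chd' u) cs1"
    using i(8)[OF u(1)] big new(3) u(1) eN dist by (cases "ru < 2") (auto simp: cs1_def)
  moreover have "chain nx' (chd' e) cs0"
  proof (cases "ru < 2")
    case True
    then show ?thesis using new(3) eU by (simp add: cs0_def)
  next
    case False
    then have "c2 \<notin> set cs0" using big[OF False] dist by auto
    then show ?thesis using new(3) big[OF False] False by (auto simp: chain_upd)
  qed
  ultimately have chains: "\<forall>a\<in>insert e N. chain nx' (chd' a) (ch' a)"
    using ch'_simps eN by (metis insertE)
  have sub: "set (ch' a) \<subseteq> set (ch a)" if "a \<in> N" for a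
  proof -
    have "a \<noteq> e" using that eN by metis
    then show ?thesis
      using ch'_simps split(1) by (cases "a = u") auto
  qed
  have S: "(\<Sum>a\<in>insert e N. mset (ch' a)) = (\<Sum>a\<in>N. mset (ch a))"
  proof -
    have "(\<Sum>a\<in>N. mset (ch' a)) = (\<Sum>a\<in>N. mset ((ch(u := cs1)) a))"
      by (rule sum.cong) (use eN in \<open>auto simp: ch'_def\<close>)
    moreover have "(\<Sum>a\<in>N. mset ((ch(u := cs1)) a)) + mset (ch u) = (\<Sum>a\<in>N. mset (ch a)) + mset cs1"
      by (rule sum_children_upd[OF i(5) u(1)])
    ultimately have "((\<Sum>a\<in>N. mset (ch' a)) + mset cs0) + mset cs1 = (\<Sum>a\<in>N. mset (ch a)) + mset cs1"
      using split(1) by (simp add: ac_simps)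
    then show ?thesis
      using i(5) eN ch'_simps(1) by (simp add: ac_simps)
  qed
  have m: "mset (stk @ [e]) + table_nodes tab + (\<Sum>a\<in>insert e N. mset (ch' a)) = mset_set (insert e N)"
    unfolding S using i(5,7) eN by simp
  have inv': "heap_inv (insert e N) (insert e U) ch' (stk @ [e]) mx (cur(v := e)) (item(e := v)) rnk' chd' nx' tab"
    unfolding heap_inv_def
  proof (intro conjI m chains)
    have "lt e c" if "c \<in> set cs0" for c
      using i(9)[OF u(1), of c] e(2) that split(1) lt_trans by (auto simp: u_def)
    then show "\<forall>a\<in>insert e N. \<forall>c\<in>set (ch' a). lt a c"
      using i(9) sub ch'_simps(1) by (metis insertE subsetD)
    have "map rnk' cs0 = rev [0..<ru - 2]"
    proof (cases "ru < 2")
      case False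
      have "map rnk' (ch u) = rev [0..<ru]" using rnk'_ch[OF u(1)] ranks by simp
      then show ?thesis using big[OF False] by auto
    qed (auto simp: cs0_def)
    then show "\<forall>a\<in>insert e N. (cur(v := e)) ((item(e := v)) a) = a \<longrightarrow> map rnk' (ch' a) = rev [0..<rnk' a]"
      using full i(10) rnk'_ch rnk' ch'_simps eN by (metis insertE)
    \<comment> \<open>The hollow node keeps its old rank, and \<open>2 ^ (ru div 2)\<close> is
      covered by the children of ranks ru - 1 and ru - 2 that it retains.\<close>
    have "2 ^ (rnk' u div 2) \<le> Suc (\<Sum>c\<leftarrow>ch' u. 2 ^ (rnk' c div 2))"
    proof (cases "ru < 2")
      case True
      have "rnk' u = rnk u" using rnk'(2) u(1) eN by metis
      then show ?thesis
        using True node_rank_le[OF inv u(1)] rnk'_ch[OF u(1)] new(3) by (simp add: ch'_simps cs1_def)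
    next
      case False
      from big[OF False] obtain c1 k where k: "cs1 = [c1, c2]" "ru = Suc (Suc k)" "rnk c1 = Suc k" "rnk c2 = k"
        "ch u = c1 # c2 # cs0" by auto
      have "rnk' u = ru" "rnk' c1 = Suc k" "rnk' c2 = k"
      proof -
        have "u \<noteq> e" "c1 \<noteq> e" "c2 \<noteq> e"
          using u(1) child_node[OF inv u(1)] eN k(5) by (metis list.set_intros)+
        then show "rnk' u = ru" "rnk' c1 = Suc k" "rnk' c2 = k"
          using rnk'(2) k new(1) by (simp_all add: u_def)
      qed
      moreover have "(2::nat) ^ (k div 2) \<le> 2 ^ (Suc k div 2)"
        by (rule power_increasing) auto
      ultimately show ?thesis
        by (simp add: ch'_simps k le_SucI)
    qed
    moreover have "2 ^ (rnk' a div 2) \<le> Suc (\<Sum>c\<leftarrow>ch' a. 2 ^ (rnk' c div 2))"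
      if "a \<in> N" "a \<noteq> u" "cur (item a) \<noteq> a" for a
    proof -
      have "a \<noteq> e" using that(1) eN by auto
      moreover have "(\<Sum>c\<leftarrow>ch a. 2 ^ (rnk' c div 2)) = (\<Sum>c\<leftarrow>ch a. (2::nat) ^ (rnk c div 2))"
      proof (intro arg_cong[where f = sum_list] map_cong refl)
        fix x assume "x \<in> set (ch a)"
        then have "x \<noteq> e" using child_node[OF inv that(1)] eN by metis
        then show "2 ^ (rnk' x div 2) = (2::nat) ^ (rnk x div 2)" using rnk'(2) by simp
      qed
      ultimately show ?thesis
        using i(11)[OF that(1,3)] ch'_simps(3)[OF _ that(2)] rnk'(2) by simp
    qed
    ultimately show "\<forall>a\<in>insert e N. (cur(v := e)) ((item(e := v)) a) \<noteq> a \<longrightarrow>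
        2 ^ (rnk' a div 2) \<le> Suc (\<Sum>c\<leftarrow>ch' a. 2 ^ (rnk' c div 2))"
      using full by (metis fun_upd_same insertE)
    show "\<forall>a. a \<notin> insert e U \<longrightarrow> rnk' a = 0 \<and> chd' a = 0"
      using i(12,13) new(3) by (auto split: if_splits)
    show "\<forall>w. (cur(v := e)) w \<noteq> 0 \<longrightarrow> (cur(v := e)) w \<in> insert e N \<and> (item(e := v)) ((cur(v := e)) w) = w"
      using i(18,19) eN by auto
  qed (use i e tab in auto)
  have h: "hollow_children (insert e N) ch' (cur(v := e)) (item(e := v)) \<le> hollow_children N ch cur item + 2"
  proof -
    let ?f = "\<lambda>a. if (cur(v := e)) ((item(e := v)) a) = a then 0 else length (ch' a)"
    have "?f a = (if cur (item a) = a then 0 else length (ch a))" if a: "a \<in> N - {u}" for a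
    proof -
      have "a \<noteq> e" using a eN by auto
      then show ?thesis using full[of a] a ch'_simps(3)[of a] by simp
    qed
    then have "(\<Sum>a\<in>N - {u}. ?f a) = (\<Sum>a\<in>N - {u}. if cur (item a) = a then 0 else length (ch a))"
      by (rule sum.cong[OF refl])
    moreover have "?f e = 0" by simp
    moreover have "?f u = length cs1" using full[OF u(1)] ch'_simps(2) by simp
    moreover have "(\<Sum>a\<in>insert e N. ?f a) = ?f e + (?f u + (\<Sum>a\<in>N - {u}. ?f a))"
      unfolding sum.insert[OF i(5) eN] sum.remove[OF i(5) u(1), of ?f] ..
    ultimately have "hollow_children (insert e N) ch' (cur(v := e)) (item(e := v)) =
        length cs1 + (\<Sum>a\<in>N - {u}. if cur (item a) = a then 0 else length (ch a))"
      unfolding hollow_children_def by linarith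
    also have "(\<Sum>a\<in>N - {u}. if cur (item a) = a then 0 else length (ch a)) \<le> hollow_children N ch cur item"
      unfolding hollow_children_def using i(5) by (intro sum_mono2) auto
    finally show ?thesis using split(2) by simp
  qed
  show ?thesis
    by (intro exI[of _ ch'] conjI inv') (use h in \<open>simp add: potential_def\<close>)
qed

text \<open>Occupied slots lie below \<open>mx\<close>, so lowering it slot by slot empties the
  table. A table entry (1 unit) turns into a stack entry (2 units).\<close>

lemma inv_dump:
  assumes inv: "heap_inv N U ch stk (Suc k) cur item rnk chd nx tab"
  shows "tab k = 0 \<Longrightarrow> heap_inv N U ch stk k cur item rnk chd nx tab"
    "tab k \<noteq> 0 \<Longrightarrow> heap_inv N U ch (stk @ [tab k]) k cur item rnk chd nx (tab(k := 0))"
    "tab k \<noteq> 0 \<Longrightarrow> potential N ch (stk @ [tab k]) cur item (tab(k := 0)) = Suc (potential N ch stk cur item tab)"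
proof -
  note i = inv_simps[OF inv]
  have less: "r < k" if "tab r \<noteq> 0" "r \<noteq> k" for r
    using i(14)[OF that(1)] that(2) by simp
  show "heap_inv N U ch stk k cur item rnk chd nx tab" if "tab k = 0"
    unfolding heap_inv_def using i less that by (auto, metis)
  have t: "table_nodes tab = add_mset (tab k) (table_nodes (tab(k := 0)))" if "tab k \<noteq> 0"
    using table_nodes_upd[of k tab 0] that i(17) by simp
  show "heap_inv N U ch (stk @ [tab k]) k cur item rnk chd nx (tab(k := 0))" if "tab k \<noteq> 0"
    unfolding heap_inv_def using i less t[OF that] by auto
  show "tab k \<noteq> 0 \<Longrightarrow> potential N ch (stk @ [tab k]) cur item (tab(k := 0)) = Suc (potential N ch stk cur item tab)"
    unfolding potential_def using t by simp
qed

text \<open>Extraction only makes the root hollow; the next consolidation takes it apart. Its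
  children, at most \<open>M\<close> by the rank bound, become hollow children at 3 units
  each.\<close>

lemma inv_extract:
  assumes inv: "heap_inv N U ch stk mx cur item rnk chd nx tab"
    and tab: "\<And>r. tab r = 0"
    and a: "cur v \<noteq> 0" "cur v \<in> set stk"
  shows "heap_inv N U ch stk mx (cur(v := 0)) item rnk chd nx tab"
    "potential N ch stk (cur(v := 0)) item tab \<le> potential N ch stk cur item tab + 3 * M"
proof -
  note i = inv_simps[OF inv]
  have u: "cur v \<in> N" "item (cur v) = v" using i(18,19) a(1) by auto
  have full: "(cur(v := 0)) (item a) = a \<longleftrightarrow> cur (item a) = a \<and> a \<noteq> cur v" if "a \<in> N" for a
  proof -
    have "a \<noteq> 0" using that i(6) by metis
    then show ?thesis using u(2) by auto
  qed
  show "heap_inv N U ch stk mx (cur(v := 0)) item rnk chd nx tab"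
    unfolding heap_inv_def
  proof (intro conjI)
    show "\<forall>a\<in>N. (cur(v := 0)) (item a) = a \<longrightarrow> map rnk (ch a) = rev [0..<rnk a]"
      using full i(10) by blast
    show "\<forall>a\<in>N. (cur(v := 0)) (item a) \<noteq> a \<longrightarrow> 2 ^ (rnk a div 2) \<le> Suc (\<Sum>c\<leftarrow>ch a. 2 ^ (rnk c div 2))"
      using node_rank_le[OF inv] by blast
    show "\<forall>w. (cur(v := 0)) w \<noteq> 0 \<longrightarrow> (cur(v := 0)) w \<in> N \<and> item ((cur(v := 0)) w) = w"
      using i(18,19) by auto
  qed (use i tab in auto)
  have "length (ch (cur v)) = rnk (cur v)"
    using i(10)[OF u(1)] u(2) by (metis length_map length_rev length_upt minus_nat.diff_0)
  also have "\<dots> \<le> M"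
    using root_rank_le[OF inv, of "cur v"] a(2) by simp
  finally have l: "length (ch (cur v)) \<le> M" .
  have "hollow_children N ch (cur(v := 0)) item =
      length (ch (cur v)) + (\<Sum>a\<in>N - {cur v}. if cur (item a) = a then 0 else length (ch a))"
    unfolding hollow_children_def using i(5) u(1)
    by (subst sum.remove[of N "cur v"]) (auto simp: full simp del: fun_upd_apply intro!: sum.cong)
  also have "(\<Sum>a\<in>N - {cur v}. if cur (item a) = a then 0 else length (ch a)) \<le> hollow_children N ch cur item"
    unfolding hollow_children_def using i(5) by (intro sum_mono2) auto
  finally show "potential N ch stk (cur(v := 0)) item tab \<le> potential N ch stk cur item tab + 3 * M"
    using l by (simp add: potential_def)
qed

lemma inv_init:
  "heap_inv {} {} ch [] 0 (\<lambda>_. 0) item (\<lambda>_. 0) (\<lambda>_. 0) nx (\<lambda>_. 0)"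
  by (simp add: heap_inv_def table_nodes_def)

lemma potential_init: "potential {} ch [] cur item (\<lambda>_. 0) = 0"
  by (simp add: potential_def table_nodes_def hollow_children_def)

end

section \<open>A Hoare logic with time credits\<close>

text \<open>Here \<open>t\<close> is a number of steps that may be spent, and \<open>Q\<close> receives what is left over; credits
  may be wasted.\<close>

definition wp :: "(nat \<Rightarrow> real) \<Rightarrow> com \<Rightarrow> (ram_state \<Rightarrow> nat \<Rightarrow> bool) \<Rightarrow> ram_state \<Rightarrow> nat \<Rightarrow> bool" where
  "wp \<omega> c Q s t \<longleftrightarrow> (\<exists>k s' t'. runs \<omega> c s k s' \<and> k + t' \<le> t \<and> Q s' t')"

text \<open>Loop-free code is evaluated by rewriting with \<open>sem\<close> and charged the
  syntactic bound \<open>cost\<close>, which takes the dearer branch of a conditional. Invariants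
  are thus confined to loops.\<close>

fun loop_free :: "com \<Rightarrow> bool" where
  "loop_free (Seq c c') \<longleftrightarrow> loop_free c \<and> loop_free c'"
| "loop_free (If b c c') \<longleftrightarrow> loop_free c \<and> loop_free c'"
| "loop_free (While b c) \<longleftrightarrow> False"
| "loop_free _ \<longleftrightarrow> True"

fun cost :: "com \<Rightarrow> nat" where
  "cost (Seq c c') = cost c + cost c'"
| "cost (If b c c') = Suc (max (cost c) (cost c'))"
| "cost _ = 1"

fun sem :: "(nat \<Rightarrow> real) \<Rightarrow> com \<Rightarrow> ram_state \<Rightarrow> ram_state" where
  "sem \<omega> (NSet a i x) s = nwrite a (nval i s) (nval x s) s"
| "sem \<omega> (RSet a i x) s = rwrite a (nval i s) (rval x s) s"
| "sem \<omega> (Sample a i) s = (rwrite a (nval i s) (\<omega> (drawn s)) s)\<lparr>drawn := Suc (drawn s)\<rparr>"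
| "sem \<omega> (Seq c c') s = sem \<omega> c' (sem \<omega> c s)"
| "sem \<omega> (If b c c') s = (if bval b s then sem \<omega> c s else sem \<omega> c' s)"
| "sem \<omega> _ s = s"

lemma runs_loop_free: "loop_free c \<Longrightarrow> \<exists>k \<le> cost c. runs \<omega> c s k (sem \<omega> c s)"
proof (induction c arbitrary: s)
  case (Seq c c')
  then have "loop_free c" "loop_free c'"
    by simp_all
  from Seq.IH(1)[OF this(1), of s] Seq.IH(2)[OF this(2), of "sem \<omega> c s"] obtain k k'
    where "k \<le> cost c" "runs \<omega> c s k (sem \<omega> c s)"
      "k' \<le> cost c'" "runs \<omega> c' (sem \<omega> c s) k' (sem \<omega> c' (sem \<omega> c s))"
    by (elim exE conjE)
  then show ?case
    by (intro exI[of _ "k + k'"]) (auto intro: runs.Seq)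
next
  case (If b c c')
  then have "loop_free c" "loop_free c'"
    by simp_all
  from If.IH(1)[OF this(1), of s] If.IH(2)[OF this(2), of s] obtain k k'
    where k: "k \<le> cost c" "runs \<omega> c s k (sem \<omega> c s)" "k' \<le> cost c'" "runs \<omega> c' s k' (sem \<omega> c' s)"
    by (elim exE conjE)
  show ?case
  proof (cases "bval b s")
    case True
    have "runs \<omega> (If b c c') s (Suc k) (sem \<omega> c s)"
      by (rule runs.IfTrue[OF True k(2)])
    then show ?thesis
      using True k(1) by (intro exI[of _ "Suc k"]) simp
  next
    case False
    have "runs \<omega> (If b c c') s (Suc k') (sem \<omega> c' s)"
      by (rule runs.IfFalse[OF False k(4)])
    then show ?thesis
      using False k(3) by (intro exI[of _ "Suc k'"]) simp
  qed
qed (auto intro!: exI[of _ 1] intro: runs.intros)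

lemma wpI: "runs \<omega> c s k s' \<Longrightarrow> k + t' \<le> t \<Longrightarrow> Q s' t' \<Longrightarrow> wp \<omega> c Q s t"
  unfolding wp_def by (intro exI conjI)

lemma wpE:
  assumes "wp \<omega> c Q s t"
  obtains k s' t' where "runs \<omega> c s k s'" "k + t' \<le> t" "Q s' t'"
  using assms unfolding wp_def by (elim exE conjE)

lemma wp_loop_free:
  assumes "loop_free c" "cost c \<le> t" "Q (sem \<omega> c s) (t - cost c)"
  shows "wp \<omega> c Q s t"
proof -
  from runs_loop_free[OF assms(1), of \<omega> s] obtain k where k: "k \<le> cost c" "runs \<omega> c s k (sem \<omega> c s)"
    by (elim exE conjE)
  show ?thesis
    by (rule wpI[where Q = Q, OF k(2) _ assms(3)]) (use assms(2) k(1) in simp)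
qed

lemma wp_Seq:
  assumes "wp \<omega> c (wp \<omega> c' Q) s t"
  shows "wp \<omega> (Seq c c') Q s t"
proof -
  from assms obtain k s' t' where 1: "runs \<omega> c s k s'" "k + t' \<le> t" "wp \<omega> c' Q s' t'"
    by (rule wpE)
  from 1(3) obtain k' s'' t'' where 2: "runs \<omega> c' s' k' s''" "k' + t'' \<le> t'" "Q s'' t''"
    by (rule wpE)
  show ?thesis
    by (rule wpI[where Q = Q, OF runs.Seq[OF 1(1) 2(1)] _ 2(3)]) (use 1(2) 2(2) in simp)
qed

text \<open>The credits themselves are the termination measure: every test of the guard takes one,
  and the invariant guarantees that one is available.\<close>

lemma wp_While:
  assumes "I s t"
    and "\<And>s t. I s t \<Longrightarrow> t > 0"
    and "\<And>s t. I s t \<Longrightarrow> bval b s \<Longrightarrow> wp \<omega> c I s (t - 1)"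
    and "\<And>s t. I s t \<Longrightarrow> \<not> bval b s \<Longrightarrow> Q s (t - 1)"
  shows "wp \<omega> (While b c) Q s t"
  using assms(1)
proof (induction t arbitrary: s rule: less_induct)
  case (less t)
  note pos = assms(2)[OF less.prems]
  show ?case
  proof (cases "bval b s")
    case False
    show ?thesis
      by (rule wpI[where Q = Q, OF runs.WhileFalse[OF False] _ assms(4)[OF less.prems False]]) (use pos in simp)
  next
    case True
    from assms(3)[OF less.prems True] obtain k s' t' where 1: "runs \<omega> c s k s'" "k + t' \<le> t - 1" "I s' t'"
      by (rule wpE)
    have "t' < t" using 1(2) pos by linarith
    from less.IH[OF this 1(3)] obtain k' s'' t''
      where 2: "runs \<omega> (While b c) s' k' s''" "k' + t'' \<le> t'" "Q s'' t''"
      by (rule wpE)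
    show ?thesis
      by (rule wpI[where Q = Q, OF runs.WhileTrue[OF True 1(1) 2(1)] _ 2(3)]) (use 1(2) 2(2) pos in simp)
  qed
qed

text \<open>The index breaks ties, so that the spanning tree is determined on every tape.\<close>

definition clock_less :: "(nat \<Rightarrow> real) \<Rightarrow> nat \<Rightarrow> nat \<Rightarrow> bool" where
  "clock_less x i j \<longleftrightarrow> x i < x j \<or> \<not> x j < x i \<and> i < j"

lemma clock_less_order:
  "\<not> clock_less x i i" "clock_less x i j \<Longrightarrow> clock_less x j k \<Longrightarrow> clock_less x i k"
  "i \<noteq> j \<Longrightarrow> clock_less x i j \<or> clock_less x j i"
  by (auto simp: clock_less_def)

section \<open>Greedy spanning trees and exponential clocks\<close>

locale ordered_edges =
  fixes G :: wgraph and E :: "nat \<Rightarrow> nat set" and I :: "nat set" and less :: "nat \<Rightarrow> nat \<Rightarrow> bool"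
  assumes G: "input_graph G" and inj_E: "inj_on E I" and edges: "E ` I = edges G" and fin: "finite I"
    and less_irrefl: "\<And>i. \<not> less i i"
    and less_trans: "\<And>i j k. less i j \<Longrightarrow> less j k \<Longrightarrow> less i k"
    and less_total: "\<And>i j. i \<noteq> j \<Longrightarrow> less i j \<or> less j i"
begin

text \<open>An edge is kept if the smaller edges do not already connect its ends. The description
  mentions neither a forest under construction nor an order of processing, so it suits both
  algorithms.\<close>

definition msf :: "nat set set" where
  "msf = E ` {i \<in> I. \<forall>u v. E i = {u, v} \<longrightarrow> (u, v) \<notin> reach (E ` {j \<in> I. less j i})}"

lemma msf_edges: "msf \<subseteq> edges G"
  using edges by (auto simp: msf_def)

lemma ex_least:
  assumes "finite J" "J \<noteq> {}"
  shows "\<exists>i\<in>J. \<forall>j\<in>J - {i}. less i j"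
  using assms
proof (induction J rule: finite_ne_induct)
  case (insert a J)
  then obtain i where i: "i \<in> J" "\<forall>j\<in>J - {i}. less i j" by blast
  show ?case
  proof (cases "less i a")
    case True
    then show ?thesis using i by (intro bexI[of _ i]) auto
  next
    case False
    then have "less a i" using less_total[of a i] insert.hyps i(1) by auto
    then have "less a j" if "j \<in> J" for j using i that less_trans[of a i j] by (cases "j = i") auto
    then show ?thesis by (intro bexI[of _ a]) auto
  qed
qed auto

lemma ex_greatest:
  assumes "finite J" "J \<noteq> {}"
  shows "\<exists>i\<in>J. \<forall>j\<in>J - {i}. less j i"
  using assms
proof (induction J rule: finite_ne_induct)
  case (insert a J)
  then obtain i where i: "i \<in> J" "\<forall>j\<in>J - {i}. less j i" by blast
  show ?case
  proof (cases "less a i")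
    case True
    then show ?thesis using i by (intro bexI[of _ i]) auto
  next
    case False
    then have "less i a" using less_total[of a i] insert.hyps i(1) by auto
    then have "less j a" if "j \<in> J" for j using i that less_trans[of j i a] by (cases "j = i") auto
    then show ?thesis by (intro bexI[of _ a]) auto
  qed
qed auto

text \<open>Edges are added in increasing order; when an edge arrives, the present ones are all
  smaller and so do not join its ends.\<close>

lemma forest_msf: "forest msf"
proof -
  define L where "L = {i \<in> I. \<forall>u v. E i = {u, v} \<longrightarrow> (u, v) \<notin> reach (E ` {j \<in> I. less j i})}"
  have "forest (E ` J)" if "J \<subseteq> L" for J
  proof -
    have "finite J" using that fin by (auto simp: L_def intro: finite_subset)
    then show ?thesis
      using that
    proof (induction "card J" arbitrary: J)
      case 0
      then show ?case by (simp add: forest_empty)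
    next
      case (Suc n)
      then have "J \<noteq> {}" by auto
      then obtain i where i: "i \<in> J" "\<forall>j\<in>J - {i}. less j i"
        using ex_greatest[OF Suc.prems(1)] by blast
      have IH: "forest (E ` (J - {i}))"
        using Suc.hyps(2) Suc.prems i(1) by (intro Suc.hyps(1)) auto
      have iL: "i \<in> L" "i \<in> I" using i(1) Suc.prems(2) by (auto simp: L_def)
      then obtain u v where uv: "E i = {u, v}" "u \<noteq> v"
        using edgeE[OF G, of "E i"] edges by (metis imageI)
      have "(u, v) \<notin> reach (E ` {j \<in> I. less j i})"
        using iL(1) uv(1) by (simp add: L_def)
      moreover have "E ` (J - {i}) \<subseteq> E ` {j \<in> I. less j i}"
        using i Suc.prems(2) by (auto simp: L_def)
      ultimately have nr: "(u, v) \<notin> reach (E ` (J - {i}))"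
        using reach_mono by blast
      have "{u, v} \<notin> E ` (J - {i})"
      proof
        assume "{u, v} \<in> E ` (J - {i})"
        then obtain j where j: "j \<in> J" "j \<noteq> i" "E j = E i" using uv(1) by auto
        then have "j \<in> I" using Suc.prems(2) by (auto simp: L_def)
        then show False using inj_onD[OF inj_E j(3) _ iL(2)] j(2) by blast
      qed
      then have "forest (insert {u, v} (E ` (J - {i})))"
        using forest_insert[OF uv(2)] IH nr by blast
      moreover have "insert {u, v} (E ` (J - {i})) = E ` J"
        using i(1) uv(1) by auto
      ultimately show ?case by simp
    qed
  qed
  then show ?thesis
    unfolding msf_def L_def by blast
qed

text \<open>A connected spanning part of a forest is the whole forest. Both algorithms thus have to
  show merely that they choose edges of \<open>msf\<close> and end with a connected graph.\<close>

lemma msf_eqI: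
  assumes "A \<subseteq> msf" "connects A (verts G)"
  shows "A = msf"
proof (rule ccontr)
  assume "A \<noteq> msf"
  then obtain e where e: "e \<in> msf" "e \<notin> A" using assms(1) by blast
  then obtain u v where uv: "e = {u, v}" "u \<in> verts G" "v \<in> verts G" "u \<noteq> v"
    using edgeE[OF G] msf_edges by blast
  have "(u, v) \<in> reach A"
    using assms(2) uv by (simp add: connects_def reach_def)
  moreover have "reach A \<subseteq> reach (msf - {{u, v}})"
    by (rule reach_mono) (use assms(1) e uv in auto)
  ultimately show False
    using forest_msf e(1) uv unfolding forest_def by blast
qed

text \<open>Edges smaller than the least cut edge do not cross the cut, so they never lead out of
  \<open>S\<close>.\<close>

lemma cut_edge_in_msf:
  assumes i: "i \<in> I" "E i = {y, v}" "y \<in> S" "v \<notin> S"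
    and least: "\<And>j a b. j \<in> I \<Longrightarrow> E j = {a, b} \<Longrightarrow> a \<in> S \<Longrightarrow> b \<notin> S \<Longrightarrow> j = i \<or> less i j"
  shows "E i \<in> msf"
proof -
  have "b \<in> S" if "(a, b) \<in> reach (E ` {j \<in> I. less j i})" "a \<in> S" for a b
    using that
  proof (induction rule: reach_induct)
    case (step b c)
    then obtain j where j: "j \<in> I" "less j i" "E j = {b, c}" by auto
    show ?case
    proof (rule ccontr)
      assume "c \<notin> S"
      then have "j = i \<or> less i j" using least[OF j(1,3)] step by auto
      then show False using j(2) less_irrefl less_trans by blast
    qed
  qed
  then have "(y, v) \<notin> reach (E ` {j \<in> I. less j i})" using i by blast
  then have "(a, b) \<notin> reach (E ` {j \<in> I. less j i})" if "E i = {a, b}" for a b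
    using that i(2) reach_sym by (auto simp: doubleton_eq_iff)
  then show ?thesis
    using i(1) unfolding msf_def by blast
qed

end

section \<open>Kruskal's loop with the least admissible edge instead of a sample\<close>

definition residual :: "nat set set \<Rightarrow> nat set set \<Rightarrow> nat set \<Rightarrow> nat set set" where
  "residual T F e = F - (T \<union> {e}) - {e' \<in> F. contains_cycle ({e'} \<union> (T \<union> {e}))}"

fun greedy :: "(nat \<Rightarrow> nat set) \<Rightarrow> (nat \<Rightarrow> nat \<Rightarrow> bool) \<Rightarrow> nat \<Rightarrow> nat set set \<Rightarrow> nat set \<Rightarrow> nat set set" where
  "greedy E lt 0 T J = T"
| "greedy E lt (Suc k) T J = (let i = (THE i. i \<in> J \<and> (\<forall>j\<in>J - {i}. lt i j)) in
     greedy E lt k (T \<union> {E i}) {j \<in> J. E j \<in> residual T (E ` J) (E i)})"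

text \<open>Only comparisons within \<open>J\<close> matter. This later makes the remaining run
  insensitive to the winner's clock and to a common shift of the others.\<close>

lemma greedy_cong:
  "(\<And>i j. i \<in> J \<Longrightarrow> j \<in> J \<Longrightarrow> lt i j = lt' i j) \<Longrightarrow> greedy E lt k T J = greedy E lt' k T J"
proof (induction k arbitrary: T J)
  case (Suc k)
  have "(THE i. i \<in> J \<and> (\<forall>j\<in>J - {i}. lt i j)) = (THE i. i \<in> J \<and> (\<forall>j\<in>J - {i}. lt' i j))"
    using Suc.prems by (intro arg_cong[where f = The]) auto
  moreover have "greedy E lt k T' {j \<in> J. P j} = greedy E lt' k T' {j \<in> J. P j}" for T' P
    using Suc.prems by (intro Suc.IH) auto
  ultimately show ?case
    by (simp add: Let_def)
qed simp

context ordered_edges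
begin

lemma the_least: "i \<in> J \<Longrightarrow> \<forall>j\<in>J - {i}. less i j \<Longrightarrow> (THE i. i \<in> J \<and> (\<forall>j\<in>J - {i}. less i j)) = i"
  using less_irrefl less_trans by (intro the_equality) blast+

lemma greedy_Suc:
  assumes "i \<in> J" "\<forall>j\<in>J - {i}. less i j"
  shows "greedy E less (Suc k) T J = greedy E less k (T \<union> {E i}) {j \<in> J. E j \<in> residual T (E ` J) (E i)}"
  unfolding greedy.simps the_least[OF assms] Let_def ..

lemma greedy_spanning:
  assumes "kruskal_state G k T (E ` J)" "J \<subseteq> I" "T \<subseteq> msf"
  shows "greedy E less k T J \<subseteq> msf \<and> greedy E less k T J \<in> spanning_trees G"
  using assms
proof (induction k arbitrary: T J)
  case 0
  then show ?case using kruskal_state_final[OF G] by auto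
next
  case (Suc k)
  have "finite J" "J \<noteq> {}"
    using Suc.prems fin finite_subset kruskal_state_nonempty[OF G] by blast+
  then obtain i where i: "i \<in> J" "\<forall>j\<in>J - {i}. less i j"
    using ex_least by blast
  have iI: "i \<in> I" using i(1) Suc.prems(2) by auto
  have F: "E ` J = {e \<in> edges G - T. forest (insert e T)}" and T: "forest T"
    using Suc.prems(1) by (auto simp: kruskal_state_def)
  have "E i \<in> msf"
  proof -
    have "(u, v) \<notin> reach (E ` {j \<in> I. less j i})" if uv: "E i = {u, v}" for u v
    proof
      assume r: "(u, v) \<in> reach (E ` {j \<in> I. less j i})"
      have "E i \<in> E ` J" using i(1) by simp
      then have "E i \<in> edges G" "E i \<notin> T" "forest (insert (E i) T)" unfolding F by auto
      then have "u \<noteq> v" using edgeE[OF G] uv by (metis doubleton_eq_iff)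
      then have "(u, v) \<notin> reach T"
        using forest_insert[of u v T] \<open>E i \<notin> T\<close> \<open>forest (insert (E i) T)\<close> uv by auto
      moreover have "(u, v) \<in> reach T"
        using r
      proof (rule reach_minimal)
        fix a b assume "{a, b} \<in> E ` {j \<in> I. less j i}"
        then obtain j where j: "j \<in> I" "less j i" "E j = {a, b}" by auto
        have "j \<noteq> i" using j(2) less_irrefl by auto
        \<comment> \<open>Being below the least index of \<open>J\<close>, \<open>j\<close> has been
          dealt with: its edge is in \<open>T\<close> or would close a cycle, and in both cases
          \<open>T\<close> joins its ends.\<close>
        then have "j \<notin> J" using i(2) j(2) less_irrefl less_trans by blast
        then have "E j \<notin> E ` J"
          using j(1) Suc.prems(2) inj_E by (auto simp: inj_on_def)
        moreover have e: "E j \<in> edges G" using j(1) edges by auto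
        ultimately have c: "E j \<in> T \<or> \<not> forest (insert (E j) T)" unfolding F by auto
        have "a \<noteq> b" using edgeE[OF G e] j(3) by (metis doubleton_eq_iff)
        then show "(a, b) \<in> reach T"
          using c reach_edge[of a b T] forest_insert[of a b T] T j(3) by auto
      qed
      ultimately show False by simp
    qed
    then show ?thesis using iI unfolding msf_def by blast
  qed
  moreover have "E ` {j \<in> J. E j \<in> residual T (E ` J) (E i)} = residual T (E ` J) (E i)"
    by (auto simp: residual_def)
  moreover have "kruskal_state G k (T \<union> {E i}) (residual T (E ` J) (E i))"
    unfolding residual_def by (rule kruskal_state_step[OF G Suc.prems(1)]) (use i(1) in simp)
  ultimately show ?case
    unfolding greedy_Suc[OF i] using Suc.prems(2,3) by (intro Suc.IH) auto
qed

lemma greedy_eq_msf: "greedy E less (nverts G - 1) {} I = msf"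
proof -
  have "greedy E less (nverts G - 1) {} I \<subseteq> msf \<and> greedy E less (nverts G - 1) {} I \<in> spanning_trees G"
    by (rule greedy_spanning) (use kruskal_state_init[OF G] edges in auto)
  then show ?thesis
    by (intro msf_eqI) (auto simp: spanning_trees_def)
qed

end

section \<open>Memorylessness and the race of exponential clocks\<close>

abbreviation exp_clock :: "real \<Rightarrow> real measure" where
  "exp_clock l \<equiv> density lborel (\<lambda>x. ennreal (exponential_density l x))"

text \<open>\<open>A\<close> is the open or the closed half-line from \<open>t\<close>; both occur,
  depending on which index a tie favours.\<close>

lemma exp_clock_memoryless:
  assumes l: "l > 0" and t: "t \<ge> 0" and h [measurable]: "h \<in> borel_measurable borel"
    and A [measurable]: "A \<in> sets borel" and A': "{t<..} \<subseteq> A" "A \<subseteq> {t..}"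
  shows "(\<integral>\<^sup>+x. indicator A x * h x \<partial>exp_clock l) = ennreal (exp (- (l * t))) * (\<integral>\<^sup>+x. h (x + t) \<partial>exp_clock l)"
proof -
  have "(\<integral>\<^sup>+x. indicator A x * h x \<partial>exp_clock l) =
      (\<integral>\<^sup>+x. ennreal (exponential_density l x) * (indicator A x * h x) \<partial>lborel)"
    by (subst nn_integral_density) auto
  also have "\<dots> = (\<integral>\<^sup>+x. ennreal (exponential_density l (x + t)) * (indicator A (x + t) * h (x + t)) \<partial>lborel)"
    by (subst nn_integral_real_affine[where c = 1 and t = t]) (auto simp: add.commute)
  also have "\<dots> = (\<integral>\<^sup>+x. ennreal (exp (- (l * t))) * (ennreal (exponential_density l x) * h (x + t)) \<partial>lborel)"
  proof (rule nn_integral_cong_AE)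
    \<comment> \<open>At \<open>x = 0\<close> the point \<open>x + t\<close> is the end of the
      half-line, whose membership in \<open>A\<close> is left open.\<close>
    have "AE x in lborel. x \<noteq> (0::real)"
      by (rule AE_lborel_singleton)
    then show "AE x in lborel. ennreal (exponential_density l (x + t)) * (indicator A (x + t) * h (x + t)) =
        ennreal (exp (- (l * t))) * (ennreal (exponential_density l x) * h (x + t))"
    proof eventually_elim
      case (elim x)
      show ?case
      proof (cases "x > 0")
        case True
        then have "exponential_density l (x + t) = exp (- (l * t)) * exponential_density l x"
          using t by (simp add: exponential_density_def exp_add[symmetric] algebra_simps)
        moreover have "x + t \<in> A" using True A'(1) by auto
        ultimately show ?thesis
          using l by (simp add: ennreal_mult' exponential_density_nonneg mult.assoc)
      next
        case False
        then have "x + t \<notin> A" "exponential_density l x = 0"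
          using elim A'(2) by (auto simp: exponential_density_def)
        then show ?thesis by simp
      qed
    qed
  qed
  also have "\<dots> = ennreal (exp (- (l * t))) * (\<integral>\<^sup>+x. ennreal (exponential_density l x) * h (x + t) \<partial>lborel)"
    by (rule nn_integral_cmult) simp
  also have "(\<integral>\<^sup>+x. ennreal (exponential_density l x) * h (x + t) \<partial>lborel) = (\<integral>\<^sup>+x. h (x + t) \<partial>exp_clock l)"
    by (subst nn_integral_density) auto
  finally show ?thesis .
qed

locale clocks =
  fixes rate :: "nat \<Rightarrow> real" and I :: "nat set"
  assumes rate_pos: "\<And>i. rate i > 0" and finite_I: "finite I"
begin

abbreviation clocks :: "(nat \<Rightarrow> real) measure" where
  "clocks \<equiv> PiM I (\<lambda>i. exp_clock (rate i))"

sublocale product_prob_space "\<lambda>i. exp_clock (rate i)" I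
  by (rule product_prob_spaceI) (rule prob_space_exponential_density[OF rate_pos])

lemma integral_coordinate:
  assumes i: "i \<in> J" "finite J" and f: "f \<in> borel_measurable (PiM J (\<lambda>i. exp_clock (rate i)))"
  shows "(\<integral>\<^sup>+x. f x \<partial>PiM J (\<lambda>i. exp_clock (rate i))) =
    (\<integral>\<^sup>+x. (\<integral>\<^sup>+y. f (x(i := y)) \<partial>exp_clock (rate i)) \<partial>PiM (J - {i}) (\<lambda>i. exp_clock (rate i)))"
proof -
  have "insert i (J - {i}) = J" using i(1) by auto
  then show ?thesis
    using product_nn_integral_insert[of "J - {i}" i f] i(2) f by simp
qed

definition shift :: "nat set \<Rightarrow> real \<Rightarrow> (nat \<Rightarrow> real) \<Rightarrow> nat \<Rightarrow> real" where
  "shift J t x = (\<lambda>j. if j \<in> J then x j + t else x j)"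

lemma shift_measurable [measurable]:
  "J \<subseteq> K \<Longrightarrow> shift J t \<in> PiM K (\<lambda>i. exp_clock (rate i)) \<rightarrow>\<^sub>M PiM K (\<lambda>i. exp_clock (rate i))"
proof (rule measurable_PiM_single')
  assume JK: "J \<subseteq> K"
  show "(\<lambda>x. shift J t x i) \<in> PiM K (\<lambda>i. exp_clock (rate i)) \<rightarrow>\<^sub>M exp_clock (rate i)" if "i \<in> K" for i
    unfolding shift_def using that by (cases "i \<in> J") (simp_all, measurable)
  show "shift J t \<in> space (PiM K (\<lambda>i. exp_clock (rate i))) \<rightarrow> (\<Pi>\<^sub>E i\<in>K. space (exp_clock (rate i)))"
    using JK by (auto simp: space_PiM shift_def PiE_iff extensional_def)
qed

text \<open>Memorylessness applied to one coordinate after the other; the exponents add up to the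
  total rate.\<close>

lemma shift_all:
  assumes "finite K" "J \<subseteq> K" "t \<ge> 0"
    and A: "\<And>j. j \<in> J \<Longrightarrow> A j \<in> sets borel" "\<And>j. j \<in> J \<Longrightarrow> {t<..} \<subseteq> A j" "\<And>j. j \<in> J \<Longrightarrow> A j \<subseteq> {t..}"
    and h: "h \<in> borel_measurable (PiM K (\<lambda>i. exp_clock (rate i)))"
  shows "(\<integral>\<^sup>+x. (\<Prod>j\<in>J. indicator (A j) (x j)) * h x \<partial>PiM K (\<lambda>i. exp_clock (rate i))) =
    ennreal (exp (- ((\<Sum>j\<in>J. rate j) * t))) * (\<integral>\<^sup>+x. h (shift J t x) \<partial>PiM K (\<lambda>i. exp_clock (rate i)))"
proof -
  have "finite J" using assms(1,2) finite_subset by auto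
  then show ?thesis using assms(2) A h
  proof (induction J arbitrary: h)
    case empty
    have "shift {} t = (\<lambda>x. x)" by (auto simp: shift_def)
    then show ?case by simp
  next
    case (insert i J)
    let ?M = "\<lambda>i. exp_clock (rate i)"
    note [measurable] = insert.prems(5)
    have iK: "i \<in> K" "J \<subseteq> K" using insert.prems(1) by auto
    have [measurable]: "A j \<in> sets borel" if "j \<in> insert i J" for j using insert.prems(2) that by auto
    define h' where "h' x = h (shift J t x)" for x
    have h' [measurable]: "h' \<in> borel_measurable (PiM K ?M)"
      unfolding h'_def using iK(2) by measurable
    have comp [measurable]: "(\<lambda>x. x i) \<in> PiM K ?M \<rightarrow>\<^sub>M borel" 
      using measurable_component_singleton[OF iK(1), of ?M] by simp
    have ind [measurable]: "(\<lambda>x. indicator (A i) (x i) :: ennreal) \<in> borel_measurable (PiM K ?M)"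
      using comp by measurable
    have "(\<integral>\<^sup>+x. (\<Prod>j\<in>insert i J. indicator (A j) (x j)) * h x \<partial>PiM K ?M) =
        (\<integral>\<^sup>+x. (\<Prod>j\<in>J. indicator (A j) (x j)) * (indicator (A i) (x i) * h x) \<partial>PiM K ?M)"
      using insert.hyps by (intro nn_integral_cong) (simp add: ac_simps)
    also have "\<dots> = ennreal (exp (- ((\<Sum>j\<in>J. rate j) * t))) *
        (\<integral>\<^sup>+x. indicator (A i) (shift J t x i) * h (shift J t x) \<partial>PiM K ?M)"
      by (rule insert.IH) (use insert.prems iK in \<open>auto intro!: borel_measurable_times_ennreal\<close>)
    also have "(\<integral>\<^sup>+x. indicator (A i) (shift J t x i) * h (shift J t x) \<partial>PiM K ?M) =
        (\<integral>\<^sup>+x. indicator (A i) (x i) * h' x \<partial>PiM K ?M)"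
      using insert.hyps by (simp add: shift_def h'_def)
    \<comment> \<open>Coordinate \<open>i\<close> is split off by Fubini, so that the
      one-dimensional statement applies with the others held fixed.\<close>
    also have "\<dots> = (\<integral>\<^sup>+x. (\<integral>\<^sup>+y. indicator (A i) y * h' (x(i := y)) \<partial>?M i) \<partial>PiM (K - {i}) ?M)"
      by (subst integral_coordinate[OF iK(1) assms(1)]) simp_all
    also have "\<dots> = (\<integral>\<^sup>+x. ennreal (exp (- (rate i * t))) * (\<integral>\<^sup>+y. h' (x(i := y + t)) \<partial>?M i) \<partial>PiM (K - {i}) ?M)"
    proof (rule nn_integral_cong)
      fix x assume x: "x \<in> space (PiM (K - {i}) ?M)"
      have "(\<lambda>y. x(i := y)) \<in> ?M i \<rightarrow>\<^sub>M PiM (insert i (K - {i})) ?M"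
        using x by (intro measurable_component_update) auto
      then have "(\<lambda>y. x(i := y)) \<in> borel \<rightarrow>\<^sub>M PiM K ?M"
        using iK(1) by (simp add: insert_absorb cong: measurable_cong_sets)
      then have m: "(\<lambda>y. h' (x(i := y))) \<in> borel_measurable borel"
        by (rule measurable_compose[OF _ h'])
      show "(\<integral>\<^sup>+y. indicator (A i) y * h' (x(i := y)) \<partial>?M i) =
          ennreal (exp (- (rate i * t))) * (\<integral>\<^sup>+y. h' (x(i := y + t)) \<partial>?M i)"
        by (rule exp_clock_memoryless[OF rate_pos assms(3) m]) (use insert.prems in auto)
    qed
    also have "\<dots> = ennreal (exp (- (rate i * t))) * (\<integral>\<^sup>+x. (\<integral>\<^sup>+y. h' (shift {i} t (x(i := y))) \<partial>?M i) \<partial>PiM (K - {i}) ?M)"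
    proof -
      have e: "x(i := y + t) = shift {i} t (x(i := y))" for x y
        by (auto simp: shift_def)
      have "(\<lambda>x. \<integral>\<^sup>+y. h' (shift {i} t (x(i := y))) \<partial>?M i) \<in> borel_measurable (PiM (K - {i}) ?M)"
      proof (rule sigma_finite_measure.borel_measurable_nn_integral)
        show "sigma_finite_measure (?M i)" by unfold_locales
        have "(\<lambda>(x, y). x(i := y)) \<in> PiM (K - {i}) ?M \<Otimes>\<^sub>M ?M i \<rightarrow>\<^sub>M PiM (insert i (K - {i})) ?M"
          using measurable_add_dim[of i "K - {i}" ?M] by (simp add: case_prod_unfold)
        then have u: "(\<lambda>(x, y). x(i := y)) \<in> PiM (K - {i}) ?M \<Otimes>\<^sub>M ?M i \<rightarrow>\<^sub>M PiM K ?M"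
          using iK(1) by (simp add: insert_absorb)
        have s: "(\<lambda>x. h' (shift {i} t x)) \<in> borel_measurable (PiM K ?M)"
          by (rule measurable_compose[OF shift_measurable h']) (use iK(1) in simp)
        show "(\<lambda>(x, y). h' (shift {i} t (x(i := y)))) \<in> borel_measurable (PiM (K - {i}) ?M \<Otimes>\<^sub>M ?M i)"
          using measurable_compose[OF u s] by (simp add: case_prod_unfold)
      qed
      then show ?thesis unfolding e by (rule nn_integral_cmult)
    qed
    also have "(\<integral>\<^sup>+x. (\<integral>\<^sup>+y. h' (shift {i} t (x(i := y))) \<partial>?M i) \<partial>PiM (K - {i}) ?M) =
        (\<integral>\<^sup>+x. h' (shift {i} t x) \<partial>PiM K ?M)"
    proof (rule integral_coordinate[OF iK(1) assms(1), symmetric])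
      show "(\<lambda>x. h' (shift {i} t x)) \<in> borel_measurable (PiM K ?M)"
        by (rule measurable_compose[OF shift_measurable h']) (use iK(1) in simp)
    qed
    also have "(\<lambda>x. h' (shift {i} t x)) = (\<lambda>x. h (shift (insert i J) t x))"
      using insert.hyps by (auto simp: h'_def shift_def fun_eq_iff intro!: arg_cong[where f = h])
    also have "ennreal (exp (- ((\<Sum>j\<in>J. rate j) * t))) * (ennreal (exp (- (rate i * t))) *
        (\<integral>\<^sup>+x. h (shift (insert i J) t x) \<partial>PiM K ?M)) =
        ennreal (exp (- ((\<Sum>j\<in>J. rate j) * t)) * exp (- (rate i * t))) * (\<integral>\<^sup>+x. h (shift (insert i J) t x) \<partial>PiM K ?M)"
      unfolding ennreal_mult'[OF exp_ge_zero] mult.assoc ..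
    also have "exp (- ((\<Sum>j\<in>J. rate j) * t)) * exp (- (rate i * t)) = exp (- ((\<Sum>j\<in>insert i J. rate j) * t))"
      unfolding mult_exp_exp using insert.hyps by (simp add: algebra_simps)
    finally show ?case .
  qed
qed

text \<open>By memorylessness, which clock rings first is independent of the order of the others.\<close>

lemma race:
  assumes J: "J \<subseteq> I" "i \<in> J"
    and R: "{x \<in> space clocks. R x} \<in> sets clocks"
    and dep: "\<And>x y. R (x(i := y)) = R x"
    and inv: "\<And>x t. R (shift (J - {i}) t x) = R x"
  shows "emeasure clocks {x \<in> space clocks. (\<forall>j\<in>J - {i}. clock_less x i j) \<and> R x} =
    ennreal (rate i / (\<Sum>j\<in>J. rate j)) * emeasure clocks {x \<in> space clocks. R x}"
proof -
  let ?M = "\<lambda>i. exp_clock (rate i)"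
  let ?J = "J - {i}"
  \<comment> \<open>The ringing times of \<open>j\<close> that lose to time \<open>t\<close> of
    clock \<open>i\<close>: a tie is won by the smaller index, hence the closed half-line for
    \<open>i < j\<close>.\<close>
  define A where "A t j = (if i < j then {t..} else {t<..} :: real set)" for t :: real and j
  define h where "h = (indicator {x \<in> space clocks. R x} :: _ \<Rightarrow> ennreal)"
  have h: "h \<in> borel_measurable clocks" using R by (simp add: h_def)
  have iI: "i \<in> I" using J by auto
  have less: "clock_less x i j \<longleftrightarrow> x j \<in> A (x i) j" for x j
    by (auto simp: clock_less_def A_def)
  have fJ: "finite J" "finite ?J" using J(1) finite_I finite_subset by auto
  let ?\<Lambda> = "\<Sum>j\<in>?J. rate j"
  have \<Lambda>: "?\<Lambda> \<ge> 0" using rate_pos by (simp add: less_imp_le sum_nonneg)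
  define p where "p = emeasure clocks {x \<in> space clocks. R x}"
  let ?K = "I - {i}"
  have finK: "finite ?K" using finite_I by simp
  have upd: "x(i := y) \<in> space clocks" if "x \<in> space (PiM ?K ?M)" for x y
    using that iI by (auto simp: space_PiM PiE_iff extensional_def)
  \<comment> \<open>As \<open>R\<close> ignores coordinate \<open>i\<close>, its indicator descends
    to the product over the other clocks.\<close>
  define h0 where "h0 x = (indicator {x. R x} x :: ennreal)" for x
  have h0: "h (x(i := y)) = h0 x" if "x \<in> space (PiM ?K ?M)" for x y
    using upd[OF that] dep by (simp add: h_def h0_def indicator_def)
  have h0_meas: "h0 \<in> borel_measurable (PiM ?K ?M)"
  proof -
    have u: "(\<lambda>x. x(i := 0)) \<in> PiM ?K ?M \<rightarrow>\<^sub>M clocks"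
    proof -
      have "(\<lambda>x. (x, 0)) \<in> PiM ?K ?M \<rightarrow>\<^sub>M PiM ?K ?M \<Otimes>\<^sub>M ?M i" by measurable
      from measurable_compose[OF this measurable_add_dim[of i ?K ?M]] show ?thesis
        using iI by (simp add: insert_absorb)
    qed
    show ?thesis
      by (rule measurable_cong[THEN iffD1, OF _ measurable_compose[OF u h]]) (simp add: h0)
  qed
  have p: "(\<integral>\<^sup>+x. h0 x \<partial>PiM ?K ?M) = p"
  proof -
    have "p = (\<integral>\<^sup>+x. h x \<partial>clocks)" unfolding p_def h_def using R by simp
    also have "\<dots> = (\<integral>\<^sup>+x. (\<integral>\<^sup>+y. h (x(i := y)) \<partial>?M i) \<partial>PiM ?K ?M)"
      by (rule integral_coordinate[OF iI finite_I h])
    also have "\<dots> = (\<integral>\<^sup>+x. h0 x \<partial>PiM ?K ?M)"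
      by (rule nn_integral_cong) (simp add: h0 M.emeasure_space_1[of i, simplified])
    finally show ?thesis by simp
  qed
  define E where "E = {x \<in> space clocks. (\<forall>j\<in>?J. clock_less x i j) \<and> R x}"
  have E: "E \<in> sets clocks"
  proof -
    have "{x \<in> space clocks. clock_less x i j} \<in> sets clocks" if "j \<in> ?J" for j
    proof -
      have [measurable]: "(\<lambda>x. x i) \<in> clocks \<rightarrow>\<^sub>M borel" "(\<lambda>x. x j) \<in> clocks \<rightarrow>\<^sub>M borel"
        using measurable_component_singleton[of _ I ?M] iI that J(1) by auto
      show ?thesis unfolding clock_less_def by measurable
    qed
    then have "{x \<in> space clocks. (\<forall>j\<in>?J. clock_less x i j)} \<in> sets clocks"
      using fJ by (intro sets.sets_Collect_finite_All) auto
    moreover have "E = {x \<in> space clocks. (\<forall>j\<in>?J. clock_less x i j)} \<inter> {x \<in> space clocks. R x}"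
      unfolding E_def by auto
    ultimately show ?thesis
      using R by (simp only: sets.Int)
  qed
  have "emeasure clocks E = (\<integral>\<^sup>+x. indicator E x \<partial>clocks)" using E by simp
  \<comment> \<open>Integrating first over the other clocks amounts to conditioning on the time
    \<open>y\<close> at which clock \<open>i\<close> rings.\<close>
  also have "\<dots> = (\<integral>\<^sup>+y. (\<integral>\<^sup>+x. indicator E (x(i := y)) \<partial>PiM ?K ?M) \<partial>?M i)"
    using product_nn_integral_insert_rev[of ?K i "indicator E"] iI finK E by (simp add: insert_absorb)
  also have "\<dots> = (\<integral>\<^sup>+y. indicator {0..} y * (ennreal (exp (- (?\<Lambda> * y))) * p) \<partial>?M i)"
  proof (rule nn_integral_cong_AE)
    have "AE y in ?M i. 0 \<le> y"
      by (auto simp: AE_density exponential_density_def)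
    then show "AE y in ?M i. (\<integral>\<^sup>+x. indicator E (x(i := y)) \<partial>PiM ?K ?M) = indicator {0..} y * (ennreal (exp (- (?\<Lambda> * y))) * p)"
    proof eventually_elim
      case (elim y)
      have "(\<integral>\<^sup>+x. indicator E (x(i := y)) \<partial>PiM ?K ?M) =
          (\<integral>\<^sup>+x. (\<Prod>j\<in>?J. indicator (A y j) (x j)) * h0 x \<partial>PiM ?K ?M)"
      proof (rule nn_integral_cong)
        fix x assume x: "x \<in> space (PiM ?K ?M)"
        have "(\<Prod>j\<in>?J. indicator (A y j) (x j) :: ennreal) = indicator {x. \<forall>j\<in>?J. x j \<in> A y j} x"
          using fJ(2) by (auto simp: indicator_def prod_zero_iff)
        moreover have "x(i := y) \<in> E \<longleftrightarrow> (\<forall>j\<in>?J. x j \<in> A y j) \<and> R x"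
          using upd[OF x] dep by (simp add: E_def less)
        ultimately show "indicator E (x(i := y)) = (\<Prod>j\<in>?J. indicator (A y j) (x j)) * h0 x"
          by (simp add: indicator_def h0_def)
      qed
      also have "\<dots> = ennreal (exp (- (?\<Lambda> * y))) * (\<integral>\<^sup>+x. h0 (shift ?J y x) \<partial>PiM ?K ?M)"
        by (rule shift_all[OF finK _ elim]) (use J(1) h0_meas in \<open>auto simp: A_def\<close>)
      also have "(\<lambda>x. h0 (shift ?J y x)) = h0"
        using inv by (auto simp: h0_def indicator_def fun_eq_iff)
      finally show ?case
        using elim p by (simp del: fun_upd_apply)
    qed
  qed
  \<comment> \<open>The density of clock \<open>i\<close> times the survival probability of its
    rivals is the density of the first ring overall, of rate \<open>rate i + ?\<Lambda>\<close>,
    scaled by the winning probability of \<open>i\<close>.\<close>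
  also have "\<dots> = (\<integral>\<^sup>+y. ennreal (rate i / (rate i + ?\<Lambda>)) * p * ennreal (exponential_density (rate i + ?\<Lambda>) y) \<partial>lborel)"
  proof (subst nn_integral_density, simp, simp, rule nn_integral_cong)
    fix y
    have s: "rate i + ?\<Lambda> > 0" using rate_pos[of i] \<Lambda> by simp
    show "ennreal (exponential_density (rate i) y) * (indicator {0..} y * (ennreal (exp (- (?\<Lambda> * y))) * p)) =
        ennreal (rate i / (rate i + ?\<Lambda>)) * p * ennreal (exponential_density (rate i + ?\<Lambda>) y)"
    proof (cases "y \<ge> 0")
      case True
      have "exponential_density (rate i) y * exp (- (?\<Lambda> * y)) =
          rate i / (rate i + ?\<Lambda>) * exponential_density (rate i + ?\<Lambda>) y"
      proof -
        have "exponential_density (rate i) y * exp (- (?\<Lambda> * y)) = rate i * (exp (- y * rate i) * exp (- (?\<Lambda> * y)))"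
          using True by (simp add: exponential_density_def)
        also have "exp (- y * rate i) * exp (- (?\<Lambda> * y)) = exp (- y * (rate i + ?\<Lambda>))"
          by (simp add: mult_exp_exp algebra_simps)
        also have "rate i * \<dots> = rate i / (rate i + ?\<Lambda>) * exponential_density (rate i + ?\<Lambda>) y"
          using True s by (simp add: exponential_density_def)
        finally show ?thesis .
      qed
      then have "ennreal (exponential_density (rate i) y) * ennreal (exp (- (?\<Lambda> * y))) =
          ennreal (rate i / (rate i + ?\<Lambda>)) * ennreal (exponential_density (rate i + ?\<Lambda>) y)"
        using rate_pos[of i] s by (simp add: ennreal_mult'[symmetric] exponential_density_nonneg)
      then show ?thesis using True by (simp add: ac_simps)
    qed (simp add: exponential_density_def)
  qed
  also have "\<dots> = ennreal (rate i / (rate i + ?\<Lambda>)) * p * (\<integral>\<^sup>+y. ennreal (exponential_density (rate i + ?\<Lambda>) y) \<partial>lborel)"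
    by (rule nn_integral_cmult) simp
  also have "(\<integral>\<^sup>+y. ennreal (exponential_density (rate i + ?\<Lambda>) y) \<partial>lborel) = 1"
  proof -
    have "rate i + ?\<Lambda> > 0" using rate_pos[of i] \<Lambda> by simp
    from prob_space.emeasure_space_1[OF prob_space_exponential_density[OF this]] show ?thesis
      by (simp add: emeasure_density)
  qed
  also have "rate i + ?\<Lambda> = (\<Sum>j\<in>J. rate j)"
    using sum.remove[OF fJ(1) J(2), of rate] by simp
  finally show ?thesis
    by (simp add: E_def p_def)
qed

end

section \<open>The law of the tree determined by the clocks\<close>

locale kruskal_clocks = 
  fixes G :: wgraph and E :: "nat \<Rightarrow> nat set" and I :: "nat set" and c :: real
  assumes G: "input_graph G" and inj_E: "inj_on E I" and edges: "E ` I = edges G" and fin: "finite I"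
begin

definition rate :: "nat \<Rightarrow> real" where
  "rate i = exp (- (c / 2) * weight G (E i))"

sublocale clocks rate I
  by unfold_locales (simp_all add: rate_def fin)

sublocale ordered_edges G E I "clock_less x" for x
  by unfold_locales (fact G inj_E edges fin clock_less_order)+

lemma measurable_clock_less:
  assumes "i \<in> I" "j \<in> I"
  shows "{x \<in> space clocks. clock_less x i j} \<in> sets clocks"
proof -
  have [measurable]: "(\<lambda>x. x i) \<in> clocks \<rightarrow>\<^sub>M borel" "(\<lambda>x. x j) \<in> clocks \<rightarrow>\<^sub>M borel"
    using measurable_component_singleton[of _ I "\<lambda>i. exp_clock (rate i)"] assms by auto
  show ?thesis unfolding clock_less_def by measurable
qed

text \<open>The event is split by the clock that rings first. By \<open>race\<close> each part has
  the sampling probability of that edge times the probability of the rest of the run, the same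
  recursion that the expectation of \<open>kruskal_loop\<close> obeys.\<close>

lemma greedy_distribution:
  assumes "kruskal_state G k T (E ` J)" "J \<subseteq> I"
  shows "{x \<in> space clocks. greedy E (clock_less x) k T J \<in> Z} \<in> sets clocks \<and>
    emeasure clocks {x \<in> space clocks. greedy E (clock_less x) k T J \<in> Z} =
      ennreal (measure_pmf.prob (kruskal_loop (weight G) c k T (E ` J)) Z)"
  using assms
proof (induction k arbitrary: T J)
  case 0
  show ?case
  proof (cases "T \<in> Z")
    case True
    then show ?thesis
      using P.emeasure_space_1 by (simp add: sets.top[of clocks, simplified])
  next
    case False
    then show ?thesis by (simp add: indicator_def)
  qed
next
  case (Suc k)
  let ?F = "E ` J"
  define J' where "J' i = {j \<in> J. E j \<in> residual T ?F (E i)}" for i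
  define R where "R i x \<longleftrightarrow> greedy E (clock_less x) k (T \<union> {E i}) (J' i) \<in> Z" for i x
  define B where "B i = {x \<in> space clocks. (\<forall>j\<in>J - {i}. clock_less x i j) \<and> R i x}" for i
  define q where "q i = measure_pmf.prob (kruskal_loop (weight G) c k (T \<union> {E i}) (residual T ?F (E i))) Z" for i
  have J: "finite J" "J \<noteq> {}" using Suc.prems fin finite_subset kruskal_state_nonempty[OF G] by blast+
  have EJ': "E ` J' i = residual T ?F (E i)" for i
    by (auto simp: residual_def J'_def)
  have IH: "{x \<in> space clocks. R i x} \<in> sets clocks"
    "emeasure clocks {x \<in> space clocks. R i x} = ennreal (q i)" if "i \<in> J" for i
  proof -
    have "kruskal_state G k (T \<union> {E i}) (residual T ?F (E i))"
      unfolding residual_def by (rule kruskal_state_step[OF G Suc.prems(1)]) (use that in simp)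
    then show "{x \<in> space clocks. R i x} \<in> sets clocks"
      "emeasure clocks {x \<in> space clocks. R i x} = ennreal (q i)"
      using Suc.IH[of "T \<union> {E i}" "J' i"] Suc.prems(2) unfolding EJ' R_def q_def by (auto simp: J'_def)
  qed
  \<comment> \<open>Later rounds compare rivals of \<open>i\<close> only, which provides both
    invariance hypotheses of \<open>race\<close>.\<close>
  have i_notin: "J' i \<subseteq> J - {i}" for i by (auto simp: J'_def residual_def)
  have B: "B i \<in> sets clocks" if "i \<in> J" for i
  proof -
    have "{x \<in> space clocks. \<forall>j\<in>J - {i}. clock_less x i j} \<in> sets clocks"
      using J that Suc.prems(2) by (intro sets.sets_Collect_finite_All measurable_clock_less) auto
    moreover have "B i = {x \<in> space clocks. \<forall>j\<in>J - {i}. clock_less x i j} \<inter> {x \<in> space clocks. R i x}"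
      by (auto simp: B_def)
    ultimately show ?thesis using IH(1)[OF that] by (simp only: sets.Int)
  qed
  have eB: "emeasure clocks (B i) = ennreal (rate i / (\<Sum>j\<in>J. rate j) * q i)" if i: "i \<in> J" for i
  proof -
    have "emeasure clocks (B i) = ennreal (rate i / (\<Sum>j\<in>J. rate j)) * emeasure clocks {x \<in> space clocks. R i x}"
      unfolding B_def
    proof (rule race[OF Suc.prems(2) i IH(1)[OF i]])
      show "R i (x(i := y)) = R i x" for x y
        unfolding R_def
        by (subst greedy_cong[where lt' = "clock_less x"]) (use i_notin in \<open>auto simp: clock_less_def\<close>)
      show "R i (shift (J - {i}) t x) = R i x" for x t
        unfolding R_def
        by (subst greedy_cong[where lt' = "clock_less x"]) (use i_notin in \<open>auto simp: clock_less_def shift_def\<close>)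
    qed
    then show ?thesis
      unfolding IH(2)[OF i] by (subst ennreal_mult') (auto simp: q_def rate_def intro!: divide_nonneg_nonneg sum_nonneg)
  qed
  \<comment> \<open>With ties broken by index there is a least clock at every point, so the
    decomposition holds exactly and not just almost surely.\<close>
  have eq: "{x \<in> space clocks. greedy E (clock_less x) (Suc k) T J \<in> Z} = (\<Union>i\<in>J. B i)"
  proof (intro set_eqI iffI)
    fix x assume x: "x \<in> {x \<in> space clocks. greedy E (clock_less x) (Suc k) T J \<in> Z}"
    obtain i where i: "i \<in> J" "\<forall>j\<in>J - {i}. clock_less x i j" using ex_least[OF J] by blast
    then show "x \<in> (\<Union>i\<in>J. B i)"
      using x unfolding mem_Collect_eq greedy_Suc[OF i] B_def R_def J'_def by blast
  next
    fix x assume "x \<in> (\<Union>i\<in>J. B i)"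
    then obtain i where i: "i \<in> J" "\<forall>j\<in>J - {i}. clock_less x i j" "x \<in> space clocks" "R i x"
      by (auto simp: B_def)
    show "x \<in> {x \<in> space clocks. greedy E (clock_less x) (Suc k) T J \<in> Z}"
      using i(3,4) unfolding mem_Collect_eq greedy_Suc[OF i(1,2)] R_def J'_def by blast
  qed
  have disj: "disjoint_family_on B J"
    unfolding disjoint_family_on_def B_def
    using clock_less_order(1,2) by blast
  have "emeasure clocks (\<Union>i\<in>J. B i) = (\<Sum>i\<in>J. emeasure clocks (B i))"
    using B J(1) disj by (intro sum_emeasure[symmetric]) auto
  also have "\<dots> = (\<Sum>i\<in>J. ennreal (rate i / (\<Sum>j\<in>J. rate j) * q i))"
    by (rule sum.cong) (use eB in auto)
  also have "\<dots> = ennreal (\<Sum>i\<in>J. rate i / (\<Sum>j\<in>J. rate j) * q i)"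
    by (intro sum_ennreal) (auto simp: q_def rate_def intro!: mult_nonneg_nonneg divide_nonneg_nonneg sum_nonneg)
  also have "(\<Sum>i\<in>J. rate i / (\<Sum>j\<in>J. rate j) * q i) =
      measure_pmf.prob (kruskal_loop (weight G) c (Suc k) T ?F) Z"
  proof -
    have inj: "inj_on E J" using inj_E Suc.prems(2) by (rule inj_on_subset)
    have F: "finite ?F" "?F \<noteq> {}" using J by auto
    have "pmf (gibbs ?F (weight G) c) (E i) = rate i / (\<Sum>j\<in>J. rate j)" if "i \<in> J" for i
      using F that by (subst pmf_proportional_pmf) (auto simp: rate_def sum.reindex[OF inj])
    then show ?thesis
      unfolding prob_as_expectation[of "kruskal_loop (weight G) c (Suc k) T ?F"]
        expectation_kruskal_loop_Suc[OF G Suc.prems(1)] sum.reindex[OF inj]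
      unfolding q_def residual_def by (intro sum.cong) simp_all
  qed
  finally show ?case
    unfolding eq using B J(1) by (auto intro: sets.finite_UN)
qed

lemma msf_distribution:
  "{x \<in> space clocks. msf x \<in> Z} \<in> sets clocks"
  "emeasure clocks {x \<in> space clocks. msf x \<in> Z} =
    ennreal (measure_pmf.prob (kruskal_loop (weight G) c (nverts G - 1) {} (edges G)) Z)"
  using greedy_distribution[of "nverts G - 1" "{}" I Z, unfolded greedy_eq_msf edges,
      OF kruskal_state_init[OF G] order_refl] by simp_all

end

section \<open>From the uniform tape to exponential clocks\<close>

definition clock_of :: "real \<Rightarrow> real \<Rightarrow> real" where
  "clock_of l u = - ln u / l"

lemma distr_clock_of:
  assumes l: "l > 0"
  shows "distr (uniform_measure lborel {0<..<1}) borel (clock_of l) = exp_clock l"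
proof -
  let ?U = "uniform_measure lborel {0<..<1::real}"
  interpret U: prob_space ?U
    by (rule prob_space_uniform_measure) auto
  have [measurable]: "clock_of l \<in> borel_measurable borel"
    unfolding clock_of_def by measurable
  have "distributed ?U lborel (clock_of l) (exponential_density l)"
  proof (rule exponential_distributedI[OF _ l])
    show "clock_of l \<in> borel_measurable ?U" by simp
    fix a :: real assume a: "0 \<le> a"
    \<comment> \<open>Inverse transform sampling: the clock rings by time \<open>a\<close> iff the
      uniform variable is at least \<open>exp (- a * l)\<close>.\<close>
    have "{0<..<1} \<inter> {u. clock_of l u \<le> a} = {exp (- a * l)..<1}"
    proof (intro set_eqI)
      fix u :: real
      show "u \<in> {0<..<1} \<inter> {u. clock_of l u \<le> a} \<longleftrightarrow> u \<in> {exp (- a * l)..<1}"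
      proof (cases "u > 0")
        case True
        have "clock_of l u \<le> a \<longleftrightarrow> - a * l \<le> ln u"
          unfolding clock_of_def pos_divide_le_eq[OF l] by auto
        also have "\<dots> \<longleftrightarrow> exp (- a * l) \<le> u"
          using True by (simp add: ln_ge_iff)
        finally show ?thesis using True by auto
      next
        case False
        then show ?thesis using less_le_trans[OF exp_gt_zero, of "- a * l" u] by auto
      qed
    qed
    then have "emeasure ?U {x. clock_of l x \<le> a} = emeasure lborel {exp (- a * l)..<1}"
      by (subst emeasure_uniform_measure) (auto simp: divide_ennreal_def)
    also have "\<dots> = ennreal (1 - exp (- a * l))"
      using a l by (subst emeasure_lborel_Ico) auto
    also have "\<dots> = 1 - ennreal (exp (- a * l))"
      using ennreal_minus[of "exp (- a * l)" 1] by simp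
    finally show "emeasure ?U {x \<in> space ?U. clock_of l x \<le> a} = 1 - ennreal (exp (- a * l))"
      by simp
  qed
  then have "distr ?U lborel (clock_of l) = exp_clock l"
    by (simp add: distributed_def)
  moreover have "distr ?U lborel (clock_of l) = distr ?U borel (clock_of l)"
    by (rule distr_cong) auto
  ultimately show ?thesis by simp
qed

lemma distr_tape_clocks:
  fixes rate :: "nat \<Rightarrow> real" and m :: nat
  assumes rate: "\<And>i. rate i > 0"
  defines "f \<equiv> \<lambda>\<omega>. \<lambda>i\<in>{1..m}. clock_of (rate i) (\<omega> (i - 1))"
  shows "f \<in> tape_measure \<rightarrow>\<^sub>M PiM {1..m} (\<lambda>i. exp_clock (rate i))"
    "distr tape_measure (PiM {1..m} (\<lambda>i. exp_clock (rate i))) f = PiM {1..m} (\<lambda>i. exp_clock (rate i))"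
proof -
  let ?U = "uniform_measure lborel {0<..<1::real}"
  let ?M = "\<lambda>i. exp_clock (rate i)"
  have U: "prob_space ?U"
    by (rule prob_space_uniform_measure) auto
  interpret clocks rate "{1..m}"
    by unfold_locales (use rate in auto)
  have c [measurable]: "clock_of l \<in> borel_measurable borel" for l
    unfolding clock_of_def by measurable
  show meas: "f \<in> tape_measure \<rightarrow>\<^sub>M PiM {1..m} ?M"
    unfolding f_def
  proof (rule measurable_restrict)
    fix i assume "i \<in> {1..m}"
    have "(\<lambda>\<omega>. \<omega> (i - 1)) \<in> tape_measure \<rightarrow>\<^sub>M ?U"
      unfolding tape_measure_def by (rule measurable_component_singleton) simp
    moreover have "tape_measure \<rightarrow>\<^sub>M ?U = tape_measure \<rightarrow>\<^sub>M borel"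
      by (rule measurable_cong_sets) simp_all
    ultimately have "(\<lambda>\<omega>. \<omega> (i - 1)) \<in> tape_measure \<rightarrow>\<^sub>M borel" by simp
    from measurable_compose[OF this c] show "(\<lambda>\<omega>. clock_of (rate i) (\<omega> (i - 1))) \<in> tape_measure \<rightarrow>\<^sub>M ?M i"
      by simp
  qed
  show "distr tape_measure (PiM {1..m} ?M) f = PiM {1..m} ?M"
  proof (rule PiM_eqI)
    fix A assume A: "\<And>i. i \<in> {1..m} \<Longrightarrow> A i \<in> sets (?M i)"
    define B where "B j = clock_of (rate (Suc j)) -` A (Suc j)" for j
    have B: "B j \<in> sets borel" if "j < m" for j
    proof -
      have "A (Suc j) \<in> sets borel" using A[of "Suc j"] that by auto
      then show ?thesis using measurable_sets[OF c] by (simp add: B_def)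
    qed
    have "emeasure (distr tape_measure (PiM {1..m} ?M) f) (Pi\<^sub>E {1..m} A) =
        emeasure tape_measure (f -` Pi\<^sub>E {1..m} A \<inter> space tape_measure)"
      using A by (intro emeasure_distr[OF meas] sets_PiM_I_finite) auto
    \<comment> \<open>Clocks are numbered from 1 and tape cells from 0, so the event constrains the
      first \<open>m\<close> coordinates of the infinite product.\<close>
    also have "f -` Pi\<^sub>E {1..m} A \<inter> space tape_measure = prod_emb UNIV (\<lambda>_. ?U) {..<m} (Pi\<^sub>E {..<m} B)"
    proof -
      have "(\<forall>i\<in>{1..m}. clock_of (rate i) (\<omega> (i - 1)) \<in> A i) \<longleftrightarrow> (\<forall>j\<in>{..<m}. \<omega> j \<in> B j)" for \<omega>
      proof
        assume a: "\<forall>i\<in>{1..m}. clock_of (rate i) (\<omega> (i - 1)) \<in> A i"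
        show "\<forall>j\<in>{..<m}. \<omega> j \<in> B j"
        proof
          fix j assume "j \<in> {..<m}"
          then show "\<omega> j \<in> B j" using a[rule_format, of "Suc j"] by (simp add: B_def)
        qed
      next
        assume a: "\<forall>j\<in>{..<m}. \<omega> j \<in> B j"
        show "\<forall>i\<in>{1..m}. clock_of (rate i) (\<omega> (i - 1)) \<in> A i"
        proof
          fix i assume "i \<in> {1..m}"
          then have "i - 1 < m" "Suc (i - 1) = i" by auto
          then show "clock_of (rate i) (\<omega> (i - 1)) \<in> A i" using a[rule_format, of "i - 1"] by (simp add: B_def)
        qed
      qed
      then show ?thesis
        by (auto simp: f_def prod_emb_def tape_measure_def space_PiM PiE_iff)
    qed
    also have "emeasure tape_measure (prod_emb UNIV (\<lambda>_. ?U) {..<m} (Pi\<^sub>E {..<m} B)) = (\<Prod>j<m. emeasure ?U (B j))"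
      unfolding tape_measure_def by (rule Infinite_Product_Measure.emeasure_PiM_emb) (use U B in auto)
    also have "\<dots> = (\<Prod>j<m. emeasure (?M (Suc j)) (A (Suc j)))"
    proof (rule prod.cong[OF refl])
      fix j assume j: "j \<in> {..<m}"
      have "emeasure (?M (Suc j)) (A (Suc j)) = emeasure (distr ?U borel (clock_of (rate (Suc j)))) (A (Suc j))"
        by (simp add: distr_clock_of[OF rate])
      also have "\<dots> = emeasure ?U (B j)"
        using A[of "Suc j"] j by (subst emeasure_distr) (auto simp: B_def)
      finally show "emeasure ?U (B j) = emeasure (?M (Suc j)) (A (Suc j))" by simp
    qed
    also have "\<dots> = (\<Prod>i\<in>{1..m}. emeasure (?M i) (A i))"
      by (rule prod.reindex_bij_witness[of _ "\<lambda>i. i - 1" Suc]) auto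
    finally show "emeasure (distr tape_measure (PiM {1..m} ?M) f) (Pi\<^sub>E {1..m} A) = (\<Prod>i\<in>{1..m}. emeasure (?M i) (A i))" .
  qed simp_all
qed

section \<open>The program\<close>

text \<open>Node arrays: 6 to 9 are the adjacency lists (head, successor, target vertex, edge), 10 marks tree
  vertices, 11 to 15 are \<open>cur\<close>, \<open>item\<close>, \<open>rnk\<close>, \<open>chd\<close> and \<open>nx\<close> of the heap, 16 is its stack
  of roots and 17 its rank table. Array 5 holds the scalars. Heap nodes are edges, numbered from 1
  so that 0 can serve as the null pointer.\<close>

abbreviation "vX \<equiv> NLit 0"
abbreviation "vJ \<equiv> NLit 1"
abbreviation "vR \<equiv> NLit 2"
abbreviation "vMx \<equiv> NLit 3"
abbreviation "vH \<equiv> NLit 4"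
abbreviation "vE \<equiv> NLit 5"
abbreviation "vU \<equiv> NLit 6"
abbreviation "vA \<equiv> NLit 7"
abbreviation "vB \<equiv> NLit 8"
abbreviation "vBest \<equiv> NLit 9"
abbreviation "vV \<equiv> NLit 10"
abbreviation "val v \<equiv> NGet 5 v"
abbreviation "assign v x \<equiv> NSet 5 v x"

abbreviation "n_in \<equiv> NGet 0 (NLit 0)"
abbreviation "m_in \<equiv> NGet 0 (NLit 1)"

definition beq :: "nexp \<Rightarrow> nexp \<Rightarrow> bexp" where
  "beq x y = BAnd (BNot (NLess x y)) (BNot (NLess y x))"

text \<open>\<open>clock_less\<close> with its disjunctions expressed by negation and conjunction,
  the connectives of \<open>bexp\<close>.\<close>

definition blt :: "nexp \<Rightarrow> nexp \<Rightarrow> bexp" where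
  "blt x y = BNot (BAnd (BNot (RLess (RGet 2 x) (RGet 2 y)))
     (BNot (BAnd (BNot (RLess (RGet 2 y) (RGet 2 x))) (NLess x y))))"

lemma bval_beq [simp]: "bval (beq x y) s \<longleftrightarrow> nval x s = nval y s"
  by (auto simp: beq_def)

lemma bval_blt [simp]: "bval (blt x y) s \<longleftrightarrow> clock_less (rmem s 2) (nval x s) (nval y s)"
  by (auto simp: blt_def clock_less_def)

fun seqs :: "com list \<Rightarrow> com" where
  "seqs [] = Skip"
| "seqs [c] = c"
| "seqs (c # cs) = Seq c (seqs cs)"

abbreviation "inc v \<equiv> assign v (NAdd (val v) (NLit 1))"
abbreviation "dec v \<equiv> assign v (NSub (val v) (NLit 1))"

definition push :: "nexp \<Rightarrow> com" where
  "push x = Seq (NSet 16 (val vR) x) (inc vR)"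

definition link_step :: com where
  "link_step = seqs [
     If (blt (val vB) (val vA)) (seqs [assign vU (val vA), assign vA (val vB), assign vB (val vU)]) Skip,
     NSet 15 (val vB) (NGet 14 (val vA)),
     NSet 14 (val vA) (val vB),
     NSet 13 (val vA) (NAdd (NGet 13 (val vA)) (NLit 1)),
     push (val vA)]"

definition consolidate_body :: com where
  "consolidate_body = seqs [
     dec vR,
     assign vA (NGet 16 (val vR)),
     If (beq (NGet 11 (NGet 12 (val vA))) (val vA))
       (seqs [
         assign vB (NGet 17 (NGet 13 (val vA))),
         If (beq (val vB) (NLit 0))
           (seqs [
             NSet 17 (NGet 13 (val vA)) (val vA),
             If (NLess (val vMx) (NAdd (NGet 13 (val vA)) (NLit 1)))
               (assign vMx (NAdd (NGet 13 (val vA)) (NLit 1))) Skip])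
           (Seq (NSet 17 (NGet 13 (val vA)) (NLit 0)) link_step)])
       (seqs [
         NSet 13 (val vA) (NLit 0),
         assign vB (NGet 14 (val vA)),
         If (beq (val vB) (NLit 0)) Skip
           (seqs [
             NSet 14 (val vA) (NGet 15 (val vB)),
             push (val vA),
             push (val vB)])])]"

definition consolidate :: com where
  "consolidate = While (NLess (NLit 0) (val vR)) consolidate_body"

definition find_min_body :: com where
  "find_min_body = seqs [
     dec vMx,
     assign vA (NGet 17 (val vMx)),
     If (beq (val vA) (NLit 0)) Skip
       (seqs [
         NSet 17 (val vMx) (NLit 0),
         push (val vA),
         If (beq (val vBest) (NLit 0)) (assign vBest (val vA))
           (If (blt (val vA) (val vBest)) (assign vBest (val vA)) Skip)])]"

text \<open>The roots move from the rank table back to the stack while the least is remembered; the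
  table is thereby empty again for the next scan.\<close>

definition find_min :: com where
  "find_min = Seq (assign vBest (NLit 0)) (While (NLess (NLit 0) (val vMx)) find_min_body)"

text \<open>The improved edge becomes a new node, which takes over all but the first two children of the node
  it supersedes; the latter stays in place as a hollow node.\<close>

definition decrease :: com where
  "decrease = seqs [
     NSet 11 (val vV) (val vE),
     NSet 12 (val vE) (val vV),
     push (val vE),
     If (NLess (NGet 13 (val vU)) (NLit 2)) Skip
       (seqs [
         NSet 13 (val vE) (NSub (NGet 13 (val vU)) (NLit 2)),
         assign vB (NGet 15 (NGet 14 (val vU))),
         NSet 14 (val vE) (NGet 15 (val vB)),
         NSet 15 (val vB) (NLit 0)])]"

definition scan_body :: com where
  "scan_body = seqs [
     assign vV (NGet 8 (val vH)),
     assign vE (NGet 9 (val vH)),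
     If (beq (NGet 10 (val vV)) (NLit 0))
       (seqs [
         assign vU (NGet 11 (val vV)),
         If (beq (val vU) (NLit 0))
           (seqs [NSet 11 (val vV) (val vE), NSet 12 (val vE) (val vV), push (val vE)])
           (If (blt (val vE) (val vU)) decrease Skip)])
       Skip,
     assign vH (NGet 7 (val vH))]"

definition scan :: com where
  "scan = Seq (assign vH (NGet 6 (val vX))) (While (NLess (NLit 0) (val vH)) scan_body)"

text \<open>Clearing the entry of array 11 is the extraction itself. Heap nodes are edge numbers
  from 1, input arrays start at 0, hence the subtraction.\<close>

definition add_vertex :: com where
  "add_vertex = seqs [
     assign vX (NGet 12 (val vBest)),
     NSet 3 (val vJ) (NGet 1 (NSub (val vBest) (NLit 1))),
     NSet 4 (val vJ) (NGet 2 (NSub (val vBest) (NLit 1))),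
     NSet 10 (val vX) (NLit 1),
     NSet 11 (val vX) (NLit 0),
     inc vJ]"

definition prim :: com where
  "prim = While (NLess (val vJ) (NSub n_in (NLit 1)))
     (Seq scan (Seq consolidate (Seq find_min add_vertex)))"

definition half_eps :: com where
  "half_eps = (let l = RLn (RDiv (RNat (NLit 1)) (RGet 0 (NLit 1)));
       d = RSub (RSqrt (RAdd (RGet 0 (NLit 0)) l)) (RSqrt l)
     in RSet 3 (NLit 0) (RDiv (RSqrt (RDiv (RMul (RNat (NLit 2)) (RMul d d))
          (RSub (RNat n_in) (RNat (NLit 1))))) (RNat (NLit 2))))"

definition add_half_edge :: "nexp \<Rightarrow> nexp \<Rightarrow> nexp \<Rightarrow> com" where
  "add_half_edge h u v = seqs [
     NSet 7 h (NGet 6 u), NSet 6 u h, NSet 8 h v, NSet 9 h (val vE)]"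

text \<open>Multiplying \<open>- ln u\<close> by \<open>exp (c / 2 * w)\<close> divides it by the
  clock rate. The random cell is drawn in place and overwritten by its clock.\<close>

definition build_body :: com where
  "build_body = seqs [
     inc vE,
     Sample 2 (val vE),
     RSet 2 (val vE) (RMul (RSub (RNat (NLit 0)) (RLn (RGet 2 (val vE))))
       (RExp (RMul (RGet 3 (NLit 0)) (RGet 1 (NSub (val vE) (NLit 1)))))),
     assign vU (NGet 1 (NSub (val vE) (NLit 1))),
     assign vV (NGet 2 (NSub (val vE) (NLit 1))),
     add_half_edge (val vE) (val vU) (val vV),
     add_half_edge (NAdd m_in (val vE)) (val vV) (val vU)]"

definition build :: com where
  "build = While (NLess (val vE) m_in) build_body"

definition private_prim :: com where
  "private_prim = Seq half_eps (Seq build (Seq (assign vX (NLit 1)) (Seq (NSet 10 (NLit 1) (NLit 1)) prim)))"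

section \<open>The heap loops in memory\<close>

lemma nmem_simps [simp]:
  "nmem (nwrite a i x s) = (nmem s)(a := (nmem s a)(i := x))" "rmem (nwrite a i x s) = rmem s"
  "drawn (nwrite a i x s) = drawn s"
  "nmem (rwrite a i y s) = nmem s" "rmem (rwrite a i y s) = (rmem s)(a := (rmem s a)(i := y))"
  "drawn (rwrite a i y s) = drawn s"
  by (simp_all add: nwrite_def rwrite_def)

abbreviation stack :: "ram_state \<Rightarrow> nat list" where
  "stack s \<equiv> map (nmem s 16) [0..<nmem s 5 2]"

lemma map_upt_push: "map (f(n := x)) [0..<n] = map f [0..<n]"
  by (rule map_cong) auto

lemma map_upt_push2: "map (f(Suc n := x)) [0..<n] = map f [0..<n]"
  by (rule map_cong) auto

context hollow_heap
begin

definition heap_at :: "ram_state \<Rightarrow> nat set \<Rightarrow> nat set \<Rightarrow> (nat \<Rightarrow> nat list) \<Rightarrow> bool" where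
  "heap_at s N U ch \<longleftrightarrow> heap_inv N U ch (stack s) (nmem s 5 3) (nmem s 11) (nmem s 12) (nmem s 13)
     (nmem s 14) (nmem s 15) (nmem s 17) \<and> lt = clock_less (rmem s 2)"

definition pot :: "ram_state \<Rightarrow> nat set \<Rightarrow> (nat \<Rightarrow> nat list) \<Rightarrow> nat" where
  "pot s N ch = potential N ch (stack s) (nmem s 11) (nmem s 12) (nmem s 17)"

end

text \<open>What heap code leaves alone: the graph, the marks, the output, the real arrays and the
  scalars of the outer loop. \<open>same_cur\<close> additionally freezes \<open>cur\<close> and
  \<open>item\<close>.\<close>

definition same_outer :: "ram_state \<Rightarrow> ram_state \<Rightarrow> bool" where
  "same_outer s s' \<longleftrightarrow> (\<forall>a. a < 11 \<longrightarrow> a \<noteq> 5 \<longrightarrow> nmem s' a = nmem s a) \<and>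
     nmem s' 5 0 = nmem s 5 0 \<and> nmem s' 5 1 = nmem s 5 1 \<and> rmem s' = rmem s"

definition same_cur :: "ram_state \<Rightarrow> ram_state \<Rightarrow> bool" where
  "same_cur s s' \<longleftrightarrow> same_outer s s' \<and> nmem s' 11 = nmem s 11 \<and> nmem s' 12 = nmem s 12"

lemma same_refl: "same_outer s s" "same_cur s s"
  by (simp_all add: same_outer_def same_cur_def)

lemma same_cur_trans: "same_cur s s' \<Longrightarrow> same_cur s' s'' \<Longrightarrow> same_cur s s''"
  by (simp add: same_outer_def same_cur_def)

context hollow_heap
begin

lemma consolidate_step:
  fixes \<omega> :: "nat \<Rightarrow> real"
  assumes h: "heap_at s N U ch" and R: "nmem s 5 2 > 0"
  defines "s' \<equiv> sem \<omega> consolidate_body s"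
  shows "\<exists>N' ch'. heap_at s' N' U ch' \<and> Suc (pot s' N' ch') \<le> pot s N ch \<and> same_cur s s'"
proof -
  define k where "k = nmem s 5 2 - 1"
  have k: "nmem s 5 2 = Suc k" using R by (simp add: k_def)
  define a where "a = nmem s 16 k"
  define stk where "stk = map (nmem s 16) [0..<k]"
  have st: "stack s = stk @ [a]" by (simp add: k stk_def a_def)
  note inv = h[unfolded heap_at_def st, THEN conjunct1]
  have lt: "clock_less (rmem s 2) = lt" using h by (simp add: heap_at_def)
  show ?thesis
  proof (cases "nmem s 11 (nmem s 12 a) = a")
    case full: True
    show ?thesis
    proof (cases "nmem s 17 (nmem s 13 a) = 0")
      case True
      note op = inv_to_table[OF inv full True]
      have s': "nmem s' = (nmem s)(5 := (nmem s 5)(2 := k, 7 := a, 8 := 0, 3 := max (nmem s 5 3) (Suc (nmem s 13 a))),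
          17 := (nmem s 17)(nmem s 13 a := a))" "rmem s' = rmem s"
        using full True k by (auto simp: s'_def consolidate_body_def a_def fun_eq_iff max_def)
      show ?thesis
        by (intro exI[of _ N] exI[of _ ch])
          (use op in \<open>simp add: heap_at_def pot_def s' st lt same_cur_def same_outer_def flip: stk_def\<close>)
    next
      case False
      define b where "b = nmem s 17 (nmem s 13 a)"
      \<comment> \<open>A node occurs once among the roots, so it cannot be on the stack and in the
        table. This makes the comparison of the two strict.\<close>
      have ba: "b \<noteq> a"
      proof
        assume "b = a"
        then have "count (mset (stk @ [a]) + table_nodes (nmem s 17)) a \<ge> 2"
          using False root_rank_le[OF inv, of a] in_table_nodes[of a "nmem s 17"]
          by (auto simp: b_def Suc_le_eq count_greater_zero_iff)
        then show False
          using count_nodes[OF inv, of a] unfolding count_union by linarith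
      qed
      define w l where "w = (if lt b a then b else a)" and "l = (if lt b a then a else b)"
      have wl: "w = a \<and> l = b \<or> w = b \<and> l = a" "lt w l"
        using lt_total[OF ba] by (auto simp: w_def l_def)
      note op = inv_link[OF inv full False wl[unfolded b_def]]
      \<comment> \<open>The existential hides the scratch scalars, whose values depend on the
        outcome of the comparison.\<close>
      have "\<exists>z. nmem s' = (nmem s)(5 := z, 13 := (nmem s 13)(w := Suc (nmem s 13 w)),
          14 := (nmem s 14)(w := l), 15 := (nmem s 15)(l := nmem s 14 w), 16 := (nmem s 16)(k := w),
          17 := (nmem s 17)(nmem s 13 a := 0)) \<and>
          z 0 = nmem s 5 0 \<and> z 1 = nmem s 5 1 \<and> z 2 = Suc k \<and> z 3 = nmem s 5 3"
        using full False k
        by (intro exI[of _ "nmem s' 5"]) (auto simp: s'_def consolidate_body_def link_step_def push_def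
            a_def[symmetric] b_def[symmetric] w_def l_def lt fun_eq_iff)
      then obtain z where s': "nmem s' = (nmem s)(5 := z, 13 := (nmem s 13)(w := Suc (nmem s 13 w)),
          14 := (nmem s 14)(w := l), 15 := (nmem s 15)(l := nmem s 14 w), 16 := (nmem s 16)(k := w),
          17 := (nmem s 17)(nmem s 13 a := 0))" "z 0 = nmem s 5 0" "z (Suc 0) = nmem s 5 1" "z 2 = Suc k" "z 3 = nmem s 5 3"
        by auto
      have r: "rmem s' = rmem s"
        by (simp add: s'_def consolidate_body_def link_step_def push_def)
      show ?thesis
        by (intro exI[of _ N] exI[of _ "ch(w := l # ch w)"])
          (use op in \<open>simp add: heap_at_def pot_def s' r st lt same_cur_def same_outer_def map_upt_push flip: stk_def\<close>)
    qed
  next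
    case hollow: False
    show ?thesis
    proof (cases "nmem s 14 a = 0")
      case True
      note op = inv_discard[OF inv hollow True]
      have s': "nmem s' = (nmem s)(5 := (nmem s 5)(2 := k, 7 := a, 8 := 0), 13 := (nmem s 13)(a := 0))" "rmem s' = rmem s"
        using hollow True k by (auto simp: s'_def consolidate_body_def a_def fun_eq_iff)
      show ?thesis
        by (intro exI[of _ "N - {a}"] exI[of _ ch])
          (use op in \<open>simp add: heap_at_def pot_def s' st lt same_cur_def same_outer_def Suc_le_eq flip: stk_def\<close>)
    next
      case False
      note op = inv_consume[OF inv hollow False]
      have s': "nmem s' = (nmem s)(5 := (nmem s 5)(2 := Suc (Suc k), 7 := a, 8 := nmem s 14 a), 13 := (nmem s 13)(a := 0),
          14 := (nmem s 14)(a := nmem s 15 (nmem s 14 a)), 16 := (nmem s 16)(k := a, Suc k := nmem s 14 a))" "rmem s' = rmem s"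
        using hollow False k by (auto simp: s'_def consolidate_body_def push_def a_def fun_eq_iff)
      show ?thesis
        by (intro exI[of _ N] exI[of _ "ch(a := tl (ch a))"])
          (use op in \<open>simp add: heap_at_def pot_def s' st lt same_cur_def same_outer_def map_upt_push map_upt_push2 flip: stk_def\<close>)
    qed
  qed
qed

lemma cost_consolidate_body: "cost consolidate_body = 15" "loop_free consolidate_body"
  by (simp_all add: consolidate_body_def link_step_def push_def)


text \<open>One unit of potential buys one pass: 15 steps for the body and 1 for the test. The
  remaining potential stays funded for later.\<close>

lemma wp_consolidate:
  assumes h: "heap_at s N U ch" and t: "16 * pot s N ch + rest < t"
    and Q: "\<And>s' N' ch' t'. heap_at s' N' U ch' \<Longrightarrow> nmem s' 5 2 = 0 \<Longrightarrow> same_cur s s' \<Longrightarrow>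
      16 * pot s' N' ch' + rest \<le> t' \<Longrightarrow> Q s' t'"
  shows "wp \<omega> consolidate Q s t"
  unfolding consolidate_def
proof (rule wp_While[where I = "\<lambda>s' t'. \<exists>N' ch'. heap_at s' N' U ch' \<and> same_cur s s' \<and>
    16 * pot s' N' ch' + rest < t'"])
  show "\<exists>N' ch'. heap_at s N' U ch' \<and> same_cur s s \<and> 16 * pot s N' ch' + rest < t"
    using h t same_refl by blast
next
  fix s' t'
  assume "\<exists>N' ch'. heap_at s' N' U ch' \<and> same_cur s s' \<and> 16 * pot s' N' ch' + rest < t'"
    and b: "bval (NLess (NLit 0) (val vR)) s'"
  then obtain N' ch' where i: "heap_at s' N' U ch'" "same_cur s s'" "16 * pot s' N' ch' + rest < t'"
    by blast
  have "nmem s' 5 2 > 0" using b by simp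
  from consolidate_step[OF i(1) this, of \<omega>] obtain N'' ch'' where
    n: "heap_at (sem \<omega> consolidate_body s') N'' U ch''"
      "Suc (pot (sem \<omega> consolidate_body s') N'' ch'') \<le> pot s' N' ch'" "same_cur s' (sem \<omega> consolidate_body s')"
    by blast
  show "wp \<omega> consolidate_body (\<lambda>s' t'. \<exists>N' ch'. heap_at s' N' U ch' \<and> same_cur s s' \<and>
      16 * pot s' N' ch' + rest < t') s' (t' - 1)"
  proof (rule wp_loop_free)
    have "16 * Suc (pot (sem \<omega> consolidate_body s') N'' ch'') + rest \<le> 16 * pot s' N' ch' + rest"
      using n(2) by (intro add_right_mono mult_le_mono2)
    then have le: "16 * Suc (pot (sem \<omega> consolidate_body s') N'' ch'') + rest < t'"
      using i(3) by (rule le_less_trans)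
    then show "\<exists>N' ch'. heap_at (sem \<omega> consolidate_body s') N' U ch' \<and> same_cur s (sem \<omega> consolidate_body s') \<and>
        16 * pot (sem \<omega> consolidate_body s') N' ch' + rest < t' - 1 - cost consolidate_body"
      using n(1,3) same_cur_trans[OF i(2)] cost_consolidate_body(1)
      by (intro exI[of _ N''] exI[of _ ch'']) auto
    show "cost consolidate_body \<le> t' - 1"
      using le by (simp add: cost_consolidate_body)
  qed (rule cost_consolidate_body)
next
  fix s' t'
  assume "\<exists>N' ch'. heap_at s' N' U ch' \<and> same_cur s s' \<and> 16 * pot s' N' ch' + rest < t'"
    and b: "\<not> bval (NLess (NLit 0) (val vR)) s'"
  then obtain N' ch' where i: "heap_at s' N' U ch'" "same_cur s s'" "16 * pot s' N' ch' + rest < t'"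
    by blast
  show "Q s' (t' - 1)"
    by (rule Q[OF i(1) _ i(2)]) (use b i(3) in auto)
qed auto

definition best_of :: "ram_state \<Rightarrow> bool" where
  "best_of s \<longleftrightarrow> (if nmem s 5 2 = 0 then nmem s 5 9 = 0
     else nmem s 5 9 \<in> set (stack s) \<and> (\<forall>x\<in>set (stack s) - {nmem s 5 9}. lt (nmem s 5 9) x)) \<and>
     (\<forall>x\<in>set (stack s). nmem s 11 (nmem s 12 x) = x)"

lemma find_min_step:
  fixes \<omega> :: "nat \<Rightarrow> real"
  assumes h: "heap_at s N U ch" and mx: "nmem s 5 3 > 0" and best: "best_of s"
  defines "s' \<equiv> sem \<omega> find_min_body s"
  shows "heap_at s' N U ch \<and> pot s' N ch \<le> Suc (pot s N ch) \<and> same_cur s s' \<and> best_of s' \<and>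
    Suc (nmem s' 5 3) = nmem s 5 3"
proof -
  obtain k where k: "nmem s 5 3 = Suc k" using mx by (cases "nmem s 5 3") auto
  have lt: "clock_less (rmem s 2) = lt" using h by (simp add: heap_at_def)
  note inv = h[unfolded heap_at_def k, THEN conjunct1]
  note op = inv_dump[OF inv]
  define a where "a = nmem s 17 k"
  show ?thesis
  proof (cases "a = 0")
    case True
    have s': "nmem s' = (nmem s)(5 := (nmem s 5)(3 := k, 7 := 0))" "rmem s' = rmem s"
      using True k by (auto simp: s'_def find_min_body_def a_def fun_eq_iff)
    have same: "nmem s' 16 = nmem s 16" "nmem s' 5 2 = nmem s 5 2" "nmem s' 5 9 = nmem s 5 9"
      "nmem s' 11 = nmem s 11" "nmem s' 12 = nmem s 12"
      by (simp_all add: s')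
    have "best_of s'"
      using best unfolding best_of_def same .
    then show ?thesis
      using op(1) True k by (simp add: heap_at_def pot_def s' lt same_cur_def same_outer_def a_def)
  next
    case False
    define R where "R = nmem s 5 2"
    define best' where "best' = (if nmem s 5 9 = 0 then a else if lt a (nmem s 5 9) then a else nmem s 5 9)"
    have s': "nmem s' = (nmem s)(5 := (nmem s 5)(3 := k, 7 := a, 2 := Suc R, 9 := best'), 16 := (nmem s 16)(R := a),
        17 := (nmem s 17)(k := 0))" "rmem s' = rmem s"
      using False k by (auto simp: s'_def find_min_body_def push_def a_def[symmetric] R_def best'_def lt fun_eq_iff)
    have st: "stack s' = stack s @ [a]"
      by (simp add: s' R_def map_upt_push)
    have full: "nmem s 11 (nmem s 12 a) = a"
      using inv_simps(16)[OF inv, of k] False by (simp add: a_def)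
    \<comment> \<open>The value 0 encodes that no candidate has been seen, so a genuine candidate
      must not be 0.\<close>
    have nonzero: "nmem s 5 9 \<noteq> 0" if "R \<noteq> 0"
    proof -
      have "nmem s 5 9 \<in> set (stack s)" using best that by (simp add: best_of_def R_def)
      then have "nmem s 5 9 \<in> N" using root_node[OF inv, of "nmem s 5 9"] by simp
      then show ?thesis using inv_simps(6)[OF inv] by metis
    qed
    have "best' \<in> set (stack s @ [a]) \<and> (\<forall>x\<in>set (stack s @ [a]) - {best'}. lt best' x)"
    proof (cases "R = 0")
      case True
      then show ?thesis using best by (simp add: best_of_def R_def best'_def)
    next
      case R: False
      then have b: "nmem s 5 9 \<in> set (stack s)" "\<And>x. x \<in> set (stack s) \<Longrightarrow> x \<noteq> nmem s 5 9 \<Longrightarrow> lt (nmem s 5 9) x"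
        using best by (auto simp: best_of_def R_def)
      show ?thesis
      proof (cases "lt a (nmem s 5 9)")
        case True
        then have "lt a x" if "x \<in> set (stack s)" for x
          using b(2)[OF that] lt_trans by blast
        then show ?thesis using True nonzero[OF R] by (simp add: best'_def)
      next
        case False
        then have "lt (nmem s 5 9) a \<or> a = nmem s 5 9" using lt_total by blast
        then show ?thesis using False nonzero[OF R] b by (auto simp: best'_def)
      qed
    qed
    then have "best_of s'"
      using best full unfolding best_of_def st by (auto simp: s')
    moreover have "heap_at s' N U ch"
      using op(2) False unfolding heap_at_def st by (simp add: s' lt a_def)
    moreover have "pot s' N ch \<le> Suc (pot s N ch)"
      using op(3) False unfolding pot_def st by (simp add: s' a_def)
    ultimately show ?thesis
      by (simp add: same_cur_def same_outer_def s' k)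
  qed
qed

lemma cost_find_min_body: "cost find_min_body = 9" "loop_free find_min_body"
  by (simp_all add: find_min_body_def push_def)

text \<open>The 26 steps per slot are 9 for the body, 1 for the test and 16 to fund the unit of
  potential gained by moving a root to the stack.\<close>

lemma wp_find_min:
  assumes h: "heap_at s N U ch" and R: "nmem s 5 2 = 0"
    and t: "16 * pot s N ch + 26 * M + rest + 2 \<le> t"
    and Q: "\<And>s' t'. heap_at s' N U ch \<Longrightarrow> nmem s' 5 3 = 0 \<Longrightarrow> best_of s' \<Longrightarrow> same_cur s s' \<Longrightarrow>
      16 * pot s' N ch + rest \<le> t' \<Longrightarrow> Q s' t'"
  shows "wp \<omega> find_min Q s t"
  unfolding find_min_def
proof (rule wp_Seq, rule wp_loop_free)
  let ?I = "\<lambda>s' t'. heap_at s' N U ch \<and> best_of s' \<and> same_cur s s' \<and> 16 * pot s' N ch + 26 * nmem s' 5 3 + rest < t'"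
  let ?s = "sem \<omega> (assign vBest (NLit 0)) s"
  have mx: "nmem s 5 3 \<le> M" using h inv_simps(17) by (auto simp: heap_at_def)
  show "wp \<omega> (While (NLess (NLit 0) (val vMx)) find_min_body) Q ?s (t - cost (assign vBest (NLit 0)))"
  proof (rule wp_While[where I = ?I])
    have "heap_at ?s N U ch"
      using conjunct1[OF h[unfolded heap_at_def]] conjunct2[OF h[unfolded heap_at_def], symmetric]
      by (simp add: heap_at_def)
    moreover have "same_cur s ?s" "pot ?s N ch = pot s N ch" "best_of ?s"
      using R by (simp_all add: pot_def same_cur_def same_outer_def best_of_def)
    ultimately show "?I ?s (t - cost (assign vBest (NLit 0)))"
      using t mx by simp
  next
    fix s' t' assume i: "?I s' t'" and b: "bval (NLess (NLit 0) (val vMx)) s'"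
    have "nmem s' 5 3 > 0" using b by simp
    note n = find_min_step[OF conjunct1[OF i] this, of \<omega>]
    have n: "heap_at (sem \<omega> find_min_body s') N U ch" "pot (sem \<omega> find_min_body s') N ch \<le> Suc (pot s' N ch)"
      "same_cur s' (sem \<omega> find_min_body s')" "best_of (sem \<omega> find_min_body s')"
      "Suc (nmem (sem \<omega> find_min_body s') 5 3) = nmem s' 5 3"
      using n i by auto
    have le: "16 * pot (sem \<omega> find_min_body s') N ch + 26 * Suc (nmem (sem \<omega> find_min_body s') 5 3) + rest < 16 + t'"
      using i n(2) unfolding n(5) by simp
    show "wp \<omega> find_min_body ?I s' (t' - 1)"
    proof (rule wp_loop_free)
      show "?I (sem \<omega> find_min_body s') (t' - 1 - cost find_min_body)"
        using n(1,3,4) same_cur_trans[of s s'] i le by (auto simp: cost_find_min_body)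
      show "cost find_min_body \<le> t' - 1"
        using le by (simp add: cost_find_min_body)
    qed (rule cost_find_min_body)
  next
    fix s' t' assume "?I s' t'" "\<not> bval (NLess (NLit 0) (val vMx)) s'"
    then show "Q s' (t' - 1)" by (intro Q) auto
  qed auto
qed (use t in auto)

end

section \<open>Prim's algorithm on the heap\<close>

lemma cost_scan_body: "cost scan_body = 16" "loop_free scan_body"
  by (simp_all add: scan_body_def decrease_def push_def)

lemma cost_add_vertex: "cost add_vertex = 6" "loop_free add_vertex"
  by (simp_all add: add_vertex_def)

lemma same_outer_trans: "same_outer s s' \<Longrightarrow> same_outer s' s'' \<Longrightarrow> same_outer s s''"
  by (simp add: same_outer_def)

locale prim_run = hollow_heap lt M m + ordered_edges G E "{1..m}" lt
  for lt M m G E +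
  fixes adj :: "nat \<Rightarrow> nat list" and tgt eid :: "nat \<Rightarrow> nat"
  assumes adj_distinct: "v \<in> verts G \<Longrightarrow> distinct (map eid (adj v))"
    and adj_edges: "v \<in> verts G \<Longrightarrow> eid ` set (adj v) = {e \<in> {1..m}. v \<in> E e}"
    and adj_target: "v \<in> verts G \<Longrightarrow> h \<in> set (adj v) \<Longrightarrow> E (eid h) = {v, tgt h}"
begin

definition graph_at :: "ram_state \<Rightarrow> bool" where
  "graph_at s \<longleftrightarrow> (\<forall>v\<in>verts G. chain (nmem s 7) (nmem s 6 v) (adj v)) \<and> nmem s 8 = tgt \<and> nmem s 9 = eid \<and>
     nmem s 0 0 = nverts G \<and> (\<forall>e\<in>{1..m}. E e = {nmem s 1 (e - 1), nmem s 2 (e - 1)})"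

lemma graph_at_same: "graph_at s \<Longrightarrow> same_outer s s' \<Longrightarrow> graph_at s'"
  by (simp add: graph_at_def same_outer_def)

text \<open>\<open>S\<close> is the vertex set of the tree and \<open>D\<close> the set of edges that have been scanned from the tree.\<close>

definition cut_inv :: "ram_state \<Rightarrow> nat set \<Rightarrow> nat set \<Rightarrow> nat set \<Rightarrow> bool" where
  "cut_inv s S D U \<longleftrightarrow> (\<forall>v. nmem s 10 v = 0 \<longleftrightarrow> v \<notin> S) \<and>
     (\<forall>v\<in>verts G - S. \<forall>e\<in>D. v \<in> E e \<longrightarrow> nmem s 11 v \<noteq> 0 \<and> (nmem s 11 v = e \<or> lt (nmem s 11 v) e)) \<and>
     (\<forall>v. nmem s 11 v \<noteq> 0 \<longrightarrow> v \<in> verts G - S \<and> nmem s 11 v \<in> D \<and> v \<in> E (nmem s 11 v)) \<and>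
     U \<subseteq> D \<and> D \<subseteq> {1..m}"

lemma cut_invI:
  assumes "\<And>v. nmem s 10 v = 0 \<longleftrightarrow> v \<notin> S"
    "\<And>v e. v \<in> verts G - S \<Longrightarrow> e \<in> D \<Longrightarrow> v \<in> E e \<Longrightarrow> nmem s 11 v \<noteq> 0 \<and> (nmem s 11 v = e \<or> lt (nmem s 11 v) e)"
    "\<And>v. nmem s 11 v \<noteq> 0 \<Longrightarrow> v \<in> verts G - S \<and> nmem s 11 v \<in> D \<and> v \<in> E (nmem s 11 v)"
    "U \<subseteq> D" "D \<subseteq> {1..m}"
  shows "cut_inv s S D U"
  unfolding cut_inv_def by (intro conjI allI ballI impI assms; assumption)

lemma cut_invD:
  assumes "cut_inv s S D U"
  shows "\<And>v. nmem s 10 v = 0 \<longleftrightarrow> v \<notin> S"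
    "\<And>v e. v \<in> verts G - S \<Longrightarrow> e \<in> D \<Longrightarrow> v \<in> E e \<Longrightarrow> nmem s 11 v \<noteq> 0 \<and> (nmem s 11 v = e \<or> lt (nmem s 11 v) e)"
    "\<And>v. nmem s 11 v \<noteq> 0 \<Longrightarrow> v \<in> verts G - S \<and> nmem s 11 v \<in> D \<and> v \<in> E (nmem s 11 v)"
    "U \<subseteq> D" "D \<subseteq> {1..m}"
proof -
  note c0 = assms[unfolded cut_inv_def]
  note c = conjunct1[OF c0] conjunct1[OF conjunct2[OF c0]] conjunct1[OF conjunct2[OF conjunct2[OF c0]]]
    conjunct1[OF conjunct2[OF conjunct2[OF conjunct2[OF c0]]]] conjunct2[OF conjunct2[OF conjunct2[OF conjunct2[OF c0]]]]
  show "U \<subseteq> D" "D \<subseteq> {1..m}" by (fact c)+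
  fix v
  show "nmem s 10 v = 0 \<longleftrightarrow> v \<notin> S" by (rule spec[OF c(1)])
  show "nmem s 11 v \<noteq> 0 \<Longrightarrow> v \<in> verts G - S \<and> nmem s 11 v \<in> D \<and> v \<in> E (nmem s 11 v)"
    by (rule mp[OF spec[OF c(3)]])
  show "nmem s 11 v \<noteq> 0 \<and> (nmem s 11 v = e \<or> lt (nmem s 11 v) e)" if "v \<in> verts G - S" "e \<in> D" "v \<in> E e" for e
    by (rule mp[OF bspec[OF bspec[OF c(2) that(1)] that(2)] that(3)])
qed

lemma cut_inv_cong:
  assumes "nmem s' 10 = nmem s 10" "nmem s' 11 = nmem s 11"
  shows "cut_inv s' S D U \<longleftrightarrow> cut_inv s S D U"
  unfolding cut_inv_def assms ..

lemma cut_inv_same: "cut_inv s S D U \<Longrightarrow> same_cur s s' \<Longrightarrow> cut_inv s' S D U"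
  by (subst cut_inv_cong[of s' s]) (simp_all add: same_cur_def same_outer_def)

definition touched :: "nat set \<Rightarrow> nat set" where
  "touched P = {e \<in> {1..m}. E e \<inter> P \<noteq> {}}"

lemma edge_vertices:
  assumes "e \<in> {1..m}"
  shows "E e \<subseteq> verts G" "\<exists>u v. E e = {u, v} \<and> u \<noteq> v"
proof -
  have "E e \<in> edges G" using edges assms by blast
  then obtain u v where "E e = {u, v}" "u \<in> verts G" "v \<in> verts G" "u \<noteq> v"
    by (rule edgeE[OF G])
  then show "E e \<subseteq> verts G" "\<exists>u v. E e = {u, v} \<and> u \<noteq> v" by auto
qed

text \<open>Covers all outcomes of scanning one half-edge: the far end is in the tree,
  \<open>e\<close> becomes its best edge, or the old one remains best.\<close>

lemma cut_inv_extend: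
  assumes cut: "cut_inv s S D U" and e: "e \<in> {1..m}" "E e = {x, w}" "x \<in> S" "w \<in> verts G"
    and s': "nmem s' 10 = nmem s 10" "nmem s' 11 = (nmem s 11)(w := c')" "U' \<subseteq> insert e U"
    and c': "w \<in> S \<and> c' = nmem s 11 w \<or> w \<notin> S \<and> (c' = e \<and> (nmem s 11 w = 0 \<or> lt e (nmem s 11 w)) \<or>
      c' = nmem s 11 w \<and> c' \<noteq> 0 \<and> (c' = e \<or> lt c' e))"
  shows "cut_inv s' S (insert e D) U'"
proof (rule cut_invI)
  note c = cut_invD[OF cut]
  have e0: "e \<noteq> 0" using e(1) by simp
  show "nmem s' 10 v = 0 \<longleftrightarrow> v \<notin> S" for v unfolding s'(1) by (rule c(1))
  show "U' \<subseteq> insert e D" using s'(3) c(4) by blast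
  show "insert e D \<subseteq> {1..m}" using e(1) c(5) by blast
  show "v \<in> verts G - S \<and> nmem s' 11 v \<in> insert e D \<and> v \<in> E (nmem s' 11 v)" if nz: "nmem s' 11 v \<noteq> 0" for v
  proof (cases "v = w \<and> c' = e \<and> w \<notin> S")
    case True
    then show ?thesis using e by (simp add: s'(2))
  next
    case False
    then have eq: "nmem s' 11 v = nmem s 11 v" using c' by (auto simp: s'(2))
    show ?thesis using c(3)[of v] nz unfolding eq by blast
  qed
  show "nmem s' 11 v \<noteq> 0 \<and> (nmem s' 11 v = f \<or> lt (nmem s' 11 v) f)"
    if v: "v \<in> verts G - S" "f \<in> insert e D" "v \<in> E f" for v f
  proof (cases "v = w")
    case False
    then have "f \<noteq> e" using v e(2,3) by auto
    then have "f \<in> D" using v(2) by simp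
    have eq: "nmem s' 11 v = nmem s 11 v" using False by (simp add: s'(2))
    show ?thesis unfolding eq by (rule c(2)[OF v(1) \<open>f \<in> D\<close> v(3)])
  next
    case True
    have eq: "nmem s' 11 v = c'" using True by (simp add: s'(2))
    have wS: "w \<notin> S" using v(1) True by simp
    show ?thesis
    proof (cases "f = e")
      case True
      then show ?thesis unfolding eq using c' wS e0 by auto
    next
      case False
      then have "f \<in> D" using v(2) by simp
      from c(2)[OF v(1) this v(3)] have "nmem s 11 w \<noteq> 0" "nmem s 11 w = f \<or> lt (nmem s 11 w) f"
        unfolding True by blast+
      then show ?thesis unfolding eq using c' wS e0 lt_trans[of e "nmem s 11 w" f] by auto
    qed
  qed
qed

text \<open>The bound 8 is the price of a decrease; an insertion takes 2 units and the other
  outcomes none.\<close>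

lemma scan_step:
  fixes \<omega> :: "nat \<Rightarrow> real"
  assumes h: "heap_at s N U ch" and mx: "nmem s 5 3 = 0" and cut: "cut_inv s S D U"
    and e: "nmem s 8 (nmem s 5 4) = w" "nmem s 9 (nmem s 5 4) = e"
    and ed: "e \<in> {1..m}" "E e = {x, w}" "x \<in> S" "w \<in> verts G" "w \<notin> S \<Longrightarrow> e \<notin> D"
  defines "s' \<equiv> sem \<omega> scan_body s"
  shows "\<exists>N' U' ch'. heap_at s' N' U' ch' \<and> nmem s' 5 3 = 0 \<and> cut_inv s' S (insert e D) U' \<and>
    pot s' N' ch' \<le> pot s N ch + 8 \<and> same_outer s s' \<and> nmem s' 5 4 = nmem s 7 (nmem s 5 4)"
proof -
  note inv = h[unfolded heap_at_def, THEN conjunct1]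
  have lt: "clock_less (rmem s 2) = lt" using h by (simp add: heap_at_def)
  have tab: "nmem s 17 r = 0" for r
    using inv_simps(14)[OF inv, of r] mx by auto
  have e0: "e \<noteq> 0" using ed(1) by auto
  define R where "R = nmem s 5 2"
  \<comment> \<open>Heap nodes are edge numbers, which is why at most \<open>m\<close> of them are
    ever created.\<close>
  have card: "card (insert e U) \<le> m"
  proof -
    have "insert e U \<subseteq> {1..m}" using cut_invD(4,5)[OF cut] ed(1) by blast
    then show ?thesis using card_mono[of "{1..m}" "insert e U"] by simp
  qed
  note extend = cut_inv_extend[OF cut ed(1-4)]
  show ?thesis
  proof (cases "w \<in> S")
    case True
    then have w: "nmem s 10 w \<noteq> 0" using cut_invD(1)[OF cut, of w] by simp
    have s': "nmem s' = (nmem s)(5 := (nmem s 5)(10 := w, 5 := e, 4 := nmem s 7 (nmem s 5 4)))" "rmem s' = rmem s"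
      using w by (auto simp: s'_def scan_body_def e fun_eq_iff)
    have "cut_inv s' S (insert e D) U"
      by (rule extend[where c' = "nmem s 11 w"]) (use True in \<open>simp_all add: s' subset_insertI\<close>)
    then have "heap_at s' (N) (U) (ch) \<and> nmem s' 5 3 = 0 \<and> cut_inv s' S (insert e D) (U) \<and>
        pot s' (N) (ch) \<le> pot s N ch + 8 \<and> same_outer s s' \<and> nmem s' 5 4 = nmem s 7 (nmem s 5 4)"
      using h mx by (simp add: heap_at_def pot_def s' lt same_outer_def)
    then show ?thesis by (intro exI) assumption
  next
    case wS: False
    then have w: "nmem s 10 w = 0" using cut_invD(1)[OF cut, of w] by simp
    have eU: "e \<notin> U" "e \<notin> D" using cut_invD(4)[OF cut] ed(5)[OF wS] by blast+
    show ?thesis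
    proof (cases "nmem s 11 w = 0")
      case True
      note op = inv_insert[OF inv True eU(1) e0 card]
      have s': "nmem s' = (nmem s)(5 := (nmem s 5)(10 := w, 5 := e, 6 := 0, 2 := Suc R, 4 := nmem s 7 (nmem s 5 4)),
          11 := (nmem s 11)(w := e), 12 := (nmem s 12)(e := w), 16 := (nmem s 16)(R := e))" "rmem s' = rmem s"
        using w True by (auto simp: s'_def scan_body_def push_def R_def e fun_eq_iff)
      have "cut_inv s' S (insert e D) (insert e U)"
        by (rule extend[where c' = e]) (use True wS in \<open>simp_all add: s'\<close>)
      then have "heap_at s' (insert e N) (insert e U) (ch(e := [])) \<and> nmem s' 5 3 = 0 \<and> cut_inv s' S (insert e D) (insert e U) \<and>
        pot s' (insert e N) (ch(e := [])) \<le> pot s N ch + 8 \<and> same_outer s s' \<and> nmem s' 5 4 = nmem s 7 (nmem s 5 4)"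
      using op mx by (simp add: heap_at_def pot_def s' lt same_outer_def map_upt_push R_def)
    then show ?thesis by (intro exI) assumption
    next
      case u: False
      show ?thesis
      proof (cases "lt e (nmem s 11 w)")
        case False
        then have ltu: "lt (nmem s 11 w) e"
          using lt_total[of e "nmem s 11 w"] cut_invD(3)[OF cut u] eU(2) False by auto
        have s': "nmem s' = (nmem s)(5 := (nmem s 5)(10 := w, 5 := e, 6 := nmem s 11 w, 4 := nmem s 7 (nmem s 5 4)))" "rmem s' = rmem s"
          using w u False by (auto simp: s'_def scan_body_def e lt fun_eq_iff)
        have "cut_inv s' S (insert e D) U"
          by (rule extend[where c' = "nmem s 11 w"]) (use u ltu wS in \<open>simp_all add: s' subset_insertI\<close>)
        then have "heap_at s' (N) (U) (ch) \<and> nmem s' 5 3 = 0 \<and> cut_inv s' S (insert e D) (U) \<and>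
        pot s' (N) (ch) \<le> pot s N ch + 8 \<and> same_outer s s' \<and> nmem s' 5 4 = nmem s 7 (nmem s 5 4)"
      using h mx by (simp add: heap_at_def pot_def s' lt same_outer_def)
    then show ?thesis by (intro exI) assumption
      next
        case True
        define u where "u = nmem s 11 w"
        define c2 where "c2 = nmem s 15 (nmem s 14 u)"
        define small where "small \<longleftrightarrow> nmem s 13 u < 2"
        define rnk' where "rnk' = (if small then nmem s 13 else (nmem s 13)(e := nmem s 13 u - 2))"
        define chd' where "chd' = (if small then nmem s 14 else (nmem s 14)(e := nmem s 15 c2))"
        define nx' where "nx' = (if small then nmem s 15 else (nmem s 15)(c2 := 0))"
        define z where "z = (if small then nmem s 5 8 else c2)"
        have new: "if nmem s 13 (nmem s 11 w) < 2 then rnk' = nmem s 13 \<and> chd' = nmem s 14 \<and> nx' = nmem s 15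
            else rnk' = (nmem s 13)(e := nmem s 13 (nmem s 11 w) - 2) \<and>
              chd' = (nmem s 14)(e := nmem s 15 (nmem s 15 (nmem s 14 (nmem s 11 w)))) \<and>
              nx' = (nmem s 15)(nmem s 15 (nmem s 14 (nmem s 11 w)) := 0)"
          by (simp add: rnk'_def chd'_def nx'_def small_def u_def c2_def)
        from inv_decrease[OF inv tab u True eU(1) e0 card refl refl new]
        obtain ch' where op: "heap_inv (insert e N) (insert e U) ch' (stack s @ [e]) (nmem s 5 3) ((nmem s 11)(w := e))
            ((nmem s 12)(e := w)) rnk' chd' nx' (nmem s 17)"
          "potential (insert e N) ch' (stack s @ [e]) ((nmem s 11)(w := e)) ((nmem s 12)(e := w)) (nmem s 17) \<le> pot s N ch + 8"
          unfolding pot_def by blast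
        have ue: "u \<noteq> e" using True lt_irrefl by (auto simp: u_def)
        have "nmem s 14 u \<noteq> e" if "\<not> small"
        proof
          assume ch: "nmem s 14 u = e"
          have uN: "u \<in> N" using inv_simps(18)[OF inv u] by (simp add: u_def)
          have "chain (nmem s 15) (nmem s 14 u) (ch u)" by (rule inv_simps(8)[OF inv uN])
          then have "e \<in> set (ch u)" using chain_pos e0 ch by fastforce
          then have "e \<in> N" by (rule child_node[OF inv uN])
          then show False using inv_simps(1)[OF inv] eU(1) by auto
        qed
        then have s': "nmem s' = (nmem s)(5 := (nmem s 5)(10 := w, 5 := e, 6 := u, 2 := Suc R, 8 := z, 4 := nmem s 7 (nmem s 5 4)),
            11 := (nmem s 11)(w := e), 12 := (nmem s 12)(e := w), 13 := rnk', 14 := chd', 15 := nx',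
            16 := (nmem s 16)(R := e))" "rmem s' = rmem s"
          using w u True ue
          by (auto simp: s'_def scan_body_def decrease_def push_def R_def e lt fun_eq_iff u_def[symmetric] rnk'_def chd'_def
              nx'_def z_def c2_def small_def)
        have "cut_inv s' S (insert e D) (insert e U)"
          by (rule extend[where c' = e]) (use True wS in \<open>simp_all add: s'\<close>)
        then have "heap_at s' (insert e N) (insert e U) (ch') \<and> nmem s' 5 3 = 0 \<and> cut_inv s' S (insert e D) (insert e U) \<and>
        pot s' (insert e N) (ch') \<le> pot s N ch + 8 \<and> same_outer s s' \<and> nmem s' 5 4 = nmem s 7 (nmem s 5 4)"
      using op mx by (simp add: heap_at_def pot_def s' lt same_outer_def map_upt_push R_def)
    then show ?thesis by (intro exI) assumption
      qed
    qed
  qed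
qed

text \<open>A half-edge needs 16 * 8 steps to fund the potential, 16 for the body and 1 for the
  test, together 145, rounded up to 150.\<close>

lemma wp_scan:
  assumes h: "heap_at s N U ch" and mx: "nmem s 5 3 = 0" and g: "graph_at s"
    and x: "nmem s 5 0 = x" "x \<in> S" "S \<subseteq> verts G"
    and cut: "cut_inv s S (touched (S - {x})) U"
    and t: "16 * pot s N ch + 150 * length (adj x) + rest + 1 < t"
    and Q: "\<And>s' N' U' ch' t'. heap_at s' N' U' ch' \<Longrightarrow> nmem s' 5 3 = 0 \<Longrightarrow> cut_inv s' S (touched S) U' \<Longrightarrow>
      same_outer s s' \<Longrightarrow> 16 * pot s' N' ch' + rest \<le> t' \<Longrightarrow> Q s' t'"
  shows "wp \<omega> scan Q s t"
  unfolding scan_def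
proof (rule wp_Seq, rule wp_loop_free)
  let ?D = "\<lambda>done. touched (S - {x}) \<union> eid ` set done"
  let ?I = "\<lambda>s' t'. \<exists>done todo N U ch. adj x = done @ todo \<and> chain (nmem s' 7) (nmem s' 5 4) todo \<and>
    heap_at s' N U ch \<and> nmem s' 5 3 = 0 \<and> cut_inv s' S (?D done) U \<and> same_outer s s' \<and>
    16 * pot s' N ch + 150 * length todo + rest < t'"
  let ?a = "assign vH (NGet 6 (val vX))"
  let ?s = "sem \<omega> ?a s"
  have xG: "x \<in> verts G" using x by auto
  show "wp \<omega> (While (NLess (NLit 0) (val vH)) scan_body) Q ?s (t - cost ?a)"
  proof (rule wp_While[where I = ?I])
    have "heap_at ?s N U ch"
      using conjunct1[OF h[unfolded heap_at_def]] conjunct2[OF h[unfolded heap_at_def], symmetric]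
      by (simp add: heap_at_def)
    moreover have "chain (nmem ?s 7) (nmem ?s 5 4) (adj x)"
      using g xG x(1) by (simp add: graph_at_def)
    moreover have "cut_inv ?s S (?D []) U"
      by (subst cut_inv_cong[of ?s s]) (use cut in simp_all)
    moreover have "nmem ?s 5 3 = 0" "same_outer s ?s" "pot ?s N ch = pot s N ch"
      using mx by (simp_all add: same_outer_def pot_def)
    ultimately have "adj x = [] @ adj x \<and> chain (nmem ?s 7) (nmem ?s 5 4) (adj x) \<and> heap_at ?s N U ch \<and>
      nmem ?s 5 3 = 0 \<and> cut_inv ?s S (?D []) U \<and> same_outer s ?s \<and>
      16 * pot ?s N ch + 150 * length (adj x) + rest < t - cost ?a"
      using t by simp
    then show "?I ?s (t - cost ?a)" by (intro exI) assumption
  next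
    fix s' t' assume "?I s' t'" and b: "bval (NLess (NLit 0) (val vH)) s'"
    then obtain dn todo N U ch where i: "adj x = dn @ todo" "chain (nmem s' 7) (nmem s' 5 4) todo"
      "heap_at s' N U ch" "nmem s' 5 3 = 0" "cut_inv s' S (?D dn) U" "same_outer s s'"
      "16 * pot s' N ch + 150 * length todo + rest < t'" by blast
    define h where "h = nmem s' 5 4"
    have "h \<noteq> 0" using b by (simp add: h_def)
    then obtain todo' where todo: "todo = h # todo'" "chain (nmem s' 7) (nmem s' 7 h) todo'"
      using chain_pos[OF i(2)] by (auto simp: h_def)
    have gs: "graph_at s'" by (rule graph_at_same[OF g i(6)])
    have hadj: "h \<in> set (adj x)" using i(1) todo by simp
    have e: "nmem s' 8 h = tgt h" "nmem s' 9 h = eid h" using gs by (simp_all add: graph_at_def)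
    have em: "eid h \<in> {1..m}" using adj_edges[OF xG] hadj by blast
    have Ee: "E (eid h) = {x, tgt h}" by (rule adj_target[OF xG hadj])
    have tG: "tgt h \<in> verts G" using edge_vertices(1)[OF em] Ee by auto
    \<comment> \<open>An edge leaving the tree has been scanned neither from another tree vertex nor
      earlier in the list of \<open>x\<close>, so it is available as a new node.\<close>
    have fresh: "eid h \<notin> ?D dn" if "tgt h \<notin> S"
    proof -
      have "eid h \<notin> touched (S - {x})" using Ee that by (auto simp: touched_def)
      moreover have "eid h \<notin> eid ` set dn" using adj_distinct[OF xG] unfolding i(1) todo by auto
      ultimately show ?thesis by simp
    qed
    from scan_step[OF i(3,4,5) e(1)[unfolded h_def] e(2)[unfolded h_def] _ _ x(2), folded h_def, OF em Ee tG fresh, of \<omega>]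
    obtain N' U' ch' where n: "heap_at (sem \<omega> scan_body s') N' U' ch'" "nmem (sem \<omega> scan_body s') 5 3 = 0"
      "cut_inv (sem \<omega> scan_body s') S (insert (eid h) (?D dn)) U'"
      "pot (sem \<omega> scan_body s') N' ch' \<le> pot s' N ch + 8" "same_outer s' (sem \<omega> scan_body s')"
      "nmem (sem \<omega> scan_body s') 5 4 = nmem s' 7 h" by blast
    have D: "insert (eid h) (?D dn) = ?D (dn @ [h])" by auto
    have "16 * pot (sem \<omega> scan_body s') N' ch' \<le> 16 * (pot s' N ch + 8)"
      using n(4) by (rule mult_le_mono2)
    then have le: "16 * pot (sem \<omega> scan_body s') N' ch' + 150 * length todo' + rest + 20 < t'"
      using i(7) unfolding todo(1) by simp
    show "wp \<omega> scan_body ?I s' (t' - 1)"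
    proof (rule wp_loop_free)
      show "?I (sem \<omega> scan_body s') (t' - 1 - cost scan_body)"
      proof (rule exI[of _ "dn @ [h]"], rule exI[of _ todo'], rule exI[of _ N'], rule exI[of _ U'], rule exI[of _ ch'], intro conjI)
        show "chain (nmem (sem \<omega> scan_body s') 7) (nmem (sem \<omega> scan_body s') 5 4) todo'"
          using todo(2) n(5,6) by (simp add: same_outer_def)
        show "same_outer s (sem \<omega> scan_body s')" by (rule same_outer_trans[OF i(6) n(5)])
        show "cut_inv (sem \<omega> scan_body s') S (?D (dn @ [h])) U'" using n(3) unfolding D .
        show "16 * pot (sem \<omega> scan_body s') N' ch' + 150 * length todo' + rest < t' - 1 - cost scan_body"
          using le by (simp add: cost_scan_body)
      qed (use i(1) todo n in auto)
      show "cost scan_body \<le> t' - 1" using le by (simp add: cost_scan_body)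
    qed (rule cost_scan_body)
  next
    fix s' t' assume "?I s' t'" and b: "\<not> bval (NLess (NLit 0) (val vH)) s'"
    then obtain dn todo N U ch where i: "adj x = dn @ todo" "chain (nmem s' 7) (nmem s' 5 4) todo"
      "heap_at s' N U ch" "nmem s' 5 3 = 0" "cut_inv s' S (?D dn) U" "same_outer s s'"
      "16 * pot s' N ch + 150 * length todo + rest < t'" by blast
    have "todo = []" using b i(2) by (simp add: chain_0)
    then have "?D dn = touched (S - {x}) \<union> {e \<in> {1..m}. x \<in> E e}" using i(1) adj_edges[OF xG] by simp
    also have "\<dots> = touched S" using x(2) by (auto simp: touched_def)
    finally show "Q s' (t' - 1)"
      by (intro Q[OF i(3,4) _ i(6)]) (use i(5,7) in auto)
  qed auto
qed (use t in auto)

lemma exists_cut_edge: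
  assumes "S \<subseteq> verts G" "S \<noteq> verts G" "S \<noteq> {}"
  shows "\<exists>e\<in>{1..m}. \<exists>a b. E e = {a, b} \<and> a \<in> S \<and> b \<in> verts G - S"
proof (rule ccontr)
  assume no: "\<not> ?thesis"
  obtain x y where xy: "x \<in> S" "y \<in> verts G - S" using assms by blast
  have "b \<in> S" if "(a, b) \<in> reach (edges G)" "a \<in> S" for a b
    using that
  proof (induction rule: reach_induct)
    case (step b c)
    then obtain e where e: "e \<in> {1..m}" "E e = {b, c}" using edges by (metis (no_types, lifting) imageE)
    then have "c \<in> verts G" using edge_vertices(1)[OF e(1)] by auto
    then show ?case using no e step by blast
  qed
  moreover have "(x, y) \<in> reach (edges G)"
    using input_graph_reach[OF G] xy assms(1) by blast
  ultimately show False using xy by blast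
qed

section \<open>Growing the tree by the least cut edge\<close>

definition outs :: "ram_state \<Rightarrow> nat set set" where
  "outs s = {{nmem s 3 i, nmem s 4 i} | i. i < nmem s 5 1}"

definition tree_inv :: "ram_state \<Rightarrow> nat set \<Rightarrow> bool" where
  "tree_inv s S \<longleftrightarrow> S \<subseteq> verts G \<and> card S = Suc (nmem s 5 1) \<and> nmem s 5 0 \<in> S \<and> outs s \<subseteq> msf \<and>
     (\<forall>u\<in>S. \<forall>v\<in>S. (u, v) \<in> reach (outs s))"

lemma tree_inv_same: "tree_inv s S \<Longrightarrow> same_outer s s' \<Longrightarrow> tree_inv s' S"
  by (simp add: tree_inv_def same_outer_def outs_def)

text \<open>The least heap node is a root, and after consolidation all roots are full. It therefore
  is the current edge of a vertex outside the tree, and it is the least cut edge although hollow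
  nodes may still lie in the heap.\<close>

lemma add_vertex_step:
  fixes \<omega> :: "nat \<Rightarrow> real"
  assumes h: "heap_at s N U ch" and mx: "nmem s 5 3 = 0" and g: "graph_at s" and best: "best_of s"
    and cut: "cut_inv s S (touched S) U" and tree: "tree_inv s S" and j: "nmem s 5 1 < nverts G - 1"
  defines "s' \<equiv> sem \<omega> add_vertex s"
  shows "\<exists>v. v \<in> verts G - S \<and> heap_at s' N U ch \<and> nmem s' 5 3 = 0 \<and> graph_at s' \<and> nmem s' 5 0 = v \<and>
    cut_inv s' (insert v S) (touched S) U \<and> tree_inv s' (insert v S) \<and> pot s' N ch \<le> pot s N ch + 3 * M \<and>
    nmem s' 5 1 = Suc (nmem s 5 1)"
proof -
  note inv = h[unfolded heap_at_def, THEN conjunct1]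
  have lt: "clock_less (rmem s 2) = lt" using h by (simp add: heap_at_def)
  have tab: "nmem s 17 r = 0" for r
    using inv_simps(14)[OF inv, of r] mx by auto
  have "table_nodes (nmem s 17) = {#}"
    unfolding table_nodes_def by (simp add: tab)
  note c = cut_invD[OF cut]
  have S: "S \<subseteq> verts G" "card S = Suc (nmem s 5 1)" "S \<noteq> {}" using tree by (auto simp: tree_inv_def)
  have finS: "finite S" using S(1) input_graph_facts(1)[OF G] finite_subset by blast
  have SV: "S \<noteq> verts G" using S(2) j input_graph_facts(3)[OF G] by auto
  \<comment> \<open>Connectedness supplies a cut edge; it has been scanned, so its outer end has a
    current node and the heap is not empty.\<close>
  obtain e a b where e: "e \<in> {1..m}" "E e = {a, b}" "a \<in> S" "b \<in> verts G - S"
    using exists_cut_edge[OF S(1) SV S(3)] by blast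
  then have "e \<in> touched S" "b \<in> E e" by (auto simp: touched_def)
  then have "nmem s 11 b \<noteq> 0" using c(2)[OF e(4)] by blast
  then have "nmem s 11 b \<in> N" by (rule inv_simps(18)[OF inv])
  then have "N \<noteq> {}" by auto
  then obtain x0 where x0: "x0 \<in> N" "\<forall>y\<in>N - {x0}. lt x0 y"
    using ex_least[OF inv_simps(5)[OF inv]] by blast
  have "x0 \<in># mset (stack s) + table_nodes (nmem s 17)"
    by (rule least_node_is_root[OF inv x0(1)]) (use x0(2) in auto)
  then have x0s: "x0 \<in> set (stack s)" using \<open>table_nodes (nmem s 17) = {#}\<close> by simp
  define i where "i = nmem s 5 9"
  have "nmem s 5 2 \<noteq> 0"
  proof
    assume "nmem s 5 2 = 0"
    then have "stack s = []" by simp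
    then show False using x0s by (simp only: list.set empty_iff)
  qed
  then have bs: "i \<in> set (stack s)" "\<forall>x\<in>set (stack s) - {i}. lt i x" "\<forall>x\<in>set (stack s). nmem s 11 (nmem s 12 x) = x"
    using best unfolding best_of_def i_def by presburger+
  have iN: "i \<in> N" using root_node[OF inv, of i] bs(1) by simp
  have "i = x0"
  proof (rule ccontr)
    assume "i \<noteq> x0"
    then have "lt i x0" "lt x0 i" using bs(2) x0 x0s iN by auto
    then show False using lt_trans lt_irrefl by blast
  qed
  then have least: "i = y \<or> lt i y" if "y \<in> N" for y using x0(2) that by auto
  have i0: "i \<noteq> 0" using iN inv_simps(6)[OF inv] by metis
  define v where "v = nmem s 12 i"
  have cv: "nmem s 11 v = i" unfolding v_def by (rule bspec[OF bs(3,1)])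
  have cv0: "nmem s 11 v \<noteq> 0" using cv i0 by simp
  have v: "v \<in> verts G - S" "i \<in> touched S" "v \<in> E i" using c(3)[OF cv0] unfolding cv by blast+
  have im: "i \<in> {1..m}" using v(2) by (simp add: touched_def)
  obtain y where y: "y \<in> E i" "y \<in> S" using v(2) by (auto simp: touched_def)
  have Ei: "E i = {y, v}"
    using edge_vertices(2)[OF im] y v by auto
  have "E i \<in> msf"
  proof (rule cut_edge_in_msf[OF im Ei y(2)])
    show "v \<notin> S" using v by auto
    \<comment> \<open>A cut edge is never below the current edge of its outer end, which is a heap
      node and hence not below \<open>i\<close>.\<close>
    fix k a b assume k: "k \<in> {1..m}" "E k = {a, b}" "a \<in> S" "b \<notin> S"
    then have "k \<in> touched S" "b \<in> verts G - S" "b \<in> E k"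
      using edge_vertices(1)[OF k(1)] by (auto simp: touched_def)
    then have 1: "nmem s 11 b \<noteq> 0" "nmem s 11 b = k \<or> lt (nmem s 11 b) k"
      using c(2)[of b k] by blast+
    have "i = nmem s 11 b \<or> lt i (nmem s 11 b)"
      by (rule least[OF inv_simps(18)[OF inv 1(1)]])
    then show "k = i \<or> lt i k" using 1(2) lt_trans by blast
  qed
  define J where "J = nmem s 5 1"
  have s': "nmem s' = (nmem s)(5 := (nmem s 5)(0 := v, 1 := Suc J), 3 := (nmem s 3)(J := nmem s 1 (i - 1)),
      4 := (nmem s 4)(J := nmem s 2 (i - 1)), 10 := (nmem s 10)(v := 1), 11 := (nmem s 11)(v := 0))" "rmem s' = rmem s"
    by (auto simp: s'_def add_vertex_def i_def v_def J_def fun_eq_iff)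
  have op: "heap_inv N U ch (stack s) (nmem s 5 3) ((nmem s 11)(v := 0)) (nmem s 12) (nmem s 13) (nmem s 14) (nmem s 15) (nmem s 17)"
    "potential N ch (stack s) ((nmem s 11)(v := 0)) (nmem s 12) (nmem s 17) \<le>
     potential N ch (stack s) (nmem s 11) (nmem s 12) (nmem s 17) + 3 * M"
    using inv_extract[OF inv tab cv0] bs(1) cv by auto
  have Eio: "E i = {nmem s 1 (i - 1), nmem s 2 (i - 1)}" using g im by (simp add: graph_at_def)
  have outs': "outs s' = insert (E i) (outs s)"
  proof -
    let ?f = "\<lambda>a. {nmem s' 3 a, nmem s' 4 a}"
    have A: "{f a |a. a < Suc J} = insert (f J) {f a |a. a < J}" for f :: "nat \<Rightarrow> nat set"
      by (auto simp: less_Suc_eq)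
    have "outs s' = {?f a |a. a < Suc J}" by (simp add: outs_def s')
    also have "\<dots> = insert (?f J) {?f a |a. a < J}" by (rule A)
    also have "?f J = E i" by (simp add: s' Eio)
    also have "{?f a |a. a < J} = outs s"
      unfolding outs_def
    proof (intro Collect_cong ex_cong1)
      fix x a
      show "(x = ?f a \<and> a < J) = (x = {nmem s 3 a, nmem s 4 a} \<and> a < nmem s 5 1)"
        by (cases "a = J") (auto simp: s' J_def)
    qed
    finally show ?thesis .
  qed
  have "cut_inv s' (insert v S) (touched S) U"
  proof (rule cut_invI)
    show "nmem s' 10 a = 0 \<longleftrightarrow> a \<notin> insert v S" for a
      using c(1)[of a] by (simp add: s')
    show "nmem s' 11 a \<noteq> 0 \<and> (nmem s' 11 a = f \<or> lt (nmem s' 11 a) f)"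
      if "a \<in> verts G - insert v S" "f \<in> touched S" "a \<in> E f" for a f
      using c(2)[of a f] that by (simp add: s')
    show "a \<in> verts G - insert v S \<and> nmem s' 11 a \<in> touched S \<and> a \<in> E (nmem s' 11 a)" if "nmem s' 11 a \<noteq> 0" for a
      using c(3)[of a] that by (simp add: s' split: if_splits)
  qed (fact c)+
  moreover have "tree_inv s' (insert v S)"
  proof -
    have R: "(a, b) \<in> reach (outs s')" if "(a, b) \<in> reach (outs s)" for a b
      using that reach_mono[of "outs s" "outs s'"] outs' by auto
    have yv: "(y, v) \<in> reach (outs s')" using outs' Ei by (auto intro: reach_edge)
    have y_all: "(y, a) \<in> reach (outs s')" if "a \<in> insert v S" for a
      using that yv R tree y(2) by (auto simp: tree_inv_def)
    have "(a, b) \<in> reach (outs s')" if "a \<in> insert v S" "b \<in> insert v S" for a b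
      using reach_trans[OF reach_sym[OF y_all[OF that(1)]] y_all[OF that(2)]] .
    moreover have "card (insert v S) = Suc (Suc J)" using v(1) finS S(2) by (simp add: J_def)
    moreover have "outs s' \<subseteq> msf" using outs' \<open>E i \<in> msf\<close> tree by (simp add: tree_inv_def)
    ultimately show ?thesis
      using S(1) v(1) by (simp add: tree_inv_def s')
  qed
  moreover have "graph_at s'" using g by (simp add: graph_at_def s')
  ultimately show ?thesis
    using op v(1) mx by (intro exI[of _ v]) (simp add: heap_at_def pot_def s' lt J_def)
qed

text \<open>The newest tree vertex is charged with the outer ones because its list is still
  unscanned. Each vertex to come needs 26 * M for emptying the table and 48 * M = 16 * 3 * M for the
  potential added by extraction.\<close>

definition prim_inv :: "ram_state \<Rightarrow> nat \<Rightarrow> nat \<Rightarrow> bool" where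
  "prim_inv s rest t \<longleftrightarrow> (\<exists>S N U ch. heap_at s N U ch \<and> nmem s 5 3 = 0 \<and> graph_at s \<and> tree_inv s S \<and>
     cut_inv s S (touched (S - {nmem s 5 0})) U \<and>
     16 * pot s N ch + 150 * (\<Sum>v\<in>insert (nmem s 5 0) (verts G - S). length (adj v)) +
       (nverts G - 1 - nmem s 5 1) * (74 * M + 20) + rest < t)"

lemma prim_iteration:
  assumes i: "prim_inv s rest t" and j: "nmem s 5 1 < nverts G - 1"
  shows "wp \<omega> (Seq scan (Seq consolidate (Seq find_min add_vertex))) (\<lambda>s t. prim_inv s rest t) s (t - 1)"
proof -
  from i obtain S N U ch where h: "heap_at s N U ch" and mx: "nmem s 5 3 = 0" and g: "graph_at s" and tree: "tree_inv s S"
    and cut: "cut_inv s S (touched (S - {nmem s 5 0})) U"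
    and t: "16 * pot s N ch + 150 * (\<Sum>v\<in>insert (nmem s 5 0) (verts G - S). length (adj v)) +
       (nverts G - 1 - nmem s 5 1) * (74 * M + 20) + rest < t"
    unfolding prim_inv_def by blast
  define x where "x = nmem s 5 0"
  have xS: "x \<in> S" "S \<subseteq> verts G" using tree by (auto simp: tree_inv_def x_def)
  define A where "A = (\<Sum>v\<in>verts G - S. length (adj v))"
  define k where "k = nverts G - 1 - Suc (nmem s 5 1)"
  have k: "nverts G - 1 - nmem s 5 1 = Suc k" using j by (simp add: k_def)
  define r1 where "r1 = 150 * A + k * (74 * M + 20) + rest + 74 * M + 15"
  have sumx: "(\<Sum>v\<in>insert (nmem s 5 0) (verts G - S). length (adj v)) = length (adj x) + A"
    using xS(1) input_graph_facts(1)[OF G] by (simp add: A_def x_def)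
  have t1: "16 * pot s N ch + 150 * length (adj x) + r1 + 1 < t - 1"
    using t unfolding sumx k r1_def by (simp add: algebra_simps)
  show ?thesis
  proof (rule wp_Seq, rule wp_scan[OF h mx g x_def[symmetric] xS cut[folded x_def] t1])
    fix s1 N1 U1 ch1 t1
    assume 1: "heap_at s1 N1 U1 ch1" "nmem s1 5 3 = 0" "cut_inv s1 S (touched S) U1" "same_outer s s1"
      "16 * pot s1 N1 ch1 + r1 \<le> t1"
    define r2 where "r2 = r1 - 1"
    have t1': "16 * pot s1 N1 ch1 + r2 < t1" using 1(5) by (simp add: r2_def r1_def)
    show "wp \<omega> (Seq consolidate (Seq find_min add_vertex)) (\<lambda>s t. prim_inv s rest t) s1 t1"
    proof (rule wp_Seq, rule wp_consolidate[OF 1(1) t1'])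
      fix s2 N2 ch2 t2
      assume 2: "heap_at s2 N2 U1 ch2" "nmem s2 5 2 = 0" "same_cur s1 s2" "16 * pot s2 N2 ch2 + r2 \<le> t2"
      \<comment> \<open>What is left after the 26 * M of \<open>find_min\<close>: the 48 * M are
        meant for the extraction.\<close>
      define r3 where "r3 = 150 * A + k * (74 * M + 20) + rest + 48 * M + 10"
      have t2': "16 * pot s2 N2 ch2 + 26 * M + r3 + 2 \<le> t2" using 2(4) by (simp add: r1_def r2_def r3_def)
      show "wp \<omega> (Seq find_min add_vertex) (\<lambda>s t. prim_inv s rest t) s2 t2"
      proof (rule wp_Seq, rule wp_find_min[OF 2(1,2) t2'])
        fix s3 t3
        assume 3: "heap_at s3 N2 U1 ch2" "nmem s3 5 3 = 0" "best_of s3" "same_cur s2 s3" "16 * pot s3 N2 ch2 + r3 \<le> t3"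
        have same: "same_cur s1 s3" by (rule same_cur_trans[OF 2(3) 3(4)])
        then have outer: "same_outer s s3"
          using same_outer_trans[OF 1(4)] by (simp add: same_cur_def)
        have j3: "nmem s3 5 1 = nmem s 5 1" using outer by (simp add: same_outer_def)
        from add_vertex_step[OF 3(1,2) graph_at_same[OF g outer] 3(3) cut_inv_same[OF 1(3) same] tree_inv_same[OF tree outer],
          unfolded j3, OF j, of \<omega>]
        obtain v where 4: "v \<in> verts G - S" "heap_at (sem \<omega> add_vertex s3) N2 U1 ch2" "nmem (sem \<omega> add_vertex s3) 5 3 = 0"
          "graph_at (sem \<omega> add_vertex s3)" "nmem (sem \<omega> add_vertex s3) 5 0 = v"
          "cut_inv (sem \<omega> add_vertex s3) (insert v S) (touched S) U1" "tree_inv (sem \<omega> add_vertex s3) (insert v S)"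
          "pot (sem \<omega> add_vertex s3) N2 ch2 \<le> pot s3 N2 ch2 + 3 * M" "nmem (sem \<omega> add_vertex s3) 5 1 = Suc (nmem s 5 1)"
          by blast
        have "insert v S - {v} = S" using 4(1) by auto
        have "insert v (verts G - insert v S) = verts G - S" using 4(1) by auto
        have "16 * pot (sem \<omega> add_vertex s3) N2 ch2 \<le> 16 * (pot s3 N2 ch2 + 3 * M)"
          using 4(8) by (rule mult_le_mono2)
        then have le: "16 * pot (sem \<omega> add_vertex s3) N2 ch2 + 150 * A + k * (74 * M + 20) + rest + 10 \<le> t3"
          using 3(5) by (simp add: r3_def)
        show "wp \<omega> add_vertex (\<lambda>s t. prim_inv s rest t) s3 t3"
        proof (rule wp_loop_free)
          show "prim_inv (sem \<omega> add_vertex s3) rest (t3 - cost add_vertex)"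
            unfolding prim_inv_def
          proof (rule exI[of _ "insert v S"], rule exI[of _ N2], rule exI[of _ U1], rule exI[of _ ch2], intro conjI)
            show "cut_inv (sem \<omega> add_vertex s3) (insert v S) (touched (insert v S - {nmem (sem \<omega> add_vertex s3) 5 0})) U1"
              using 4(6) unfolding 4(5) \<open>insert v S - {v} = S\<close> .
            show "16 * pot (sem \<omega> add_vertex s3) N2 ch2 + 150 * (\<Sum>v\<in>insert (nmem (sem \<omega> add_vertex s3) 5 0)
                (verts G - insert v S). length (adj v)) + (nverts G - 1 - nmem (sem \<omega> add_vertex s3) 5 1) * (74 * M + 20) + rest
                < t3 - cost add_vertex"
              using le unfolding 4(5,9) \<open>insert v (verts G - insert v S) = verts G - S\<close> A_def[symmetric] k_def[symmetric]
              by (simp add: cost_add_vertex)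
          qed (fact 4)+
          show "cost add_vertex \<le> t3" using le by (simp add: cost_add_vertex)
        qed (rule cost_add_vertex)
      qed
    qed
  qed
qed

lemma wp_prim:
  assumes "prim_inv s rest t"
    and Q: "\<And>s' t'. output_edges G s' = msf \<Longrightarrow> rest \<le> t' \<Longrightarrow> Q s' t'"
  shows "wp \<omega> prim Q s t"
  unfolding prim_def
proof (rule wp_While[where I = "\<lambda>s t. prim_inv s rest t"])
  show "t > 0" if "prim_inv s rest t" for s t
    using that by (auto simp: prim_inv_def)
  have n: "nmem s 0 0 = nverts G" if "prim_inv s rest t" for s t
    using that by (auto simp: prim_inv_def graph_at_def)
  show "wp \<omega> (Seq scan (Seq consolidate (Seq find_min add_vertex))) (\<lambda>s t. prim_inv s rest t) s (t - 1)"
    if "prim_inv s rest t" "bval (NLess (val vJ) (NSub n_in (NLit 1))) s" for s t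
    using prim_iteration[OF that(1), of \<omega>] that n by simp
  show "Q s (t - 1)" if i: "prim_inv s rest t" and b: "\<not> bval (NLess (val vJ) (NSub n_in (NLit 1))) s" for s t
  proof (rule Q)
    from i obtain S where tree: "tree_inv s S" and t: "rest < t" unfolding prim_inv_def by auto
    have S: "S \<subseteq> verts G" "card S = Suc (nmem s 5 1)" using tree by (auto simp: tree_inv_def)
    have "card S \<le> nverts G"
      using card_mono[OF input_graph_facts(1)[OF G] S(1)] input_graph_facts(3)[OF G] by simp
    then have j: "nmem s 5 1 = nverts G - 1" "card S = card (verts G)"
      using b n[OF i] S(2) input_graph_facts(3)[OF G] by auto
    have "S = verts G" using card_subset_eq[OF input_graph_facts(1)[OF G] S(1) j(2)] .
    then have "outs s = msf"
      using tree by (intro msf_eqI) (auto simp: tree_inv_def connects_def reach_def)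
    then show "output_edges G s = msf"
      unfolding output_edges_def outs_def j(1) .
    show "rest \<le> t - 1" using t by simp
  qed
qed (fact assms(1))

end

section \<open>Reading the input, and the main result\<close>

lemma ln_2_ge: "ln (2::real) \<ge> 1 / 2"
  using ln_le_minus_one[of "1 / 2 :: real"] by (simp add: ln_div)

locale listed_graph =
  fixes G :: wgraph and es :: "(nat \<times> nat) list" and \<epsilon> \<delta> :: real
  assumes G: "input_graph G" and n2: "nverts G \<ge> 2" and listing: "edge_listing G es"
begin

abbreviation "m \<equiv> length es"
abbreviation "src k \<equiv> fst (es ! k)"
abbreviation "dst k \<equiv> snd (es ! k)"

definition E :: "nat \<Rightarrow> nat set" where
  "E e = {src (e - 1), dst (e - 1)}"

lemma E_Suc: "E (Suc k) = (\<lambda>(u, v). {u, v}) (es ! k)"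
  by (simp add: E_def case_prod_unfold)

lemma edges_eq: "E ` {1..m} = edges G"
proof -
  have "edges G = set (map (\<lambda>(u, v). {u, v}) es)"
    using listing by (simp add: edge_listing_def)
  also have "\<dots> = (\<lambda>k. (\<lambda>(u, v). {u, v}) (es ! k)) ` {..<m}"
  proof -
    have "set es = (\<lambda>k. es ! k) ` {..<m}" by (auto simp: set_conv_nth)
    then show ?thesis by (simp only: set_map image_image)
  qed
  also have "\<dots> = E ` Suc ` {..<m}"
    unfolding image_image E_Suc ..
  also have "Suc ` {..<m} = {1..m}"
    by (simp add: image_Suc_lessThan)
  finally show ?thesis ..
qed

lemma inj_E: "inj_on E {1..m}"
proof (rule inj_onI)
  fix i j assume ij: "i \<in> {1..m}" "j \<in> {1..m}" "E i = E j"
  define a b where "a = i - 1" and "b = j - 1"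
  have ab: "i = Suc a" "j = Suc b" "a < m" "b < m" using ij by (auto simp: a_def b_def)
  have "distinct (map (\<lambda>(u, v). {u, v}) es)"
    using listing by (simp add: edge_listing_def)
  from nth_eq_iff_index_eq[OF this, of a b] have "(\<lambda>(u, v). {u, v}) (es ! a) = (\<lambda>(u, v). {u, v}) (es ! b) \<longleftrightarrow> a = b"
    using ab(3,4) by simp
  then have "a = b" using ij(3) unfolding ab(1,2) E_Suc by blast
  then show "i = j" using ab by simp
qed

lemma ends:
  assumes "k < m"
  shows "src k \<in> verts G" "dst k \<in> verts G" "src k \<noteq> dst k"
proof -
  have "E (Suc k) \<in> edges G" using edges_eq assms by (auto intro: imageI)
  then obtain u v where "E (Suc k) = {u, v}" "u \<in> verts G" "v \<in> verts G" "u \<noteq> v"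
    by (rule edgeE[OF G])
  then show "src k \<in> verts G" "dst k \<in> verts G" "src k \<noteq> dst k"
    by (auto simp: E_def doubleton_eq_iff)
qed

lemma m_pos: "m \<ge> 1"
proof -
  have "card (edges G) = m"
    using edges_eq card_image[OF inj_E] by simp
  then show ?thesis using card_edges_ge[OF G] n2 by simp
qed

lemma card_edges: "card (edges G) = m"
  using edges_eq card_image[OF inj_E] by simp

text \<open>Edge \<open>e\<close> contributes the half-edges \<open>e\<close>, leaving its first endpoint, and \<open>m + e\<close>.\<close>

fun adj_upto :: "nat \<Rightarrow> nat \<Rightarrow> nat list" where
  "adj_upto 0 v = []"
| "adj_upto (Suc k) v = (if v = dst k then [m + Suc k] else []) @ (if v = src k then [Suc k] else []) @ adj_upto k v"

lemma set_adj_upto: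
  "set (adj_upto k v) = {Suc i | i. i < k \<and> src i = v} \<union> {m + Suc i | i. i < k \<and> dst i = v}"
proof (induction k)
  case (Suc k)
  show ?case unfolding adj_upto.simps set_append Suc by (auto simp: less_Suc_eq)
qed simp

definition half_target :: "nat \<Rightarrow> nat" where
  "half_target h = (if h \<le> m then dst (h - 1) else src (h - m - 1))"

definition half_edge :: "nat \<Rightarrow> nat" where
  "half_edge h = (if h \<le> m then h else h - m)"

lemma distinct_adj_upto: "k \<le> m \<Longrightarrow> distinct (map half_edge (adj_upto k v))"
proof (induction k)
  case (Suc k)
  have "Suc k \<notin> half_edge ` set (adj_upto k v)"
    using Suc.prems by (auto simp: set_adj_upto half_edge_def)
  then show ?case
    using Suc ends(3)[of k] by (auto simp: half_edge_def)
qed simp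

lemma adj_upto_edges:
  assumes "k \<le> m"
  shows "half_edge ` set (adj_upto k v) = {e \<in> {1..k}. v \<in> E e}"
proof -
  have "half_edge ` set (adj_upto k v) = {Suc i | i. i < k \<and> src i = v} \<union> {Suc i | i. i < k \<and> dst i = v}"
  proof -
    have "half_edge ` {Suc i | i. i < k \<and> src i = v} = {Suc i | i. i < k \<and> src i = v}"
      using assms by (force simp: half_edge_def image_iff)
    moreover have "half_edge ` {m + Suc i | i. i < k \<and> dst i = v} = {Suc i | i. i < k \<and> dst i = v}"
      using assms by (force simp: half_edge_def image_iff)
    ultimately show ?thesis unfolding set_adj_upto image_Un by simp
  qed
  also have "\<dots> = {e \<in> {1..k}. v \<in> E e}"
  proof (intro set_eqI)
    fix e
    show "e \<in> {Suc i | i. i < k \<and> src i = v} \<union> {Suc i | i. i < k \<and> dst i = v} \<longleftrightarrow> e \<in> {e \<in> {1..k}. v \<in> E e}"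
      by (cases e) (auto simp: E_def)
  qed
  finally show ?thesis .
qed

lemma adj_upto_target:
  assumes "h \<in> set (adj_upto m v)"
  shows "E (half_edge h) = {v, half_target h}" "h \<in> {1..m} \<union> {Suc m..m + m}"
  using assms by (auto simp: set_adj_upto half_edge_def half_target_def E_def)

lemma sum_length_adj_upto: "k \<le> m \<Longrightarrow> (\<Sum>v\<in>verts G. length (adj_upto k v)) = 2 * k"
proof (induction k)
  case (Suc k)
  have k: "k < m" using Suc.prems by simp
  have "(\<Sum>v\<in>verts G. length (adj_upto (Suc k) v)) =
      (\<Sum>v\<in>verts G. if v = dst k then 1 else 0) + (\<Sum>v\<in>verts G. if v = src k then 1 else 0) + (\<Sum>v\<in>verts G. length (adj_upto k v))"
    by (simp add: sum.distrib[symmetric]) (rule sum.cong, auto)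
  also have "(\<Sum>v\<in>verts G. if v = dst k then 1 else 0) = (1::nat)"
    using ends(2)[OF k] input_graph_facts(1)[OF G] by simp
  also have "(\<Sum>v\<in>verts G. if v = src k then 1 else 0) = (1::nat)"
    using ends(1)[OF k] input_graph_facts(1)[OF G] by simp
  finally show ?case using Suc by simp
qed simp

definition c :: real where "c = eps_step (nverts G) \<epsilon> \<delta>"

sublocale kruskal_clocks G E "{1..m}" c
  by unfold_locales (fact G inj_E edges_eq | simp)+

definition key :: "(nat \<Rightarrow> real) \<Rightarrow> nat \<Rightarrow> real" where
  "key \<omega> e = clock_of (rate e) (\<omega> (e - 1))"

definition build_inv :: "(nat \<Rightarrow> real) \<Rightarrow> ram_state \<Rightarrow> nat \<Rightarrow> bool" where
  "build_inv \<omega> s k \<longleftrightarrow> k \<le> m \<and> nmem s 5 5 = k \<and> drawn s = k \<and>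
     nmem s 0 0 = nverts G \<and> nmem s 0 1 = m \<and>
     (\<forall>i<m. nmem s 1 i = src i \<and> nmem s 2 i = dst i \<and> rmem s 1 i = weight G (E (Suc i))) \<and>
     rmem s 3 0 = c / 2 \<and>
     (\<forall>v. chain (nmem s 7) (nmem s 6 v) (adj_upto k v)) \<and>
     (\<forall>i<k. nmem s 8 (Suc i) = dst i \<and> nmem s 8 (Suc (m + i)) = src i \<and>
            nmem s 9 (Suc i) = Suc i \<and> nmem s 9 (Suc (m + i)) = Suc i \<and> rmem s 2 (Suc i) = key \<omega> (Suc i)) \<and>
     (\<forall>a\<in>{10..17}. nmem s a = (\<lambda>_. 0)) \<and> nmem s 5 1 = 0 \<and> nmem s 5 2 = 0 \<and> nmem s 5 3 = 0"

lemma build_inv_init: "build_inv \<omega> (sem \<omega> half_eps (input_state \<epsilon> \<delta> G es)) 0"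
  by (simp add: build_inv_def half_eps_def Let_def input_state_def c_def eps_step_def rho_param_def power2_eq_square E_def)

text \<open>The body without the two list insertions. Evaluating the three pieces one at a time
  keeps the memory terms readable.\<close>

definition build_prefix :: com where
  "build_prefix = seqs [
     inc vE,
     Sample 2 (val vE),
     RSet 2 (val vE) (RMul (RSub (RNat (NLit 0)) (RLn (RGet 2 (val vE))))
       (RExp (RMul (RGet 3 (NLit 0)) (RGet 1 (NSub (val vE) (NLit 1)))))),
     assign vU (NGet 1 (NSub (val vE) (NLit 1))),
     assign vV (NGet 2 (NSub (val vE) (NLit 1)))]"

lemma build_step:
  assumes "build_inv \<omega> s k" "k < m"
  shows "build_inv \<omega> (sem \<omega> build_body s) (Suc k)"
proof -
  let ?s' = "sem \<omega> build_body s"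
  note b = assms(1)[unfolded build_inv_def]
  have b1: "nmem s 5 5 = k" "drawn s = k" "nmem s 0 1 = m" "nmem s 1 k = src k" "nmem s 2 k = dst k"
    "rmem s 1 k = weight G (E (Suc k))" "rmem s 3 0 = c / 2"
    using b assms(2) by auto
  have chains: "\<And>v. chain (nmem s 7) (nmem s 6 v) (adj_upto k v)" using b by blast
  have old: "\<And>i. i < k \<Longrightarrow> nmem s 8 (Suc i) = dst i \<and> nmem s 8 (Suc (m + i)) = src i \<and>
            nmem s 9 (Suc i) = Suc i \<and> nmem s 9 (Suc (m + i)) = Suc i \<and> rmem s 2 (Suc i) = key \<omega> (Suc i)"
    using b by blast
  have ne: "src k \<noteq> dst k" by (rule ends(3)[OF assms(2)])
  define s1 where "s1 = sem \<omega> (build_prefix) s"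
  define s2 where "s2 = sem \<omega> (add_half_edge (val vE) (val vU) (val vV)) s1"
  have s'_eq: "?s' = sem \<omega> (add_half_edge (NAdd m_in (val vE)) (val vV) (val vU)) s2"
    unfolding s2_def s1_def build_body_def build_prefix_def by (simp only: seqs.simps sem.simps(4))
  have s1: "nmem s1 = (nmem s)(5 := (nmem s 5)(5 := Suc k, 6 := src k, 10 := dst k))"
    "rmem s1 = (rmem s)(2 := (rmem s 2)(Suc k := (0 - ln (\<omega> k)) * exp (c / 2 * weight G (E (Suc k)))))" "drawn s1 = Suc k"
    using b1(1-6) by (simp_all add: s1_def build_prefix_def b1(7))
  have s2: "nmem s2 = (nmem s1)(7 := (nmem s1 7)(Suc k := nmem s1 6 (src k)), 6 := (nmem s1 6)(src k := Suc k),
      8 := (nmem s1 8)(Suc k := dst k), 9 := (nmem s1 9)(Suc k := Suc k))" "rmem s2 = rmem s1" "drawn s2 = drawn s1"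
  proof -
    have "nmem s1 5 5 = Suc k" "nmem s1 5 6 = src k" "nmem s1 5 10 = dst k" by (simp_all add: s1)
    then show "nmem s2 = (nmem s1)(7 := (nmem s1 7)(Suc k := nmem s1 6 (src k)), 6 := (nmem s1 6)(src k := Suc k),
      8 := (nmem s1 8)(Suc k := dst k), 9 := (nmem s1 9)(Suc k := Suc k))" "rmem s2 = rmem s1" "drawn s2 = drawn s1"
      by (simp_all add: s2_def add_half_edge_def)
  qed
  have s': "nmem ?s' = (nmem s2)(7 := (nmem s2 7)(m + Suc k := nmem s2 6 (dst k)), 6 := (nmem s2 6)(dst k := m + Suc k),
      8 := (nmem s2 8)(m + Suc k := src k), 9 := (nmem s2 9)(m + Suc k := Suc k))" "rmem ?s' = rmem s2" "drawn ?s' = drawn s2"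
  proof -
    have "nmem s2 5 5 = Suc k" "nmem s2 5 6 = src k" "nmem s2 5 10 = dst k" "nmem s2 0 1 = m"
      using b1 by (simp_all add: s1 s2)
    then show "nmem ?s' = (nmem s2)(7 := (nmem s2 7)(m + Suc k := nmem s2 6 (dst k)), 6 := (nmem s2 6)(dst k := m + Suc k),
      8 := (nmem s2 8)(m + Suc k := src k), 9 := (nmem s2 9)(m + Suc k := Suc k))" "rmem ?s' = rmem s2" "drawn ?s' = drawn s2"
      unfolding s'_eq by (simp_all add: add_half_edge_def)
  qed
  have n': "nmem ?s' 5 5 = Suc k" "nmem ?s' 5 1 = nmem s 5 1" "nmem ?s' 5 2 = nmem s 5 2" "nmem ?s' 5 3 = nmem s 5 3"
      "nmem ?s' 7 = (nmem s 7)(Suc k := nmem s 6 (src k), m + Suc k := nmem s 6 (dst k))"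
      "nmem ?s' 6 = (nmem s 6)(src k := Suc k, dst k := m + Suc k)"
      "nmem ?s' 8 = (nmem s 8)(Suc k := dst k, m + Suc k := src k)"
      "nmem ?s' 9 = (nmem s 9)(Suc k := Suc k, m + Suc k := Suc k)"
      "\<And>a. a \<noteq> 5 \<Longrightarrow> a \<noteq> 6 \<Longrightarrow> a \<noteq> 7 \<Longrightarrow> a \<noteq> 8 \<Longrightarrow> a \<noteq> 9 \<Longrightarrow> nmem ?s' a = nmem s a"
    using ne unfolding s' s2 s1 by simp_all
  have r': "rmem ?s' = (rmem s)(2 := (rmem s 2)(Suc k := (0 - ln (\<omega> k)) * exp (c / 2 * weight G (E (Suc k)))))"
    "drawn ?s' = Suc k"
    unfolding s' s2 s1 by simp_all
  \<comment> \<open>The program multiplies by the inverse rate where \<open>clock_of\<close> divides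
    by the rate.\<close>
  have key: "(0 - ln (\<omega> k)) * exp (c / 2 * weight G (E (Suc k))) = key \<omega> (Suc k)"
  proof -
    have "rate (Suc k) = inverse (exp (c / 2 * weight G (E (Suc k))))"
      unfolding rate_def exp_minus[symmetric] by simp
    then show ?thesis by (simp only: key_def clock_of_def diff_Suc_1 divide_inverse inverse_inverse_eq diff_0)
  qed
  \<comment> \<open>The two new half-edges occur in no earlier list, so overwriting their successor
    cells leaves the old chains intact.\<close>
  have notin: "Suc k \<notin> set (adj_upto k v)" "m + Suc k \<notin> set (adj_upto k v)" for v
    using assms(2) by (auto simp: set_adj_upto)
  have mk: "m + Suc k \<noteq> Suc k" using assms(2) by linarith
  have chains': "chain (nmem ?s' 7) (nmem ?s' 6 v) (adj_upto (Suc k) v)" for v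
  proof -
    have 1: "chain (nmem ?s' 7) (nmem s 6 v) (adj_upto k v)" for v
      unfolding n'(5) chain_upd[OF notin(2)] chain_upd[OF notin(1)] by (rule chains)
    have 2: "nmem ?s' 7 (Suc k) = nmem s 6 (src k)" "nmem ?s' 7 (m + Suc k) = nmem s 6 (dst k)"
      using mk by (simp_all add: n')
    consider "v = dst k" | "v = src k" | "v \<noteq> dst k" "v \<noteq> src k" by blast
    then show ?thesis
    proof cases
      case 1
      then have "nmem ?s' 6 v = m + Suc k" by (simp add: n')
      then show ?thesis using 1 ne 2(2) \<open>\<And>v. chain (nmem ?s' 7) (nmem s 6 v) (adj_upto k v)\<close> by simp
    next
      case 2
      then have "nmem ?s' 6 v = Suc k" using ne by (simp add: n')
      then show ?thesis using 2 ne \<open>nmem ?s' 7 (Suc k) = _\<close> \<open>\<And>v. chain (nmem ?s' 7) (nmem s 6 v) (adj_upto k v)\<close> by simp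
    next
      case 3
      then have "nmem ?s' 6 v = nmem s 6 v" by (simp add: n')
      then show ?thesis using 3 1[of v] by simp
    qed
  qed
  have new: "nmem ?s' 8 (Suc i) = dst i \<and> nmem ?s' 8 (Suc (m + i)) = src i \<and>
      nmem ?s' 9 (Suc i) = Suc i \<and> nmem ?s' 9 (Suc (m + i)) = Suc i \<and> rmem ?s' 2 (Suc i) = key \<omega> (Suc i)"
    if "i < Suc k" for i
  proof (cases "i = k")
    case True
    then show ?thesis using mk key by (simp add: n' r')
  next
    case False
    then have "i < k" using that by simp
    then show ?thesis using old[of i] assms(2) by (simp add: n' r')
  qed
  show ?thesis
    unfolding build_inv_def
  proof (intro conjI allI impI chains')
    fix i assume "i < Suc k"
    from new[OF this] show "nmem ?s' 8 (Suc i) = dst i" "nmem ?s' 8 (Suc (m + i)) = src i"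
      "nmem ?s' 9 (Suc i) = Suc i" "nmem ?s' 9 (Suc (m + i)) = Suc i" "rmem ?s' 2 (Suc i) = key \<omega> (Suc i)" by simp_all
  next
    show "\<forall>a\<in>{10..17}. nmem ?s' a = (\<lambda>_. 0)"
    proof
      fix a :: nat assume a: "a \<in> {10..17}"
      have "nmem ?s' a = nmem s a" by (rule n'(9)) (use a in auto)
      then show "nmem ?s' a = (\<lambda>_. 0)" using b a by metis
    qed
  qed (use b assms(2) in \<open>simp_all add: n' n'(2)[unfolded One_nat_def] r'\<close>)
qed

lemma cost_build_body: "cost build_body = 13" "loop_free build_body"
  by (simp_all add: build_body_def add_half_edge_def)

lemma wp_build:
  assumes "build_inv \<omega> s 0" "14 * m + rest < t"
    and Q: "\<And>s' t'. build_inv \<omega> s' m \<Longrightarrow> rest \<le> t' \<Longrightarrow> Q s' t'"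
  shows "wp \<omega> build Q s t"
  unfolding build_def
proof (rule wp_While[where I = "\<lambda>s t. \<exists>k. build_inv \<omega> s k \<and> 14 * (m - k) + rest < t"])
  show "\<exists>k. build_inv \<omega> s k \<and> 14 * (m - k) + rest < t"
    using assms(1,2) by (intro exI[of _ 0]) simp
next
  fix s t assume "\<exists>k. build_inv \<omega> s k \<and> 14 * (m - k) + rest < t" and b: "bval (NLess (val vE) m_in) s"
  then obtain k where k: "build_inv \<omega> s k" "14 * (m - k) + rest < t" by blast
  have km: "k < m" using b k(1) by (simp add: build_inv_def)
  then have mk: "m - k = Suc (m - Suc k)" by simp
  have le: "14 * (m - Suc k) + rest + 14 < t" using k(2) unfolding mk by simp
  show "wp \<omega> build_body (\<lambda>s t. \<exists>k. build_inv \<omega> s k \<and> 14 * (m - k) + rest < t) s (t - 1)"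
  proof (rule wp_loop_free)
    show "\<exists>k. build_inv \<omega> (sem \<omega> build_body s) k \<and> 14 * (m - k) + rest < t - 1 - cost build_body"
      using build_step[OF k(1) km] le by (intro exI[of _ "Suc k"]) (simp add: cost_build_body)
    show "cost build_body \<le> t - 1" using le by (simp add: cost_build_body)
  qed (rule cost_build_body)
next
  fix s t assume "\<exists>k. build_inv \<omega> s k \<and> 14 * (m - k) + rest < t" and b: "\<not> bval (NLess (val vE) m_in) s"
  then obtain k where k: "build_inv \<omega> s k" "14 * (m - k) + rest < t" by blast
  have "k = m" using b k(1) by (simp add: build_inv_def)
  then show "Q s (t - 1)" using k by (intro Q) auto
qed auto

lemma msf_cong:
  assumes "\<And>i. i \<in> {1..m} \<Longrightarrow> x i = y i"
  shows "msf x = msf y"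
proof -
  have "clock_less x i j = clock_less y i j" if "i \<in> {1..m}" "j \<in> {1..m}" for i j
    using assms that by (simp add: clock_less_def)
  then have "{j \<in> {1..m}. clock_less x j i} = {j \<in> {1..m}. clock_less y j i}" if "i \<in> {1..m}" for i
    using that by auto
  then show ?thesis
    unfolding msf_def by (intro arg_cong[where f = "image E"] Collect_cong conj_cong refl) simp
qed

section \<open>Step count and output law of the program\<close>

definition log_bound :: nat where
  "log_bound = (LEAST k. m < 2 ^ k)"

text \<open>Minimality gives \<open>2 ^ k <= m <= n * n\<close> for k = \<open>log_bound\<close> -
  1. With \<open>ln 2 >= 1 / 2\<close> this yields k <= 4 ln n, and the missing 1 is at most 2 ln
  n.\<close>

lemma log_bound: "m < 2 ^ log_bound" "real log_bound \<le> 6 * ln (real (nverts G))"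
proof -
  show 1: "m < 2 ^ log_bound"
    unfolding log_bound_def by (rule LeastI[of _ m]) (rule less_exp)
  have "log_bound \<noteq> 0"
  proof
    assume "log_bound = 0"
    then show False using 1 m_pos by simp
  qed
  then obtain k where k: "log_bound = Suc k" by (cases log_bound) auto
  have "\<not> m < 2 ^ k"
    using not_less_Least[of k "\<lambda>k. m < 2 ^ k"] k unfolding log_bound_def by simp
  then have "2 ^ k \<le> m" by simp
  also have "m \<le> nverts G * nverts G" using card_edges_le[OF G] card_edges by simp
  finally have "real (2 ^ k) \<le> real (nverts G * nverts G)" by (rule of_nat_mono)
  then have "2 ^ k \<le> real (nverts G) * real (nverts G)" by simp
  then have "ln (2 ^ k) \<le> ln (real (nverts G) * real (nverts G))"
    using n2 by (subst ln_le_cancel_iff) auto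
  then have le: "real k * ln 2 \<le> 2 * ln (real (nverts G))"
    using n2 by (simp add: ln_mult ln_realpow)
  have ln2: "ln (2::real) \<ge> 1 / 2"
    using ln_2_ge by simp
  have "real k * (1 / 2) \<le> real k * ln 2" using ln2 by (intro mult_left_mono) auto
  then have "real k \<le> 4 * ln (real (nverts G))" using le by simp
  moreover have "ln 2 \<le> ln (real (nverts G))" using n2 by simp
  ultimately show "real log_bound \<le> 6 * ln (real (nverts G))"
    using ln2 by (simp add: k)
qed

text \<open>314 = 14 + 2 * 150: building an edge costs 13 steps and a test, and each edge is scanned
  as two half-edges. \<open>2 * log_bound\<close> is the rank bound \<open>M\<close>.\<close>

definition time :: nat where
  "time = 314 * m + (nverts G - 1) * (74 * (2 * log_bound) + 20) + 6"

lemma wp_private_prim: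
  "wp \<omega> private_prim (\<lambda>s t. output_edges G s = msf (key \<omega>)) (input_state \<epsilon> \<delta> G es) time"
  unfolding private_prim_def
proof (rule wp_Seq, rule wp_loop_free)
  define r where "r = 300 * m + (nverts G - 1) * (74 * (2 * log_bound) + 20) + 4"
  let ?rest = "Seq (assign vX (NLit 1)) (Seq (NSet 10 (NLit 1) (NLit 1)) prim)"
  show "wp \<omega> (Seq build ?rest) (\<lambda>s t. output_edges G s = msf (key \<omega>))
      (sem \<omega> half_eps (input_state \<epsilon> \<delta> G es)) (time - cost half_eps)"
  proof (rule wp_Seq, rule wp_build[where rest = r, OF build_inv_init])
    show "14 * m + r < time - cost half_eps"
      by (simp add: time_def r_def half_eps_def Let_def)
    fix s t assume b: "build_inv \<omega> s m" and t: "r \<le> t"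
    let ?c = "Seq (assign vX (NLit 1)) (NSet 10 (NLit 1) (NLit 1))"
    define s1 where "s1 = sem \<omega> (NSet 10 (NLit 1) (NLit 1)) (sem \<omega> (assign vX (NLit 1)) s)"
    note b' = b[unfolded build_inv_def]
    have keys: "\<And>i. i < m \<Longrightarrow> rmem s 2 (Suc i) = key \<omega> (Suc i)"
      using b' by blast
    have zero: "nmem s 10 = (\<lambda>_. 0)" "nmem s 11 = (\<lambda>_. 0)" "nmem s 13 = (\<lambda>_. 0)" "nmem s 14 = (\<lambda>_. 0)"
      "nmem s 17 = (\<lambda>_. 0)"
      using b' by auto
    have s1: "nmem s1 = (nmem s)(5 := (nmem s 5)(0 := 1), 10 := (\<lambda>_. 0)(1 := 1))" "rmem s1 = rmem s"
      by (auto simp: s1_def zero(1) fun_eq_iff)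
    have half: "nmem s 8 h = half_target h \<and> nmem s 9 h = half_edge h" if h: "h \<in> {1..m} \<union> {Suc m..m + m}" for h
    proof (cases "h \<le> m")
      case True
      define i where "i = h - 1"
      have "h = Suc i" "i < m" using h True by (auto simp: i_def)
      then show ?thesis using b' True by (simp add: half_target_def half_edge_def)
    next
      case False
      define i where "i = h - m - 1"
      have "h = Suc (m + i)" "i < m" using h False by (auto simp: i_def)
      then show ?thesis using b' False by (simp add: half_target_def half_edge_def)
    qed
    interpret prim_run "clock_less (rmem s 2)" "2 * log_bound" m G E "adj_upto m" "nmem s 8" "nmem s 9"
    proof unfold_locales
      show "\<not> clock_less (rmem s 2) a a" for a by (rule clock_less_order(1))
      show "clock_less (rmem s 2) a b \<Longrightarrow> clock_less (rmem s 2) b d \<Longrightarrow> clock_less (rmem s 2) a d" for a b d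
        by (rule clock_less_order(2))
      show "a \<noteq> b \<Longrightarrow> clock_less (rmem s 2) a b \<or> clock_less (rmem s 2) b a" for a b
        by (rule clock_less_order(3))
      show "r < 2 * log_bound" if "2 ^ (r div 2) \<le> m" for r
      proof -
        have "(2::nat) ^ (r div 2) < 2 ^ log_bound" using that log_bound(1) by (rule le_less_trans)
        then have "r div 2 < log_bound" by simp
        then show ?thesis by linarith
      qed
      fix v assume "v \<in> verts G"
      have eq: "map (nmem s 9) (adj_upto m v) = map half_edge (adj_upto m v)"
        using half adj_upto_target(2) by (intro map_cong) auto
      show "distinct (map (nmem s 9) (adj_upto m v))"
        unfolding eq by (rule distinct_adj_upto) simp
      have "nmem s 9 ` set (adj_upto m v) = half_edge ` set (adj_upto m v)"
        using arg_cong[OF eq, of set] by simp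
      then show "nmem s 9 ` set (adj_upto m v) = {e \<in> {1..m}. v \<in> E e}"
        using adj_upto_edges[of m v] by simp
      fix h assume h: "h \<in> set (adj_upto m v)"
      show "E (nmem s 9 h) = {v, nmem s 8 h}"
        using half[OF adj_upto_target(2)[OF h]] adj_upto_target(1)[OF h] by simp
    qed
    have prim_s1: "prim_inv s1 0 (t - 2)"
      unfolding prim_inv_def
    proof (intro exI conjI)
      have v1: "1 \<in> verts G" using n2 by (simp add: verts_def)
      show "heap_at s1 {} {} (\<lambda>_. [])"
        using inv_init[of "\<lambda>_. []" "nmem s 12" "nmem s 15"] b' by (simp add: heap_at_def s1 zero)
      show "nmem s1 5 3 = 0" using b' by (simp add: s1)
      show "graph_at s1"
        unfolding graph_at_def
      proof (intro conjI ballI)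
        show "chain (nmem s1 7) (nmem s1 6 v) (adj_upto m v)" for v using b' by (simp add: s1)
        show "nmem s1 8 = nmem s 8" "nmem s1 9 = nmem s 9" "nmem s1 0 0 = nverts G"
          using b' by (simp_all add: s1)
        fix e assume "e \<in> {1..m}"
        then have "e - 1 < m" by auto
        then show "E e = {nmem s1 1 (e - 1), nmem s1 2 (e - 1)}" using b' by (simp add: s1 E_def)
      qed
      show "tree_inv s1 {1}"
        using b' v1 by (simp add: tree_inv_def outs_def s1)
      have t0: "touched ({1} - {nmem s1 5 0}) = {}" by (simp add: touched_def s1)
      show "cut_inv s1 {1} (touched ({1} - {nmem s1 5 0})) {}"
        unfolding t0 by (rule cut_invI) (auto simp: s1 zero)
      \<comment> \<open>The start vertex is in the tree but unscanned, so all adjacency lists, 2 m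
        half-edges in total, are charged.\<close>
      have "insert (nmem s1 5 0) (verts G - {1}) = verts G" using v1 by (auto simp: s1)
      then show "16 * pot s1 {} (\<lambda>_. []) + 150 * (\<Sum>v\<in>insert (nmem s1 5 0) (verts G - {1}). length (adj_upto m v)) +
          (nverts G - 1 - nmem s1 5 1) * (74 * (2 * log_bound) + 20) + 0 < t - 2"
        using t b' sum_length_adj_upto[of m] by (simp add: pot_def s1 zero r_def potential_init)
    qed
    \<comment> \<open>Array and \<open>key\<close> need only agree on the edge numbers; other cells
      do not influence the tree.\<close>
    have "msf (rmem s 2) = msf (key \<omega>)"
    proof (rule msf_cong)
      fix i assume "i \<in> {1..m}"
      then have "i - 1 < m" "Suc (i - 1) = i" by auto
      then show "rmem s 2 i = key \<omega> i" using keys[of "i - 1"] by simp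
    qed
    then have prim: "wp \<omega> prim (\<lambda>s t. output_edges G s = msf (key \<omega>)) s1 (t - 2)"
      by (intro wp_prim[OF prim_s1]) simp
    have t2: "t - cost (assign vX (NLit 1)) - cost (NSet 10 (NLit 1) (NLit 1)) = t - 2" by simp
    show "wp \<omega> ?rest (\<lambda>s t. output_edges G s = msf (key \<omega>)) s t"
    proof (rule wp_Seq, rule wp_loop_free)
      show "wp \<omega> (Seq (NSet 10 (NLit 1) (NLit 1)) prim) (\<lambda>s t. output_edges G s = msf (key \<omega>))
          (sem \<omega> (assign vX (NLit 1)) s) (t - cost (assign vX (NLit 1)))"
      proof (rule wp_Seq, rule wp_loop_free)
        show "wp \<omega> prim (\<lambda>s t. output_edges G s = msf (key \<omega>))
            (sem \<omega> (NSet 10 (NLit 1) (NLit 1)) (sem \<omega> (assign vX (NLit 1)) s))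
            (t - cost (assign vX (NLit 1)) - cost (NSet 10 (NLit 1) (NLit 1)))"
          using prim unfolding s1_def t2 .
      qed (use t in \<open>simp_all add: r_def\<close>)
    qed (use t in \<open>simp_all add: r_def\<close>)
  qed
qed (simp_all add: half_eps_def Let_def time_def)

text \<open>For n >= 2 constants are absorbed by 1 <= 2 ln n and 1 <= m. The coefficient of n ln n
  becomes 148 * 6 + 40 = 928 and that of m becomes 320.\<close>

lemma time_le: "real time \<le> 1000 * (real (card (edges G)) + real (nverts G) * ln (real (nverts G)))"
proof -
  define n where "n = real (nverts G)"
  define l where "l = ln n"
  have n: "n \<ge> 2" using n2 by (simp add: n_def)
  have l: "1 \<le> 2 * l"
  proof -
    have "ln 2 \<le> l" unfolding l_def using n by simp
    then show ?thesis using ln_2_ge by simp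
  qed
  have lb: "real log_bound \<le> 6 * l" using log_bound(2) by (simp add: l_def n_def)
  have "real time = 314 * real m + (n - 1) * (148 * real log_bound + 20) + 6"
    using n2 by (simp add: time_def n_def of_nat_diff)
  also have "\<dots> \<le> 314 * real m + n * (148 * (6 * l) + 20 * (2 * l)) + 6 * real m"
  proof (intro add_mono mult_mono)
    show "real log_bound \<le> 6 * l" by (rule lb)
    show "20 \<le> 20 * (2 * l)" using l by simp
    show "6 \<le> 6 * real m" using m_pos by simp
  qed (use n l in auto)
  also have "\<dots> = 320 * real m + 928 * (n * l)" by (simp add: algebra_simps)
  also have "\<dots> \<le> 1000 * (real m + n * l)"
    using n l by simp
  finally show ?thesis by (simp add: card_edges n_def l_def)
qed

lemma samples: 
  "\<exists>out \<in> tape_measure \<rightarrow>\<^sub>M count_space UNIV.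
     (\<forall>\<omega>. valid_tape \<omega> \<longrightarrow> (\<exists>k s. runs \<omega> private_prim (input_state \<epsilon> \<delta> G es) k s \<and>
        real k \<le> 1000 * (real (card (edges G)) + real (nverts G) * ln (real (nverts G))) \<and> output_edges G s = out \<omega>)) \<and>
     distr tape_measure (count_space UNIV) out = measure_pmf (private_kruskal \<epsilon> \<delta> G)"
proof (intro bexI conjI allI impI)
  let ?f = "\<lambda>\<omega>. \<lambda>i\<in>{1..m}. clock_of (rate i) (\<omega> (i - 1))"
  have rate_pos': "\<And>i. rate i > 0" by (simp add: rate_def)
  note f = distr_tape_clocks[where m = m, OF rate_pos']
  have msf_f: "msf (key \<omega>) = msf (?f \<omega>)" for \<omega>
    by (rule msf_cong) (simp add: key_def)
  have meas: "msf \<in> clocks \<rightarrow>\<^sub>M count_space UNIV"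
  proof (rule measurableI)
    fix Z
    have "msf -` Z \<inter> space clocks = {x \<in> space clocks. msf x \<in> Z}" by auto
    then show "msf -` Z \<inter> space clocks \<in> sets clocks" using msf_distribution(1)[of Z] by simp
  qed simp
  show out: "(\<lambda>\<omega>. msf (key \<omega>)) \<in> tape_measure \<rightarrow>\<^sub>M count_space UNIV"
    unfolding msf_f by (rule measurable_compose[OF f(1) meas])
  \<comment> \<open>The law is transported in two stages, from the tape to the clocks and from the
    clocks to the tree.\<close>
  have "distr tape_measure (count_space UNIV) (\<lambda>\<omega>. msf (key \<omega>)) = distr (distr tape_measure clocks ?f) (count_space UNIV) msf"
    unfolding msf_f by (subst distr_distr[OF meas f(1)]) (simp add: comp_def)
  also have "\<dots> = distr clocks (count_space UNIV) msf" by (simp only: f(2))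
  also have "\<dots> = measure_pmf (private_kruskal \<epsilon> \<delta> G)"
  proof (rule measure_eqI)
    fix Z assume "Z \<in> sets (distr clocks (count_space UNIV) msf)"
    have v: "msf -` Z \<inter> space clocks = {x \<in> space clocks. msf x \<in> Z}" by auto
    have "emeasure (distr clocks (count_space UNIV) msf) Z = emeasure clocks (msf -` Z \<inter> space clocks)"
      by (rule emeasure_distr[OF meas]) simp
    also have "\<dots> = emeasure clocks {x \<in> space clocks. msf x \<in> Z}"
      unfolding v ..
    also have "\<dots> = emeasure (measure_pmf (private_kruskal \<epsilon> \<delta> G)) Z"
      unfolding msf_distribution(2) by (simp add: private_kruskal_def c_def measure_pmf.emeasure_eq_measure)
    finally show "emeasure (distr clocks (count_space UNIV) msf) Z = emeasure (measure_pmf (private_kruskal \<epsilon> \<delta> G)) Z" .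
  qed simp
  finally show "distr tape_measure (count_space UNIV) (\<lambda>\<omega>. msf (key \<omega>)) = measure_pmf (private_kruskal \<epsilon> \<delta> G)" .
  fix \<omega>
  from wp_private_prim[of \<omega>] obtain k s t' where k: "runs \<omega> private_prim (input_state \<epsilon> \<delta> G es) k s"
    "k + t' \<le> time" "output_edges G s = msf (key \<omega>)"
    by (rule wpE)
  have "real k \<le> real time" using k(2) by simp
  then show "\<exists>k s. runs \<omega> private_prim (input_state \<epsilon> \<delta> G es) k s \<and>
      real k \<le> 1000 * (real (card (edges G)) + real (nverts G) * ln (real (nverts G))) \<and> output_edges G s = msf (key \<omega>)"
    using k(1,3) time_le by (intro exI[of _ k] exI[of _ s]) auto
qed

end

theorem theorem3p2:
  shows
    "(\<exists>P C. \<forall>G \<epsilon> \<delta>. input_graph G \<longrightarrow> nverts G \<ge> 2 \<longrightarrow> \<epsilon> > 0 \<longrightarrow> \<delta> > 0 \<longrightarrow>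
        samples_within P \<epsilon> \<delta> G (private_kruskal \<epsilon> \<delta> G)
          (C * (real (card (edges G)) + real (nverts G) * ln (real (nverts G)))))
     \<and> (\<forall>\<epsilon> \<delta>. \<epsilon> > 0 \<longrightarrow> \<delta> > 0 \<longrightarrow> differentially_private \<epsilon> \<delta> (private_kruskal \<epsilon> \<delta>))
     \<and> (\<forall>\<epsilon> \<delta> G. \<epsilon> > 0 \<longrightarrow> \<delta> > 0 \<longrightarrow> input_graph G \<longrightarrow>
          set_pmf (private_kruskal \<epsilon> \<delta> G) \<subseteq> spanning_trees G)
     \<and> (\<forall>K > 0. \<exists>C. \<forall>\<epsilon> \<delta> G Tstar.
          \<epsilon> > 0 \<longrightarrow> \<delta> > 0 \<longrightarrow> \<epsilon> \<le> K * ln (1 / \<delta>) \<longrightarrow> input_graph G \<longrightarrow> is_mst G Tstar \<longrightarrow>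
            measure_pmf.expectation (private_kruskal \<epsilon> \<delta> G) (\<lambda>T. \<Sum>e\<in>T. weight G e)
              - (\<Sum>e\<in>Tstar. weight G e)
            \<le> C * (1 / \<epsilon> * real (nverts G) powr (3 / 2) * ln (real (nverts G))
                     * sqrt (ln (1 / \<delta>))))"
proof (intro conjI)
  show "\<exists>P C. \<forall>G \<epsilon> \<delta>. input_graph G \<longrightarrow> nverts G \<ge> 2 \<longrightarrow> \<epsilon> > 0 \<longrightarrow> \<delta> > 0 \<longrightarrow>
      samples_within P \<epsilon> \<delta> G (private_kruskal \<epsilon> \<delta> G)
        (C * (real (card (edges G)) + real (nverts G) * ln (real (nverts G))))"
  proof (intro exI allI impI)
    \<comment> \<open>One program and the constant 1000 serve all graphs and parameters, which the
      program reads from its input.\<close>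
    fix G \<epsilon> \<delta> assume G: "input_graph G" "nverts G \<ge> 2"
    show "samples_within private_prim \<epsilon> \<delta> G (private_kruskal \<epsilon> \<delta> G)
        (1000 * (real (card (edges G)) + real (nverts G) * ln (real (nverts G))))"
      unfolding samples_within_def
    proof (intro allI impI)
      fix es assume "edge_listing G es"
      then interpret listed_graph G es \<epsilon> \<delta>
        using G by unfold_locales
      show "\<exists>out \<in> tape_measure \<rightarrow>\<^sub>M count_space UNIV.
         (\<forall>\<omega>. valid_tape \<omega> \<longrightarrow> (\<exists>k s. runs \<omega> private_prim (input_state \<epsilon> \<delta> G es) k s \<and>
            real k \<le> 1000 * (real (card (edges G)) + real (nverts G) * ln (real (nverts G))) \<and> output_edges G s = out \<omega>)) \<and>
         distr tape_measure (count_space UNIV) out = measure_pmf (private_kruskal \<epsilon> \<delta> G)"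
        by (rule samples)
    qed
  qed
  show "\<forall>\<epsilon> \<delta>. \<epsilon> > 0 \<longrightarrow> \<delta> > 0 \<longrightarrow> differentially_private \<epsilon> \<delta> (private_kruskal \<epsilon> \<delta>)"
    using private_kruskal_private by blast
  show "\<forall>\<epsilon> \<delta> G. \<epsilon> > 0 \<longrightarrow> \<delta> > 0 \<longrightarrow> input_graph G \<longrightarrow>
      set_pmf (private_kruskal \<epsilon> \<delta> G) \<subseteq> spanning_trees G"
    unfolding private_kruskal_def using set_kruskal_loop kruskal_state_init by blast
  show "\<forall>K > 0. \<exists>C. \<forall>\<epsilon> \<delta> G Tstar.
      \<epsilon> > 0 \<longrightarrow> \<delta> > 0 \<longrightarrow> \<epsilon> \<le> K * ln (1 / \<delta>) \<longrightarrow> input_graph G \<longrightarrow> is_mst G Tstar \<longrightarrow>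
        measure_pmf.expectation (private_kruskal \<epsilon> \<delta> G) (\<lambda>T. \<Sum>e\<in>T. weight G e)
          - (\<Sum>e\<in>Tstar. weight G e)
        \<le> C * (1 / \<epsilon> * real (nverts G) powr (3 / 2) * ln (real (nverts G)) * sqrt (ln (1 / \<delta>)))"
    \<comment> \<open>The witness is \<open>4 * (sqrt (K + 1) + 1)\<close>, which depends on
      \<open>K\<close> alone.\<close>
    by (intro allI impI exI, rule private_kruskal_utility) assumption+
qed

end
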